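(* Let $0\le\delta\le1/2$, and let $m=(m^1,m^2)$ be a Fourier multiplier on $\mathbb{R}^2$ that is homogeneous of degree $-1+2\delta$, not necessarily smooth away from $0$, with associated operator $\widehat{T^\ell\theta}(\xi)=m^\ell(\xi)\hat\theta(\xi)$. Assume there is a constant $C$ such that $$\left|\int_{\mathbb{R}^2}\phi\,T^\ell[\theta]\,\nabla_\ell\theta\,dx\right|\le C\,\|\mathring{\nabla}^2\phi\|_{L^\infty}\,\|\theta\|_{\dot H^{-1+\delta}}^2$$ for all $\phi\in C_c^\infty(\mathbb{R}^2)$ and $\theta\in\mathcal{S}_0(\mathbb{R}^2)$. Then $m^\ell$ is a constant multiple of the mSQG multiplier $-\epsilon^{\ell a}(i\xi_a)|\xi|^{2(-1+\delta)}$.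
   Context: Repeated indices are summed; $\epsilon^{j\ell}=-\epsilon^{\ell j}$, $\epsilon^{12}=1$. The components $m^\ell$ are homogeneous distributions away from the origin in frequency space (so that $m^\ell\hat\theta$ makes sense for $\theta\in\mathcal{S}_0$), and satisfy the reality condition $m(-\xi)=\overline{m(\xi)}$, so that $T^\ell\theta$ is real-valued whenever $\theta$ is. $\mathring{\nabla}^2_{j\ell}\phi=\nabla_j\nabla_\ell\phi-\tfrac12\Delta\phi\,\delta_{j\ell}$ is the trace-free part of the Hessian ($\delta_{j\ell}$ the Kronecker delta). $\mathcal{S}_0(\mathbb{R}^2)$ is the set of Schwartz functions $f$ for which $\mathrm{supp}\,\hat f$ is a compact subset of $\mathbb{R}^2\setminus\{0\}$. Littlewood–Paley projections: $P_{\le 0}$ has smooth symbol $\hat\chi_{\le0}$ equal to $1$ for $|\xi|\le1/2$ and supported in $|\xi|\le1$; $P_{\le q}$ has symbol $\hat\chi_{\le0}(2^{-q}\xi)$ and $P_q=P_{\le q+1}-P_{\le q}$, $q\in\mathbb{Z}$. The norm is $\|\theta\|_{\dot H^s}^2=\sum_{q}(2^{sq}\|P_q\theta\|_{L^2})^2$. *)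

theory Defs
  imports "HOL-Analysis.Analysis"
begin

type_synonym plane = "real^2"

section \<open>Smooth functions, test functions, Schwartz functions\<close>

definition partial :: "2 \<Rightarrow> (plane \<Rightarrow> 'a::real_normed_vector) \<Rightarrow> plane \<Rightarrow> 'a" where
  "partial j f x = frechet_derivative f (at x) (axis j 1)"

definition partials :: "2 list \<Rightarrow> (plane \<Rightarrow> 'a::real_normed_vector) \<Rightarrow> plane \<Rightarrow> 'a" where
  "partials js f = foldr partial js f"

text \<open>The Frechet derivative is unspecified where it does not exist, so differentiability of every
  iterated partial derivative is required explicitly.\<close>

definition smooth :: "(plane \<Rightarrow> 'a::real_normed_vector) \<Rightarrow> bool" where
  "smooth f \<longleftrightarrow> (\<forall>js x. partials js f differentiable (at x))"

definition supp :: "(plane \<Rightarrow> 'a::zero) \<Rightarrow> plane set" where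
  "supp f = closure {x. f x \<noteq> 0}"

definition test_functions :: "plane set \<Rightarrow> (plane \<Rightarrow> 'a::real_normed_vector) set" where
  "test_functions \<Omega> = {f. smooth f \<and> compact (supp f) \<and> supp f \<subseteq> \<Omega>}"

definition schwartz :: "(plane \<Rightarrow> complex) set" where
  "schwartz = {f. smooth f \<and> (\<forall>js k. bounded (range (\<lambda>x. norm x ^ k *\<^sub>R partials js f x)))}"

section \<open>Fourier transform\<close>

text \<open>The convention is the one for which \<^term>\<open>partial a\<close> has symbol \<open>\<i> \<xi>\<^sub>a\<close>.\<close>

definition fourier :: "(plane \<Rightarrow> complex) \<Rightarrow> plane \<Rightarrow> complex" where
  "fourier f \<xi> = (LINT x|lborel. cis (- (x \<bullet> \<xi>)) * f x)"

definition inv_fourier :: "(plane \<Rightarrow> complex) \<Rightarrow> plane \<Rightarrow> complex" where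
  "inv_fourier g x = of_real (1 / (2 * pi)\<^sup>2) * (LINT \<xi>|lborel. cis (x \<bullet> \<xi>) * g \<xi>)"

definition schwartz0 :: "(plane \<Rightarrow> complex) set" where
  "schwartz0 = {f \<in> schwartz. compact (supp (fourier f)) \<and> supp (fourier f) \<subseteq> - {0}}"

section \<open>Distributions and their use as Fourier multipliers\<close>

text \<open>A distribution on \<open>\<Omega>\<close> is a functional of which only the values on
  \<^term>\<open>test_functions \<Omega>\<close> are meaningful; the last clause is continuity, in its seminorm form.\<close>

definition distribution_on :: "plane set \<Rightarrow> ((plane \<Rightarrow> complex) \<Rightarrow> complex) \<Rightarrow> bool" where
  "distribution_on \<Omega> u \<longleftrightarrow>
     (\<forall>f \<in> test_functions \<Omega>. \<forall>g \<in> test_functions \<Omega>. u (\<lambda>x. f x + g x) = u f + u g) \<and>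
     (\<forall>f \<in> test_functions \<Omega>. \<forall>c. u (\<lambda>x. c * f x) = c * u f) \<and>
     (\<forall>K. compact K \<and> K \<subseteq> \<Omega> \<longrightarrow>
        (\<exists>A N. \<forall>f \<in> test_functions \<Omega>. supp f \<subseteq> K \<longrightarrow>
           norm (u f) \<le> A * (\<Sum>js | length js \<le> N. SUP x. norm (partials js f x))))"

definition dist_eq_on ::
    "plane set \<Rightarrow> ((plane \<Rightarrow> complex) \<Rightarrow> complex) \<Rightarrow> ((plane \<Rightarrow> complex) \<Rightarrow> complex) \<Rightarrow> bool" where
  "dist_eq_on \<Omega> u v \<longleftrightarrow> (\<forall>f \<in> test_functions \<Omega>. u f = v f)"

definition dist_of :: "(plane \<Rightarrow> complex) \<Rightarrow> (plane \<Rightarrow> complex) \<Rightarrow> complex" where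
  "dist_of g f = (LINT x|lborel. g x * f x)"

text \<open>\<open>u(r \<xi>) = r\<^sup>d u(\<xi>)\<close> for \<open>r > 0\<close>, in the weak sense; the change of variables in the plane
  contributes the factor \<open>r\<^sup>2\<close>.\<close>

definition homogeneous_dist :: "real \<Rightarrow> ((plane \<Rightarrow> complex) \<Rightarrow> complex) \<Rightarrow> bool" where
  "homogeneous_dist d u \<longleftrightarrow>
     (\<forall>r>0. \<forall>f \<in> test_functions (- {0}). u (\<lambda>\<xi>. f (\<xi> /\<^sub>R r)) = of_real (r powr (d + 2)) * u f)"

text \<open>\<open>u(-\<xi>)\<close> equals the complex conjugate of \<open>u(\<xi>)\<close>, in the weak sense.\<close>

definition reality_condition :: "((plane \<Rightarrow> complex) \<Rightarrow> complex) \<Rightarrow> bool" where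
  "reality_condition u \<longleftrightarrow>
     (\<forall>f \<in> test_functions (- {0}). u (\<lambda>\<xi>. f (- \<xi>)) = cnj (u (\<lambda>\<xi>. cnj (f \<xi>))))"

text \<open>For \<open>\<theta>\<close> in \<^term>\<open>schwartz0\<close>, the product of a distribution \<open>m\<close> on \<open>- {0}\<close> with the Fourier
  transform of \<open>\<theta>\<close> is a compactly supported distribution. Its inverse Fourier transform is the
  smooth function obtained by pairing it with \<open>\<xi> \<mapsto> cis (x \<bullet> \<xi>) / (2 \<pi>)\<^sup>2\<close>.\<close>

definition multiplier_op ::
    "((plane \<Rightarrow> complex) \<Rightarrow> complex) \<Rightarrow> (plane \<Rightarrow> complex) \<Rightarrow> plane \<Rightarrow> complex" where
  "multiplier_op m \<theta> x = of_real (1 / (2 * pi)\<^sup>2) * m (\<lambda>\<xi>. cis (x \<bullet> \<xi>) * fourier \<theta> \<xi>)"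

section \<open>Littlewood-Paley projections and the homogeneous Sobolev norm\<close>

definition lp_cutoff :: "(plane \<Rightarrow> complex) \<Rightarrow> bool" where
  "lp_cutoff \<psi> \<longleftrightarrow> smooth \<psi> \<and> (\<forall>\<xi>. norm \<xi> \<le> 1/2 \<longrightarrow> \<psi> \<xi> = 1) \<and> supp \<psi> \<subseteq> cball 0 1"

definition lp_le :: "(plane \<Rightarrow> complex) \<Rightarrow> int \<Rightarrow> (plane \<Rightarrow> complex) \<Rightarrow> plane \<Rightarrow> complex" where
  "lp_le \<psi> q f = inv_fourier (\<lambda>\<xi>. \<psi> ((2 powi (- q)) *\<^sub>R \<xi>) * fourier f \<xi>)"

definition lp_proj :: "(plane \<Rightarrow> complex) \<Rightarrow> int \<Rightarrow> (plane \<Rightarrow> complex) \<Rightarrow> plane \<Rightarrow> complex" where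
  "lp_proj \<psi> q f x = lp_le \<psi> (q + 1) f x - lp_le \<psi> q f x"

definition L2_norm :: "(plane \<Rightarrow> complex) \<Rightarrow> real" where
  "L2_norm f = sqrt (LINT x|lborel. (norm (f x))\<^sup>2)"

text \<open>For \<open>f\<close> in \<^term>\<open>schwartz0\<close> only finitely many terms of the sum are nonzero.\<close>

definition Hdot_norm :: "(plane \<Rightarrow> complex) \<Rightarrow> real \<Rightarrow> (plane \<Rightarrow> complex) \<Rightarrow> real" where
  "Hdot_norm \<psi> s f =
     sqrt (\<Sum>\<^sub>\<infinity>q\<in>(UNIV::int set). (2 powr (s * of_int q) * L2_norm (lp_proj \<psi> q f))\<^sup>2)"

section \<open>The trace-free Hessian and the mSQG multiplier\<close>

definition tf_hessian :: "(plane \<Rightarrow> real) \<Rightarrow> plane \<Rightarrow> real^2^2" where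
  "tf_hessian \<phi> x = (\<chi> j l. partial j (partial l \<phi>) x
     - 1/2 * (\<Sum>a\<in>UNIV. partial a (partial a \<phi>) x) * (if j = l then 1 else 0))"

text \<open>Used for continuous functions only, where the supremum is the essential supremum.\<close>

definition sup_norm :: "(plane \<Rightarrow> 'a::real_normed_vector) \<Rightarrow> real" where
  "sup_norm f = (SUP x. norm (f x))"

definition levi_civita :: "2 \<Rightarrow> 2 \<Rightarrow> real" where
  "levi_civita j l = (if j = 1 \<and> l = 2 then 1 else if j = 2 \<and> l = 1 then -1 else 0)"

definition msqg_mult :: "real \<Rightarrow> 2 \<Rightarrow> plane \<Rightarrow> complex" where
  "msqg_mult \<delta> l \<xi> =
     - (\<Sum>a\<in>UNIV. of_real (levi_civita l a) * (\<i> * of_real (\<xi> $ a)))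
       * of_real (norm \<xi> powr (2 * (-1 + \<delta>)))"

end

theory Submission
  imports Defs "HOL-Probability.Characteristic_Functions" "HOL-Probability.Sinc_Integral"
begin

text \<open>Truncating \<open>1 + |x - a|\<^sup>2\<close> logarithmically gives test functions \<open>\<phi>\<close> whose trace-free Hessian is
  uniformly small, so in the limit the bilinear form vanishes for \<open>\<phi> = 1 + |x - a|\<^sup>2\<close> itself. On the
  Fourier side, varying \<open>a\<close> and polarizing against a cutoff, this says that \<open>D = \<xi> \<cdot> m\<close> is odd, that
  \<open>m(\<xi>) + m(- \<xi>) = \<nabla>D\<close>, and that a second order identity holds. Contracting with \<open>\<xi>\<close> gives
  \<open>\<xi> \<cdot> \<nabla>D = 2 D\<close>; but \<open>D\<close> is homogeneous of degree \<open>2 \<delta> < 2\<close>, so \<open>D = 0\<close>. Hence \<open>m\<close> is odd, tangential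
  to circles and, by the second order identity, divergence free, so that its tangential component is
  invariant under rotations as well as homogeneous. Averaging over the multiplicative group of the
  complex plane shows that such a distribution is a constant multiple of a power of \<open>|\<xi>|\<close>, and the
  reality condition makes the constant real.\<close>

section \<open>Smoothness with parameters\<close>

text \<open>The obstacle is that \<open>m\<close> is only a distribution: no equation for it can be
  read pointwise, integrated along a ray or restricted to a circle. Each is stated on test
  functions, and motions are applied to the test function instead. This works because a distribution
  commutes with integration of a family of test functions over a box (\<open>box_integral\<close>);
  the calculus of families that are smooth in the point and continuous in a parameter exists to feed
  that fact.

  The polynomials \<open>1 + |x - a|^2\<close> are natural because their Hessian is a multiple of
  the identity. A cutoff at one spatial scale would leave a trace-free Hessian of order one, since
  two derivatives of the cutoff just compensate the quadratic growth; spreading it over all scales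
  up to \<open>exp (1 / p)\<close> gains the factor \<open>p\<close>.

  The hypothesis sees only real \<open>\<theta>\<close> and only the diagonal of a bilinear form, so
  the raw identities are quadratic in the Fourier transform. Pairing with a function equal to one
  near the support makes them linear, that is, equations between distributions.\<close>

lemma partial_eq:
  assumes "(f has_derivative f') (at x)"
  shows "partial j f x = f' (axis j 1)"
  using frechet_derivative_at[OF assms] by (simp add: partial_def)

lemma plane_sum_axis: "(h::plane) = (\<Sum>j\<in>UNIV. (h $ j) *\<^sub>R axis j 1)"
  by (simp add: vec_eq_iff axis_def if_distrib cong: if_cong)

lemma sum_axis:
  fixes c :: "2 \<Rightarrow> 'b::real_vector"
  shows "(\<Sum>j\<in>UNIV. ((axis k 1 :: plane) $ j) *\<^sub>R c j) = c k"
proof -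
  have "(\<Sum>j\<in>UNIV. ((axis k 1 :: plane) $ j) *\<^sub>R c j) = (\<Sum>j\<in>UNIV. if j = k then c j else 0)"
    by (rule sum.cong) (auto simp: axis_def)
  then show ?thesis by simp
qed

lemma has_derivative_partials:
  assumes "f differentiable (at x)"
  shows "(f has_derivative (\<lambda>h. \<Sum>j\<in>UNIV. (h $ j) *\<^sub>R partial j f x)) (at x)"
proof -
  from assms obtain f' where f': "(f has_derivative f') (at x)" by (auto simp: differentiable_def)
  interpret f': bounded_linear f' using f' by (rule has_derivative_bounded_linear)
  have "f' h = (\<Sum>j\<in>UNIV. (h $ j) *\<^sub>R partial j f x)" for h
  proof -
    have "f' h = f' (\<Sum>j\<in>UNIV. (h $ j) *\<^sub>R axis j 1)" by (simp flip: plane_sum_axis)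
    also have "\<dots> = (\<Sum>j\<in>UNIV. (h $ j) *\<^sub>R partial j f x)"
      by (simp add: f'.sum f'.scaleR partial_eq[OF f'])
    finally show ?thesis .
  qed
  then have "f' = (\<lambda>h. \<Sum>j\<in>UNIV. (h $ j) *\<^sub>R partial j f x)" by auto
  with f' show ?thesis by simp
qed

text \<open>Smooth functions of \<open>x\<close> that depend on a parameter: the partial derivatives in \<open>x\<close> are jointly
  continuous in \<open>(p, x)\<close>. Nothing is differentiated in \<open>p\<close>. In \<open>pC n\<close> only orders up to \<open>n\<close> count.\<close>

primrec pC :: "nat \<Rightarrow> 'p::topological_space set \<Rightarrow> ('p \<Rightarrow> plane \<Rightarrow> 'b::real_normed_vector) \<Rightarrow> bool" where
  "pC 0 P H \<longleftrightarrow> continuous_on (P \<times> UNIV) (\<lambda>(p, x). H p x)"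
| "pC (Suc n) P H \<longleftrightarrow> continuous_on (P \<times> UNIV) (\<lambda>(p, x). H p x) \<and>
     (\<forall>p\<in>P. \<forall>x. H p differentiable (at x)) \<and> (\<forall>j. pC n P (\<lambda>p. partial j (H p)))"

definition psm :: "'p::topological_space set \<Rightarrow> ('p \<Rightarrow> plane \<Rightarrow> 'b::real_normed_vector) \<Rightarrow> bool" where
  "psm P H \<longleftrightarrow> (\<forall>n. pC n P H)"

lemma pC_cong:
  assumes "\<And>p. p \<in> P \<Longrightarrow> H p = K p"
  shows "pC n P H = pC n P K"
  using assms
proof (induction n arbitrary: H K)
  case 0
  then show ?case by (auto intro!: continuous_on_cong)
next
  case (Suc n)
  have "continuous_on (P \<times> UNIV) (\<lambda>(p, x). H p x) = continuous_on (P \<times> UNIV) (\<lambda>(p, x). K p x)"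
    using Suc.prems by (auto intro!: continuous_on_cong)
  moreover have "pC n P (\<lambda>p. partial j (H p)) = pC n P (\<lambda>p. partial j (K p))" for j
    using Suc.prems by (intro Suc.IH) simp
  ultimately show ?case using Suc.prems by simp
qed

lemma psm_cong:
  assumes "\<And>p x. p \<in> P \<Longrightarrow> H p x = K p x"
  shows "psm P H = psm P K"
  unfolding psm_def using assms pC_cong[of P H K] by fastforce

lemma pC_continuous: "pC n P H \<Longrightarrow> continuous_on (P \<times> UNIV) (\<lambda>(p, x). H p x)"
  by (cases n) auto

lemma pC_Suc_imp: "pC (Suc n) P H \<Longrightarrow> pC n P H"
proof (induction n arbitrary: H)
  case (Suc n)
  then show ?case by (metis pC.simps(2))
qed simp

lemma pC_Suc: "pC (Suc n) P H \<longleftrightarrow> pC n P H \<and>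
     (\<forall>p\<in>P. \<forall>x. H p differentiable (at x)) \<and> (\<forall>j. pC n P (\<lambda>p. partial j (H p)))"
  using pC_Suc_imp pC_continuous by (metis pC.simps(2))

lemma psm_continuous: "psm P H \<Longrightarrow> continuous_on (P \<times> UNIV) (\<lambda>(p, x). H p x)"
  using pC_continuous psm_def by blast

lemma psm_differentiable: "psm P H \<Longrightarrow> p \<in> P \<Longrightarrow> H p differentiable (at x)"
  by (metis pC.simps(2) psm_def)

lemma psm_partial: "psm P H \<Longrightarrow> psm P (\<lambda>p. partial j (H p))"
  by (metis pC.simps(2) psm_def)

lemma psmI:
  assumes "continuous_on (P \<times> UNIV) (\<lambda>(p, x). H p x)"
    "\<And>p x. p \<in> P \<Longrightarrow> H p differentiable (at x)"
    "\<And>j. psm P (\<lambda>p. partial j (H p))"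
  shows "psm P H"
  unfolding psm_def
proof
  fix n show "pC n P H"
    using assms by (cases n) (auto simp: psm_def)
qed

lemma partials_Cons: "partials (j # js) f = partial j (partials js f)"
  by (simp add: partials_def)

lemma partials_Nil [simp]: "partials [] f = f"
  by (simp add: partials_def)

lemma partials_snoc: "partials (js @ [j]) f = partials js (partial j f)"
  by (simp add: partials_def)

lemma psm_partials: "psm P H \<Longrightarrow> psm P (\<lambda>p. partials js (H p))"
  by (induction js) (auto simp: partials_Cons intro: psm_partial)

text \<open>\<open>pC\<close> strips off the derivative next to \<open>H\<close>, whereas
  \<open>partials\<close> adds new ones on the outside; \<open>partials_snoc\<close> mediates
  between the two orders.\<close>

lemma psm_iff_partials:
  "psm P H \<longleftrightarrow> (\<forall>js. continuous_on (P \<times> UNIV) (\<lambda>(p, x). partials js (H p) x) \<and>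
     (\<forall>p\<in>P. \<forall>x. partials js (H p) differentiable (at x)))" (is "?L \<longleftrightarrow> ?R")
proof
  assume ?L
  then show ?R using psm_continuous[OF psm_partials] psm_differentiable[OF psm_partials] by blast
next
  have "pC n P H" if "?R" for n
    using that
  proof (induction n arbitrary: H)
    case 0
    then show ?case using 0[rule_format, of "[]"] by simp
  next
    case (Suc n)
    have "pC n P (\<lambda>p. partial j (H p))" for j
      by (rule Suc.IH) (simp only: flip: partials_snoc, use Suc.prems in blast)
    moreover have "continuous_on (P \<times> UNIV) (\<lambda>(p, x). H p x)" "\<forall>p\<in>P. \<forall>x. H p differentiable (at x)"
      using Suc.prems[rule_format, of "[]"] by simp_all
    ultimately show ?case by simp
  qed
  then show "?R \<Longrightarrow> ?L" by (simp add: psm_def)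
qed

lemma smooth_imp_psm:
  assumes "smooth f"
  shows "psm P (\<lambda>_. f)"
  unfolding psm_iff_partials
proof (intro allI conjI ballI)
  fix js :: "2 list" and x
  show d: "partials js f differentiable (at x)" for x using assms by (simp add: smooth_def)
  have "continuous_on UNIV (partials js f)"
    using d by (meson differentiable_imp_continuous_within continuous_at_imp_continuous_on)
  then have "continuous_on (P \<times> UNIV) (\<lambda>px. partials js f (snd px))"
    by (rule continuous_on_compose2) (auto intro: continuous_on_snd continuous_on_id)
  then show "continuous_on (P \<times> UNIV) (\<lambda>(p, x). partials js f x)" by (simp add: case_prod_beta)
qed

lemma psm_imp_smooth: "psm P H \<Longrightarrow> p \<in> P \<Longrightarrow> smooth (H p)"
  by (simp add: psm_iff_partials smooth_def)

text \<open>A one-point parameter space turns each closure property of parametric families into one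
  of single smooth functions, so the calculus is developed only once.\<close>

lemma smoothI_psm: "psm {0::real} (\<lambda>_. f) \<Longrightarrow> smooth f"
  using psm_imp_smooth by blast

lemma smooth_continuous_partials: "smooth f \<Longrightarrow> continuous_on A (partials js f)"
  by (meson smooth_def continuous_at_imp_continuous_on differentiable_imp_continuous_within)

lemma smooth_continuous: "smooth f \<Longrightarrow> continuous_on A f"
  using smooth_continuous_partials[of f A "[]"] by simp

lemma smooth_partial: "smooth f \<Longrightarrow> smooth (partial j f)"
  by (simp add: smooth_def flip: partials_snoc)

lemma smooth_differentiable: "smooth f \<Longrightarrow> f differentiable (at x)"
  unfolding smooth_def by (drule spec[where x="[]"]) simp

section \<open>Closure properties of parametric smooth families\<close>

lemma partial_const [simp]: "partial j (\<lambda>x. c) = (\<lambda>x. 0)"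
  by (auto intro!: ext partial_eq[THEN trans] derivative_eq_intros)

text \<open>Coefficients are constant in the point, so all their derivatives vanish and only
  continuity in the parameter is at stake. The density \<open>c\<close> of the convolution and the
  values of \<open>log_bump\<close> enter later in this way.\<close>

lemma psm_param:
  assumes "continuous_on P c"
  shows "psm P (\<lambda>p x. c p)"
proof -
  have z: "pC n P (\<lambda>p x. 0::'b)" for n by (induction n) (auto simp: case_prod_beta)
  have "continuous_on (P \<times> (UNIV::plane set)) (\<lambda>px. c (fst px))"
    by (rule continuous_on_compose2[OF assms]) (auto intro: continuous_on_fst continuous_on_id)
  then show ?thesis
    by - (rule psmI, auto simp: psm_def z case_prod_beta)
qed

lemma psm_const: "psm P (\<lambda>p x. c)"
  by (rule psm_param) simp

lemma partial_bounded_linear: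
  assumes "bounded_linear L" "f differentiable (at x)"
  shows "partial j (\<lambda>x. L (f x)) x = L (partial j f x)"
proof -
  interpret bounded_linear L by fact
  have "((\<lambda>x. L (f x)) has_derivative (\<lambda>h. L (\<Sum>j\<in>UNIV. (h $ j) *\<^sub>R partial j f x))) (at x)"
    by (rule has_derivative[OF has_derivative_partials[OF assms(2)]])
  from partial_eq[OF this, of j] show ?thesis
    by (simp add: axis_def if_distrib[of "\<lambda>c. c *\<^sub>R _"] cong: if_cong)
qed

lemma differentiable_bounded_linear:
  fixes f :: "plane \<Rightarrow> 'a::real_normed_vector"
  assumes "bounded_linear L" "f differentiable (at x)"
  shows "(\<lambda>x. L (f x)) differentiable (at x)"
  using bounded_linear.has_derivative[OF assms(1) has_derivative_partials[OF assms(2)]]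
  by (auto simp: differentiable_def)

lemma psm_bounded_linear:
  assumes L: "bounded_linear L" and "psm P H"
  shows "psm P (\<lambda>p x. L (H p x))"
proof -
  have "pC n P H \<Longrightarrow> pC n P (\<lambda>p x. L (H p x))" for n
  proof (induction n arbitrary: H)
    case 0
    then show ?case
      by (auto simp: case_prod_beta intro!: bounded_linear.continuous_on[OF L])
  next
    case (Suc n)
    then have d: "p \<in> P \<Longrightarrow> H p differentiable (at x)" for p x by simp
    have "pC n P (\<lambda>p. partial j (\<lambda>x. L (H p x)))" for j
    proof -
      have "pC n P (\<lambda>p x. L (partial j (H p) x))" using Suc by simp
      then show ?thesis
        by (rule pC_cong[THEN iffD1, rotated]) (auto simp: partial_bounded_linear[OF L] d)
    qed
    moreover have "continuous_on (P \<times> UNIV) (\<lambda>(p, x). L (H p x))"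
      using pC_continuous[OF Suc.prems] by (auto simp: case_prod_beta intro!: bounded_linear.continuous_on[OF L])
    ultimately show ?case using d by (simp add: differentiable_bounded_linear[OF L])
  qed
  then show ?thesis using assms by (simp add: psm_def)
qed

lemma partial_add:
  assumes "f differentiable (at x)" "g differentiable (at x)"
  shows "partial j (\<lambda>x. f x + g x) x = partial j f x + partial j g x"
proof -
  from partial_eq[OF has_derivative_add[OF assms[THEN has_derivative_partials]], of j] show ?thesis
    by (simp add: axis_def if_distrib[of "\<lambda>c. c *\<^sub>R _"] cong: if_cong)
qed

lemma pC_add: "pC n P H \<Longrightarrow> pC n P K \<Longrightarrow> pC n P (\<lambda>p x. H p x + K p x)"
proof (induction n arbitrary: H K)
  case 0
  then show ?case by (auto simp: case_prod_beta intro!: continuous_intros)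
next
  case (Suc n)
  then have d: "H p differentiable (at x)" "K p differentiable (at x)" if "p \<in> P" for p x using that by auto
  have "pC n P (\<lambda>p. partial j (\<lambda>x. H p x + K p x))" for j
  proof -
    have "pC n P (\<lambda>p x. partial j (H p) x + partial j (K p) x)" using Suc by simp
    then show ?thesis
      by (rule pC_cong[THEN iffD1, rotated]) (auto simp: partial_add d)
  qed
  moreover have "continuous_on (P \<times> UNIV) (\<lambda>(p, x). H p x + K p x)"
    using Suc.prems[THEN pC_continuous] by (auto simp: case_prod_beta intro!: continuous_intros)
  ultimately show ?case using d by auto
qed

lemma psm_add: "psm P H \<Longrightarrow> psm P K \<Longrightarrow> psm P (\<lambda>p x. H p x + K p x)"
  by (simp add: psm_def pC_add)

lemma psm_sum: "(\<And>i. i \<in> I \<Longrightarrow> psm P (H i)) \<Longrightarrow> psm P (\<lambda>p x. \<Sum>i\<in>I. H i p x)"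
  by (induction I rule: infinite_finite_induct) (auto intro: psm_const psm_add)

lemma pC_sum: "(\<And>i. i \<in> I \<Longrightarrow> pC n P (H i)) \<Longrightarrow> pC n P (\<lambda>p x. \<Sum>i\<in>I. H i p x)"
  by (induction I rule: infinite_finite_induct) (auto intro!: pC_add psm_const[unfolded psm_def, rule_format])

lemma partial_bilinear:
  assumes "bounded_bilinear B" "f differentiable (at x)" "g differentiable (at x)"
  shows "partial j (\<lambda>x. B (f x) (g x)) x = B (f x) (partial j g x) + B (partial j f x) (g x)"
proof -
  interpret bounded_bilinear B by fact
  from partial_eq[OF FDERIV[OF assms(2,3)[THEN has_derivative_partials]], of j] show ?thesis
    by (simp add: axis_def if_distrib[of "\<lambda>c. c *\<^sub>R _"] cong: if_cong)
qed

lemma differentiable_bilinear: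
  fixes f :: "plane \<Rightarrow> 'a::real_normed_vector" and g :: "plane \<Rightarrow> 'b::real_normed_vector"
  assumes "bounded_bilinear B" "f differentiable (at x)" "g differentiable (at x)"
  shows "(\<lambda>x. B (f x) (g x)) differentiable (at x)"
  using bounded_bilinear.FDERIV[OF assms(1) assms(2,3)[THEN has_derivative_partials]]
  by (auto simp: differentiable_def)

lemma pC_bilinear:
  assumes B: "bounded_bilinear B"
  shows "pC n P H \<Longrightarrow> pC n P K \<Longrightarrow> pC n P (\<lambda>p x. B (H p x) (K p x))"
proof (induction n arbitrary: H K)
  case 0
  then show ?case by (auto simp: case_prod_beta intro!: bounded_bilinear.continuous_on[OF B])
next
  case (Suc n)
  then have d: "H p differentiable (at x)" "K p differentiable (at x)" if "p \<in> P" for p x using that by auto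
  have "pC n P (\<lambda>p. partial j (\<lambda>x. B (H p x) (K p x)))" for j
  proof -
    have "pC n P (\<lambda>p x. B (H p x) (partial j (K p) x) + B (partial j (H p) x) (K p x))"
      using Suc.prems by (intro pC_add Suc.IH) (auto simp only: pC_Suc)
    then show ?thesis
      by (rule pC_cong[THEN iffD1, rotated]) (auto simp: partial_bilinear[OF B] d)
  qed
  moreover have "continuous_on (P \<times> UNIV) (\<lambda>(p, x). B (H p x) (K p x))"
    using Suc.prems[THEN pC_continuous]
    by (auto simp: case_prod_beta intro!: bounded_bilinear.continuous_on[OF B])
  ultimately show ?case using d by (auto simp: differentiable_bilinear[OF B])
qed

lemma psm_bilinear: "bounded_bilinear B \<Longrightarrow> psm P H \<Longrightarrow> psm P K \<Longrightarrow> psm P (\<lambda>p x. B (H p x) (K p x))"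
  by (simp add: psm_def pC_bilinear)

lemmas psm_mult = psm_bilinear[OF bounded_bilinear_mult]
lemmas psm_scaleR = psm_bilinear[OF bounded_bilinear_scaleR]
lemmas psm_of_real = psm_bounded_linear[OF bounded_linear_of_real]
lemmas psm_nth = psm_bounded_linear[OF bounded_linear_vec_nth]
lemmas psm_Re = psm_bounded_linear[OF bounded_linear_Re]
lemmas partial_mult = partial_bilinear[OF bounded_bilinear_mult]
lemmas partial_of_real = partial_bounded_linear[OF bounded_linear_of_real]

lemma partial_coord: "partial k (\<lambda>x::plane. x $ j) x = (if j = k then 1 else 0)"
  using partial_eq[OF bounded_linear.has_derivative[OF bounded_linear_vec_nth has_derivative_ident], of k j x]
  by (auto simp: axis_def)

text \<open>Expansion in the standard basis separates the variables: the point enters through its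
  coordinates, the parameter through the matrix entries. This serves both
  \<open>x \<bullet> \<xi>\<close> with parameter \<open>x\<close> and complex
  multiplication.\<close>

lemma psm_linear:
  assumes "\<And>p. p \<in> P \<Longrightarrow> bounded_linear (A p)" "\<And>h. continuous_on P (\<lambda>p. A p h)"
  shows "psm P A"
proof -
  have *: "A p x = (\<Sum>j\<in>UNIV. (x $ j) *\<^sub>R A p (axis j 1))" if "p \<in> P" for p x
  proof -
    interpret bounded_linear "A p" by (rule assms) fact
    show ?thesis by (subst plane_sum_axis[of x]) (simp add: sum scaleR)
  qed
  have "psm P (\<lambda>p x. \<Sum>j\<in>UNIV. (x $ j) *\<^sub>R A p (axis j 1))"
  proof (intro psm_sum psm_scaleR)
    fix j :: 2
    show "psm P (\<lambda>p x. A p (axis j 1))" by (rule psm_param) (rule assms)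
    have z: "psm P (\<lambda>p. partial k (\<lambda>x::plane. x $ j))" for k
    proof -
      have "partial k (\<lambda>x::plane. x $ j) = (\<lambda>x. if j = k then 1 else 0)"
        by (rule ext) (rule partial_coord)
      then show ?thesis by (simp add: psm_const)
    qed
    show "psm P (\<lambda>p x. x $ j)"
      by (rule psmI)
        (auto simp: case_prod_beta z bounded_linear_imp_differentiable bounded_linear_vec_nth intro!: continuous_intros)
  qed
  then show ?thesis by (rule psm_cong[THEN iffD1, rotated]) (simp add: *)
qed

lemma psm_fixed_linear: "bounded_linear A \<Longrightarrow> psm P (\<lambda>p. A)"
  by (rule psm_linear) auto

lemma psm_coord: "psm P (\<lambda>p x. x $ j)"
  by (rule psm_fixed_linear) (rule bounded_linear_vec_nth)

lemma partial_compose: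
  assumes "f differentiable (at (u x))" "u differentiable (at x)"
  shows "partial j (\<lambda>x. f (u x)) x = (\<Sum>a\<in>UNIV. (partial j u x $ a) *\<^sub>R partial a f (u x))"
proof -
  from partial_eq[OF has_derivative_compose[OF has_derivative_partials[OF assms(2)] has_derivative_partials[OF assms(1)]], of j]
  show ?thesis
    by (simp add: axis_def if_distrib[of "\<lambda>c. c *\<^sub>R _"] cong: if_cong)
qed

text \<open>The induction is over all \<open>f\<close> at once: by the chain rule a derivative of
  \<open>f \<circ> u\<close> is a sum of products of derivatives of \<open>u\<close> with
  \<open>partial a f \<circ> u\<close>, the same inner family under another smooth function.\<close>

lemma psm_compose:
  assumes u: "psm P u" and "smooth f"
  shows "psm P (\<lambda>p x. f (u p x))"
proof -
  have c: "continuous_on (P \<times> UNIV) (\<lambda>(p, x). f (u p x))" if "smooth f" for f :: "plane \<Rightarrow> 'b"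
    using continuous_on_compose2[OF smooth_continuous[OF that, of UNIV] psm_continuous[OF u]]
    by (simp add: case_prod_beta)
  have d: "(\<lambda>x. f (u p x)) differentiable (at x)" if "smooth f" "p \<in> P" for f :: "plane \<Rightarrow> 'b" and p x
    using differentiable_chain_at[OF psm_differentiable[OF u that(2)] smooth_differentiable[OF that(1)]]
    by (simp add: o_def)
  have "pC n P (\<lambda>p x. f (u p x))" if "smooth f" for n
    using that
  proof (induction n arbitrary: f)
    case 0
    then show ?case using c by simp
  next
    case (Suc n)
    have "pC n P (\<lambda>p. partial j (\<lambda>x. f (u p x)))" for j
    proof -
      have "pC n P (\<lambda>p x. \<Sum>a\<in>UNIV. (partial j (u p) x $ a) *\<^sub>R partial a f (u p x))"
        using Suc.IH[OF smooth_partial[OF Suc.prems]] psm_nth[OF psm_partial[OF u]]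
        by (intro pC_sum pC_bilinear[OF bounded_bilinear_scaleR]) (auto simp: psm_def)
      then show ?thesis
        by (rule pC_cong[THEN iffD1, rotated])
          (auto simp: partial_compose smooth_differentiable[OF Suc.prems] psm_differentiable[OF u])
    qed
    then show ?case using c d Suc.prems by simp
  qed
  then show ?thesis using assms by (simp add: psm_def)
qed

lemma has_derivative_real_compose:
  fixes u :: "plane \<Rightarrow> real" and g :: "real \<Rightarrow> 'b::real_normed_vector"
  assumes "(g has_vector_derivative g') (at (u x))" "u differentiable (at x)"
  shows "((\<lambda>x. g (u x)) has_derivative (\<lambda>h. (\<Sum>j\<in>UNIV. (h $ j) *\<^sub>R partial j u x) *\<^sub>R g')) (at x)"
  using has_derivative_compose[OF has_derivative_partials[OF assms(2)] assms(1)[unfolded has_vector_derivative_def]]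
  by simp

lemma partial_real_compose:
  fixes u :: "plane \<Rightarrow> real" and g :: "real \<Rightarrow> 'b::real_normed_vector"
  assumes "(g has_vector_derivative g') (at (u x))" "u differentiable (at x)"
  shows "partial j (\<lambda>x. g (u x)) x = partial j u x *\<^sub>R g'"
  using partial_eq[OF has_derivative_real_compose[OF assms], of j] unfolding sum_axis .

text \<open>\<open>G\<close> lists all derivatives of the outer function, so that differentiating
  only moves the index and multiplies by a derivative of \<open>u\<close>. The set \<open>S\<close>
  leaves room for functions such as the logarithm that are smooth on part of the line.\<close>

lemma psm_real_compose:
  fixes u :: "'p::topological_space \<Rightarrow> plane \<Rightarrow> real" and G :: "nat \<Rightarrow> real \<Rightarrow> 'b::real_normed_vector"
  assumes u: "psm P u" and "\<And>p x. p \<in> P \<Longrightarrow> u p x \<in> S"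
    and G: "\<And>n t. t \<in> S \<Longrightarrow> (G n has_vector_derivative G (Suc n) t) (at t)"
  shows "psm P (\<lambda>p x. G n (u p x))"
proof -
  have c: "continuous_on (P \<times> UNIV) (\<lambda>(p, x). G n (u p x))" for n
  proof -
    have "continuous_on S (G n)"
      using G has_vector_derivative_continuous by (metis continuous_at_imp_continuous_on)
    moreover have "(\<lambda>(p, x). u p x) ` (P \<times> UNIV) \<subseteq> S" using assms(2) by auto
    ultimately show ?thesis
      using continuous_on_compose2[OF _ psm_continuous[OF u]] by (fastforce simp: case_prod_beta)
  qed
  have d: "(\<lambda>x. G n (u p x)) differentiable (at x)" if "p \<in> P" for p x n
    using has_derivative_real_compose[of "G n" _ "u p" x, OF G[OF assms(2)[OF that]] psm_differentiable[OF u that]]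
    by (auto simp: differentiable_def)
  have "pC k P (\<lambda>p x. G n (u p x))" for k
  proof (induction k arbitrary: n)
    case 0
    then show ?case using c by simp
  next
    case (Suc k)
    have "pC k P (\<lambda>p. partial j (\<lambda>x. G n (u p x)))" for j
    proof -
      have "pC k P (\<lambda>p x. partial j (u p) x *\<^sub>R G (Suc n) (u p x))"
        using Suc.IH psm_partial[OF u] by (intro pC_bilinear[OF bounded_bilinear_scaleR]) (auto simp: psm_def)
      then show ?thesis
        by (rule pC_cong[THEN iffD1, rotated])
          (auto simp: partial_real_compose[OF G] assms(2) psm_differentiable[OF u])
    qed
    then show ?case using c d by simp
  qed
  then show ?thesis by (simp add: psm_def)
qed

lemma psm_exp:
  assumes "psm P u"
  shows "psm P (\<lambda>p x. exp (u p x :: real))"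
  using psm_real_compose[OF assms, of UNIV "\<lambda>_. exp" 0]
  by (auto simp flip: has_real_derivative_iff_has_vector_derivative intro!: DERIV_exp)

lemma psm_cis:
  assumes "psm P u"
  shows "psm P (\<lambda>p x. cis (u p x))"
proof -
  have "((\<lambda>t. \<i> ^ n * cis t) has_vector_derivative \<i> ^ Suc n * cis t) (at t)" for n t
    unfolding has_vector_derivative_def
    by (auto intro!: derivative_eq_intros simp: scaleR_conv_of_real mult_ac)
  then show ?thesis using psm_real_compose[OF assms, of UNIV "\<lambda>n t. \<i> ^ n * cis t" 0] by simp
qed

lemma partial_cis:
  assumes "u differentiable (at x)"
  shows "partial j (\<lambda>x. cis (u x)) x = \<i> * of_real (partial j u x) * cis (u x)"
proof -
  have "(cis has_vector_derivative \<i> * cis t) (at t)" for t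
    unfolding has_vector_derivative_def
    by (auto intro!: derivative_eq_intros simp: scaleR_conv_of_real mult_ac)
  from partial_real_compose[OF this assms] show ?thesis by (simp add: scaleR_conv_of_real mult_ac)
qed

lemma psm_ln:
  assumes u: "psm P u" and pos: "\<And>p x. p \<in> P \<Longrightarrow> u p x > (0::real)"
  shows "psm P (\<lambda>p x. ln (u p x))"
proof -
  \<comment> \<open>From index 1 on the derivatives of \<open>ln\<close> are multiples of powers of
    the inverse; index 0 does not fit the pattern.\<close>
  define G where "G n t = (if n = 0 then ln t else (-1) ^ (n - 1) * fact (n - 1) * inverse t ^ n)" for n and t :: real
  have "(G n has_vector_derivative G (Suc n) t) (at t)" if "t \<in> {0<..}" for n t
  proof (cases n)
    case 0
    then show ?thesis using that unfolding G_def has_real_derivative_iff_has_vector_derivative[symmetric]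
      by (auto intro!: derivative_eq_intros simp: divide_inverse)
  next
    case (Suc m)
    have [simp]: "G (Suc m) = (\<lambda>t. (-1) ^ m * fact m * inverse t ^ Suc m)" for m by (auto simp: G_def)
    have "((\<lambda>t. inverse t ^ Suc m) has_real_derivative of_nat (Suc m) * (- (inverse t ^ Suc (Suc 0)) * inverse t ^ m)) (at t)"
      using DERIV_power[OF DERIV_inverse[of t UNIV], of "Suc m"] that by simp
    from DERIV_cmult[OF this, of "(-1) ^ m * fact m"]
    show ?thesis unfolding Suc has_real_derivative_iff_has_vector_derivative[symmetric]
      by (simp add: mult_ac)
  qed
  then show ?thesis using psm_real_compose[OF u, where S="{0<..}" and G=G and n=0] pos by (simp add: G_def)
qed

section \<open>Parametric integrals\<close>

text \<open>The derivative is total, not along one line, so dominated convergence is applied to the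
  normalized remainder of the linear approximation. The mean value inequality bounds it by the
  majorants \<open>G j\<close> of the partial derivatives.\<close>

lemma has_derivative_integral:
  fixes H :: "'x \<Rightarrow> plane \<Rightarrow> 'b::{banach, second_countable_topology}"
  assumes diff: "\<And>t x. t \<in> space M \<Longrightarrow> H t differentiable (at x)"
    and int: "\<And>x. integrable M (\<lambda>t. H t x)"
    and meas: "\<And>j x. (\<lambda>t. partial j (H t) x) \<in> borel_measurable M"
    and G: "\<And>j. integrable M (G j)" "\<And>j t x. t \<in> space M \<Longrightarrow> norm (partial j (H t) x) \<le> G j t"
  shows "((\<lambda>x. LINT t|M. H t x) has_derivative (\<lambda>h. \<Sum>j\<in>UNIV. (h $ j) *\<^sub>R (LINT t|M. partial j (H t) x))) (at x)"
    (is "(?I has_derivative ?D) _")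
  unfolding has_derivative_at_within
proof (intro conjI)
  show "bounded_linear ?D"
    by (intro bounded_linear_sum bounded_linear_compose[OF bounded_linear_scaleR_left] bounded_linear_vec_nth)
  define B where "B t = (\<Sum>j\<in>UNIV. G j t)" for t
  have B: "norm (\<Sum>j\<in>UNIV. (h $ j) *\<^sub>R partial j (H t) x) \<le> B t * norm h" if "t \<in> space M" for t h x
  proof -
    have "norm (\<Sum>j\<in>UNIV. (h $ j) *\<^sub>R partial j (H t) x) \<le> (\<Sum>j\<in>UNIV. norm h * G j t)"
      using G(2)[OF that] by (intro sum_norm_le) (auto intro!: mult_mono component_le_norm_cart)
    then show ?thesis by (simp add: B_def sum_distrib_left mult.commute)
  qed
  have B0: "0 \<le> B t" if "t \<in> space M" for t
    unfolding B_def using G(2)[OF that] by (intro sum_nonneg) (metis norm_ge_zero order_trans)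
  have lip: "norm (H t y - H t x) \<le> B t * norm (y - x)" if "t \<in> space M" for t x y
    by (rule differentiable_bound[OF convex_UNIV, where f'="\<lambda>x h. \<Sum>j\<in>UNIV. (h $ j) *\<^sub>R partial j (H t) x"])
      (auto intro!: has_derivative_at_withinI has_derivative_partials diff that onorm_bound B B0)
  have int': "integrable M (\<lambda>t. partial j (H t) x)" for j x
    by (rule Bochner_Integration.integrable_bound[OF G(1)[of j] meas]) (auto intro!: AE_I2 order_trans[OF G(2)])
  show "((\<lambda>y. (?I y - ?I x - ?D (y - x)) /\<^sub>R norm (y - x)) \<longlongrightarrow> 0) (at x)"
    unfolding tendsto_at_iff_sequentially comp_def
  proof (intro allI impI)
    fix X assume X: "\<forall>i. X i \<in> UNIV - {x}" "X \<longlonglongrightarrow> x"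
    define Q where "Q i t = (H t (X i) - H t x - (\<Sum>j\<in>UNIV. ((X i - x) $ j) *\<^sub>R partial j (H t) x)) /\<^sub>R norm (X i - x)" for i t
    have "(\<lambda>i. LINT t|M. Q i t) \<longlonglongrightarrow> (LINT t|M. 0)"
    proof (rule integral_dominated_convergence)
      \<comment> \<open>One \<open>B t\<close> bounds the increment of \<open>H t\<close>, the other
        the subtracted linear term.\<close>
      show "integrable M (\<lambda>t. 2 * B t)" using G(1) by (simp add: B_def)
      show "Q i \<in> borel_measurable M" for i
        unfolding Q_def using int meas by (intro measurable) (auto dest: borel_measurable_integrable)
      show "AE t in M. (\<lambda>i. Q i t) \<longlonglongrightarrow> 0"
      proof (rule AE_I2)
        fix t assume "t \<in> space M"
        from has_derivative_partials[OF diff[OF this], of x] show "(\<lambda>i. Q i t) \<longlonglongrightarrow> 0"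
          unfolding has_derivative_at_within tendsto_at_iff_sequentially comp_def Q_def using X by auto
      qed
      show "AE t in M. norm (Q i t) \<le> 2 * B t" for i
      proof (rule AE_I2)
        fix t assume t: "t \<in> space M"
        have "norm (H t (X i) - H t x - (\<Sum>j\<in>UNIV. ((X i - x) $ j) *\<^sub>R partial j (H t) x))
          \<le> B t * norm (X i - x) + B t * norm (X i - x)"
          by (rule order_trans[OF norm_triangle_ineq4]) (intro add_mono lip B t)
        moreover have "norm (X i - x) > 0" using X by auto
        moreover have "norm (Q i t) = norm (H t (X i) - H t x - (\<Sum>j\<in>UNIV. ((X i - x) $ j) *\<^sub>R partial j (H t) x)) / norm (X i - x)"
          by (simp add: Q_def divide_inverse mult.commute)
        ultimately show "norm (Q i t) \<le> 2 * B t" by (simp add: pos_divide_le_eq)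
      qed
    qed simp
    moreover have "(LINT t|M. Q i t) = (?I (X i) - ?I x - ?D (X i - x)) /\<^sub>R norm (X i - x)" for i
      unfolding Q_def using int int' by simp
    ultimately show "(\<lambda>i. (?I (X i) - ?I x - ?D (X i - x)) /\<^sub>R norm (X i - x)) \<longlonglongrightarrow> 0"
      by simp
  qed
qed

text \<open>Here \<open>t\<close> is the variable of integration and \<open>q\<close> a further
  parameter that is kept. Each list of derivatives may have its own majorant, uniform in
  \<open>q\<close> and \<open>x\<close>; the notion is therefore stable under
  \<open>partial\<close>, which drives the inductions below.\<close>

definition dominated_family ::
  "'q::topological_space set \<Rightarrow> 'x measure \<Rightarrow> ('q \<Rightarrow> 'x \<Rightarrow> plane \<Rightarrow> 'b::{banach, second_countable_topology}) \<Rightarrow> bool" where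
  "dominated_family Q M H \<longleftrightarrow> (\<forall>t\<in>space M. psm Q (\<lambda>q. H q t)) \<and>
     (\<forall>js. \<forall>q\<in>Q. \<forall>x. (\<lambda>t. partials js (H q t) x) \<in> borel_measurable M) \<and>
     (\<forall>js. \<exists>G. integrable M G \<and> (\<forall>q\<in>Q. \<forall>t\<in>space M. \<forall>x. norm (partials js (H q t) x) \<le> G t))"

lemma dominated_familyD:
  assumes "dominated_family Q M H"
  shows "t \<in> space M \<Longrightarrow> psm Q (\<lambda>q. H q t)"
    "q \<in> Q \<Longrightarrow> (\<lambda>t. partials js (H q t) x) \<in> borel_measurable M"
    "\<exists>G. integrable M G \<and> (\<forall>q\<in>Q. \<forall>t\<in>space M. \<forall>x. norm (partials js (H q t) x) \<le> G t)"
  using assms by (auto simp: dominated_family_def)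

lemma dominated_family_partial:
  assumes "dominated_family Q M H"
  shows "dominated_family Q M (\<lambda>q t. partial j (H q t))"
  using assms unfolding dominated_family_def partials_snoc[symmetric] by (auto intro: psm_partial)

lemma dominated_family_integrable:
  assumes "dominated_family Q M H" "q \<in> Q"
  shows "integrable M (\<lambda>t. partials js (H q t) x)"
proof -
  obtain G where "integrable M G" "\<And>t x. t \<in> space M \<Longrightarrow> norm (partials js (H q t) x) \<le> G t"
    using dominated_familyD(3)[OF assms(1), of js] assms(2) by blast
  then show ?thesis
    by (intro Bochner_Integration.integrable_bound[OF _ dominated_familyD(2)[OF assms]])
      (auto intro!: AE_I2 order_trans[OF _ abs_ge_self])
qed

lemma dominated_family_has_derivative:
  assumes H: "dominated_family Q M H" and q: "q \<in> Q"
  shows "((\<lambda>x. LINT t|M. H q t x) has_derivative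
    (\<lambda>h. \<Sum>j\<in>UNIV. (h $ j) *\<^sub>R (LINT t|M. partial j (H q t) x))) (at x)"
proof -
  have "\<exists>G. integrable M G \<and> (\<forall>t\<in>space M. \<forall>x. norm (partial j (H q t) x) \<le> G t)" for j
    using dominated_familyD(3)[OF H, of "[j]"] q by (auto simp: partials_Cons)
  then obtain G where "\<And>j. integrable M (G j)" "\<And>j t x. t \<in> space M \<Longrightarrow> norm (partial j (H q t) x) \<le> G j t"
    by metis
  then show ?thesis
    using psm_differentiable[OF dominated_familyD(1)[OF H] q]
      dominated_family_integrable[OF H q, of "[]"] dominated_familyD(2)[OF H q, of "[_]"]
    by (intro has_derivative_integral[where G=G]) (simp_all add: partials_Cons)
qed

lemma dominated_family_partial_integral:
  assumes "dominated_family Q M H" "q \<in> Q"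
  shows "partial j (\<lambda>x. LINT t|M. H q t x) = (\<lambda>x. LINT t|M. partial j (H q t) x)"
  using partial_eq[OF dominated_family_has_derivative[OF assms], of j] unfolding sum_axis by blast

lemma dominated_family_partials_integral:
  assumes "dominated_family Q M H" "q \<in> Q"
  shows "partials js (\<lambda>x. LINT t|M. H q t x) = (\<lambda>x. LINT t|M. partials js (H q t) x)"
  using assms
proof (induction js arbitrary: H rule: rev_induct)
  case (snoc j js)
  then show ?case
    using snoc.IH[OF dominated_family_partial[OF snoc.prems(1)] snoc.prems(2)]
    by (simp add: partials_snoc dominated_family_partial_integral)
qed simp

text \<open>Joint continuity is dominated convergence along sequences, and the derivative of the
  integral is again the integral of a dominated family.\<close>

lemma psm_integral:
  fixes H :: "'q::metric_space \<Rightarrow> 'x \<Rightarrow> plane \<Rightarrow> 'b::{banach, second_countable_topology}"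
  assumes "dominated_family Q M H"
  shows "psm Q (\<lambda>q x. LINT t|M. H q t x)"
proof -
  have c: "continuous_on (Q \<times> UNIV) (\<lambda>(q, x). LINT t|M. H q t x)"
    if H: "dominated_family Q M H" for H :: "'q \<Rightarrow> 'x \<Rightarrow> plane \<Rightarrow> 'b"
    unfolding continuous_on_sequentially
  proof (intro ballI allI impI, elim conjE)
    fix X a assume X: "\<forall>n. X n \<in> Q \<times> (UNIV::plane set)" and lim: "X \<longlonglongrightarrow> a" and a: "a \<in> Q \<times> UNIV"
    obtain G where G: "integrable M G" "\<And>q t x. q \<in> Q \<Longrightarrow> t \<in> space M \<Longrightarrow> norm (H q t x) \<le> G t"
      using dominated_familyD(3)[OF H, of "[]"] by auto
    have Q: "fst (X n) \<in> Q" "fst a \<in> Q" for n using X a by (auto simp: mem_Times_iff)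
    have "(\<lambda>n. LINT t|M. H (fst (X n)) t (snd (X n))) \<longlonglongrightarrow> (LINT t|M. H (fst a) t (snd a))"
    proof (rule integral_dominated_convergence)
      show "integrable M G" by fact
      show "(\<lambda>t. H (fst (X n)) t (snd (X n))) \<in> borel_measurable M" for n
        using dominated_familyD(2)[OF H Q(1), of "[]"] by simp
      show "(\<lambda>t. H (fst a) t (snd a)) \<in> borel_measurable M"
        using dominated_familyD(2)[OF H Q(2), of "[]"] by simp
      show "AE t in M. norm (H (fst (X n)) t (snd (X n))) \<le> G t" for n
        using G(2) Q by (auto intro!: AE_I2)
      show "AE t in M. (\<lambda>n. H (fst (X n)) t (snd (X n))) \<longlonglongrightarrow> H (fst a) t (snd a)"
      proof (rule AE_I2)
        fix t assume "t \<in> space M"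
        from psm_continuous[OF dominated_familyD(1)[OF H this]]
        show "(\<lambda>n. H (fst (X n)) t (snd (X n))) \<longlonglongrightarrow> H (fst a) t (snd a)"
          unfolding continuous_on_sequentially using X lim a by (force simp: comp_def case_prod_beta)
      qed
    qed
    then show "((\<lambda>(q, x). LINT t|M. H q t x) \<circ> X) \<longlonglongrightarrow> (case a of (q, x) \<Rightarrow> LINT t|M. H q t x)"
      by (simp add: comp_def case_prod_beta)
  qed
  have "pC n Q (\<lambda>q x. LINT t|M. H q t x)" if "dominated_family Q M H" for n and H :: "'q \<Rightarrow> 'x \<Rightarrow> plane \<Rightarrow> 'b"
    using that
  proof (induction n arbitrary: H)
    case 0
    then show ?case using c by simp
  next
    case (Suc n)
    have "pC n Q (\<lambda>q. partial j (\<lambda>x. LINT t|M. H q t x))" for j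
      using Suc.IH[OF dominated_family_partial[OF Suc.prems, of j]]
      by (rule pC_cong[THEN iffD1, rotated]) (simp add: dominated_family_partial_integral[OF Suc.prems])
    moreover have "(\<lambda>x. LINT t|M. H q t x) differentiable (at x)" if "q \<in> Q" for q x
      using dominated_family_has_derivative[OF Suc.prems that] by (auto simp: differentiable_def)
    ultimately show ?case using c[OF Suc.prems] by simp
  qed
  then show ?thesis using assms by (simp add: psm_def)
qed

text \<open>On each cell the oscillation of \<open>f\<close> about the tag is at most
  \<open>e\<close>, and the cell volumes add up. The bound sees \<open>f\<close> only through
  \<open>e\<close> and \<open>d\<close>, so one division serves many functions at once, which
  \<open>box_integral\<close> exploits.\<close>

lemma riemann_sum_bound:
  fixes f :: "'p::euclidean_space \<Rightarrow> 'b::banach"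
  assumes f: "continuous_on (cbox a b) f" and p: "p tagged_division_of (cbox a b)"
    and fine: "(\<lambda>x. ball x d) fine p"
    and e: "\<And>x y. x \<in> cbox a b \<Longrightarrow> y \<in> cbox a b \<Longrightarrow> dist x y < d \<Longrightarrow> norm (f x - f y) \<le> e"
  shows "norm ((\<Sum>(x, k)\<in>p. measure lborel k *\<^sub>R f x) - integral (cbox a b) f) \<le> e * measure lborel (cbox a b)"
proof -
  have int: "f integrable_on cbox a b" by (rule integrable_continuous) fact
  have *: "norm (measure lborel k *\<^sub>R f x - integral k f) \<le> e * measure lborel k" if xk: "(x, k) \<in> p" for x k
  proof -
    obtain u v where k: "k = cbox u v" using tagged_division_ofD(4)[OF p xk] by blast
    have sub: "k \<subseteq> cbox a b" "x \<in> k" using tagged_division_ofD(2,3)[OF p xk] by auto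
    have fk: "f integrable_on k" unfolding k by (rule integrable_continuous, rule continuous_on_subset[OF f]) (use sub k in auto)
    have d: "k \<subseteq> ball x d" using fine xk by (auto simp: fine_def)
    have "e \<ge> 0"
      using e[of x x] sub d by (auto simp: subset_iff)
    have "((\<lambda>y. f x - f y) has_integral measure lborel k *\<^sub>R f x - integral k f) k"
      using fk unfolding k by (intro has_integral_diff has_integral_const integrable_integral)
    from has_integral_bound[OF \<open>e \<ge> 0\<close> this[unfolded k]] show ?thesis
      using e[of x] sub d unfolding k by (auto simp: subset_iff)
  qed
  have fin: "finite p" using p by (rule tagged_division_of_finite)
  have "(\<Sum>(x, k)\<in>p. measure lborel k *\<^sub>R f x) - integral (cbox a b) f = (\<Sum>(x, k)\<in>p. measure lborel k *\<^sub>R f x - integral k f)"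
    by (simp add: integral_combine_tagged_division_topdown[OF int p] split_def sum_subtractf)
  also have "norm \<dots> \<le> (\<Sum>(x, k)\<in>p. e * measure lborel k)"
    by (rule sum_norm_le) (use * in auto)
  also have "\<dots> = e * measure lborel (cbox a b)"
    by (simp add: additive_content_tagged_division[OF p, symmetric] sum_distrib_left split_def)
  finally show ?thesis .
qed

section \<open>Distributions away from the origin\<close>

abbreviation T0 :: "(plane \<Rightarrow> complex) set" where "T0 \<equiv> test_functions (- {0})"

definition annulus :: "real \<Rightarrow> real \<Rightarrow> plane set" where
  "annulus r R = {\<xi>. r \<le> norm \<xi> \<and> norm \<xi> \<le> R}"

text \<open>One annulus for all parameters, because the continuity estimate of a distribution is
  tied to a fixed compact set away from the origin.\<close>

definition annular :: "'p set \<Rightarrow> ('p \<Rightarrow> plane \<Rightarrow> 'b::zero) \<Rightarrow> real \<Rightarrow> real \<Rightarrow> bool" where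
  "annular P H r R \<longleftrightarrow> (\<forall>p\<in>P. \<forall>\<xi>. H p \<xi> \<noteq> 0 \<longrightarrow> \<xi> \<in> annulus r R)"

lemma annularD: "annular P H r R \<Longrightarrow> p \<in> P \<Longrightarrow> H p \<xi> \<noteq> 0 \<Longrightarrow> \<xi> \<in> annulus r R"
  by (simp add: annular_def)

lemma compact_annulus: "compact (annulus r R)"
proof -
  have "annulus r R = cball 0 R \<inter> - ball 0 r" by (auto simp: annulus_def)
  then show ?thesis by (simp add: compact_Int_closed closed_Compl)
qed

lemma closed_annulus: "closed (annulus r R)"
  by (rule compact_imp_closed) (rule compact_annulus)

lemma annulus_nonzero: "0 < r \<Longrightarrow> annulus r R \<subseteq> - {0}"
  by (auto simp: annulus_def)

lemma supp_subset: "closed K \<Longrightarrow> (\<And>x. f x \<noteq> 0 \<Longrightarrow> x \<in> K) \<Longrightarrow> supp f \<subseteq> K"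
  unfolding supp_def by (rule closure_minimal) auto

lemma supp_superset: "f x \<noteq> 0 \<Longrightarrow> x \<in> supp f"
  unfolding supp_def using closure_subset by fastforce

lemma T0_smooth: "f \<in> T0 \<Longrightarrow> smooth f"
  by (simp add: test_functions_def)

lemma T0I:
  assumes "smooth f" "0 < r" "\<And>\<xi>. f \<xi> \<noteq> 0 \<Longrightarrow> \<xi> \<in> annulus r R"
  shows "f \<in> T0"
proof -
  have "supp f \<subseteq> annulus r R" by (rule supp_subset[OF closed_annulus]) (rule assms)
  moreover have "compact (supp f)"
    using calculation compact_annulus by (metis compact_Int_closed closed_closure inf.absorb_iff2 supp_def)
  ultimately show ?thesis using assms annulus_nonzero by (auto simp: test_functions_def)
qed

lemma T0E:
  assumes "f \<in> T0"
  obtains r R where "0 < r" "r \<le> R" "\<And>\<xi>. f \<xi> \<noteq> 0 \<Longrightarrow> \<xi> \<in> annulus r R"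
proof -
  have c: "compact (supp f)" and "0 \<notin> supp f" using assms by (auto simp: test_functions_def)
  then obtain r where r: "r > 0" "ball 0 r \<subseteq> - supp f"
    by (metis ComplI open_Compl compact_imp_closed open_contains_ball)
  obtain R where R: "\<And>x. x \<in> supp f \<Longrightarrow> norm x \<le> R"
    using compact_imp_bounded[OF c] by (auto simp: bounded_iff)
  \<comment> \<open>The maximum guarantees that the outer radius is at least \<open>r\<close>, also
    when \<open>f\<close> vanishes identically.\<close>
  have "\<xi> \<in> annulus r (max R r)" if "f \<xi> \<noteq> 0" for \<xi>
    using supp_superset[of f, OF that] R[of \<xi>] r by (force simp: annulus_def subset_iff not_less)
  then show ?thesis using r(1) that[of r "max R r"] by auto
qed

lemma partial_cong_open:
  assumes "open S" "x \<in> S" "\<And>y. y \<in> S \<Longrightarrow> f y = g y"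
  shows "partial j f x = partial j g x"
proof -
  have "(f has_derivative f') (at x) \<longleftrightarrow> (g has_derivative f') (at x)" for f'
    using has_derivative_transform_within_open[OF _ assms(1,2)] assms(3) by metis
  then show ?thesis by (simp add: partial_def frechet_derivative_def)
qed

lemma partials_cong_open:
  assumes "open S" "\<And>y. y \<in> S \<Longrightarrow> f y = g y" "x \<in> S"
  shows "partials js f x = partials js g x"
  using assms(3)
proof (induction js arbitrary: x)
  case (Cons j js)
  then show ?case using partial_cong_open[OF assms(1) Cons.prems, of "partials js f" "partials js g" j]
    by (simp add: partials_Cons)
qed (use assms in simp)

lemma partials_zero [simp]: "partials js (\<lambda>x. 0) = (\<lambda>x. 0)"
  by (induction js) (simp_all add: partials_Cons)

lemma partials_support:
  assumes "closed K" "\<And>x. f x \<noteq> 0 \<Longrightarrow> x \<in> K" "x \<notin> K"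
  shows "partials js f x = 0"
  using partials_cong_open[of "- K" f "\<lambda>_. 0" x js] assms by force

lemma partials_add:
  assumes "smooth f" "smooth g"
  shows "partials js (\<lambda>x. f x + g x) = (\<lambda>x. partials js f x + partials js g x)"
proof (induction js)
  case (Cons j js)
  then show ?case using assms by (auto simp: partials_Cons smooth_def intro!: partial_add)
qed simp

lemma partials_bounded_linear:
  assumes "bounded_linear L" "smooth f"
  shows "partials js (\<lambda>x. L (f x)) = (\<lambda>x. L (partials js f x))"
proof (induction js)
  case (Cons j js)
  then show ?case using assms by (auto simp: partials_Cons smooth_def intro!: partial_bounded_linear)
qed simp

lemma smooth_add: "smooth f \<Longrightarrow> smooth g \<Longrightarrow> smooth (\<lambda>x. f x + g x)"
  by (rule smoothI_psm) (intro psm_add smooth_imp_psm)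

lemma smooth_sum: "(\<And>i. i \<in> I \<Longrightarrow> smooth (f i)) \<Longrightarrow> smooth (\<lambda>x. \<Sum>i\<in>I. f i x)"
  by (rule smoothI_psm) (intro psm_sum smooth_imp_psm)

lemma smooth_const: "smooth (\<lambda>x. c)"
  by (rule smoothI_psm) (rule psm_const)

lemma smooth_mult: "smooth f \<Longrightarrow> smooth g \<Longrightarrow> smooth (\<lambda>x. f x * g x :: 'a::real_normed_algebra)"
  by (rule smoothI_psm) (intro psm_mult smooth_imp_psm)

lemma smooth_bounded_linear: "bounded_linear L \<Longrightarrow> smooth f \<Longrightarrow> smooth (\<lambda>x. L (f x))"
  by (rule smoothI_psm[OF psm_bounded_linear[OF _ smooth_imp_psm]])

lemma partials_sum:
  "(\<And>i. i \<in> I \<Longrightarrow> smooth (f i)) \<Longrightarrow> partials js (\<lambda>x. \<Sum>i\<in>I. f i x) = (\<lambda>x. \<Sum>i\<in>I. partials js (f i) x)"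
  by (induction I rule: infinite_finite_induct) (simp_all add: partials_add smooth_sum)

lemma T0_zero: "(\<lambda>x. 0) \<in> T0"
  by (rule T0I[of _ 1]) (simp_all add: smooth_const)

lemma T0_add: assumes "f \<in> T0" "g \<in> T0" shows "(\<lambda>x. f x + g x) \<in> T0"
proof -
  obtain r R where f: "0 < r" "r \<le> R" "\<And>\<xi>. f \<xi> \<noteq> 0 \<Longrightarrow> \<xi> \<in> annulus r R" using T0E[OF assms(1)] by blast
  obtain s S where g: "0 < s" "s \<le> S" "\<And>\<xi>. g \<xi> \<noteq> 0 \<Longrightarrow> \<xi> \<in> annulus s S" using T0E[OF assms(2)] by blast
  show ?thesis
  proof (rule T0I)
    show "smooth (\<lambda>x. f x + g x)" using assms by (intro smooth_add T0_smooth)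
    show "0 < min r s" using f g by simp
    show "f \<xi> + g \<xi> \<noteq> 0 \<Longrightarrow> \<xi> \<in> annulus (min r s) (max R S)" for \<xi>
      using f(3)[of \<xi>] g(3)[of \<xi>] by (cases "f \<xi> = 0"; cases "g \<xi> = 0") (auto simp: annulus_def)
  qed
qed

lemma T0_mult: assumes "f \<in> T0" "smooth g" shows "(\<lambda>x. g x * f x) \<in> T0"
proof -
  obtain r R where "0 < r" "\<And>\<xi>. f \<xi> \<noteq> 0 \<Longrightarrow> \<xi> \<in> annulus r R" using T0E[OF assms(1)] by blast
  then show ?thesis using T0_smooth[OF assms(1)] assms(2) by (intro T0I[of _ r R] smooth_mult) auto
qed

lemma T0_cmult: "f \<in> T0 \<Longrightarrow> (\<lambda>x. c * f x) \<in> T0"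
  by (rule T0_mult) (simp_all add: smooth_const)

lemma T0_sum: "(\<And>i. i \<in> I \<Longrightarrow> f i \<in> T0) \<Longrightarrow> (\<lambda>x. \<Sum>i\<in>I. f i x) \<in> T0"
  by (induction I rule: infinite_finite_induct) (simp_all add: T0_zero T0_add)

lemma T0_diff: "f \<in> T0 \<Longrightarrow> g \<in> T0 \<Longrightarrow> (\<lambda>x. f x - g x) \<in> T0"
  using T0_add[OF _ T0_cmult[of g "-1"]] by simp

section \<open>Distributions on the punctured plane as continuous linear functionals\<close>

locale punctured_distribution =
  fixes u :: "(plane \<Rightarrow> complex) \<Rightarrow> complex"
  assumes dist: "distribution_on (- {0}) u"
begin

lemma add: "f \<in> T0 \<Longrightarrow> g \<in> T0 \<Longrightarrow> u (\<lambda>x. f x + g x) = u f + u g"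
  using dist by (simp add: distribution_on_def)

lemma cmult: "f \<in> T0 \<Longrightarrow> u (\<lambda>x. c * f x) = c * u f"
  using dist by (simp add: distribution_on_def)

lemma zero: "u (\<lambda>x. 0) = 0"
  using cmult[OF T0_zero, of 0] by simp

lemma sum: "(\<And>i. i \<in> I \<Longrightarrow> f i \<in> T0) \<Longrightarrow> u (\<lambda>x. \<Sum>i\<in>I. f i x) = (\<Sum>i\<in>I. u (f i))"
  by (induction I rule: infinite_finite_induct) (simp_all add: zero add T0_sum)

lemma diff: "f \<in> T0 \<Longrightarrow> g \<in> T0 \<Longrightarrow> u (\<lambda>x. f x - g x) = u f - u g"
  using add[OF _ T0_cmult[of g "-1"]] cmult[of g "-1"] by simp

text \<open>There are finitely many derivatives of order at most \<open>N\<close>, so their number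
  is absorbed into \<open>A\<close> and one pointwise bound \<open>e\<close> replaces the sum of
  suprema.\<close>

lemma seminorm_bound:
  assumes "0 < r"
  shows "\<exists>A\<ge>0. \<exists>N. \<forall>f e. smooth f \<longrightarrow> (\<forall>\<xi>. f \<xi> \<noteq> 0 \<longrightarrow> \<xi> \<in> annulus r R) \<longrightarrow>
    (\<forall>js \<xi>. length js \<le> N \<longrightarrow> norm (partials js f \<xi>) \<le> e) \<longrightarrow> norm (u f) \<le> A * e"
proof -
  have "\<forall>K. compact K \<and> K \<subseteq> - {0} \<longrightarrow> (\<exists>A N. \<forall>f\<in>T0. supp f \<subseteq> K \<longrightarrow>
      norm (u f) \<le> A * (\<Sum>js | length js \<le> N. SUP x. norm (partials js f x)))"
    using dist unfolding distribution_on_def by (elim conjE)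
  from this[rule_format, OF conjI[OF compact_annulus annulus_nonzero[OF assms]], of R]
  obtain A N where AN: "\<And>f. f \<in> T0 \<Longrightarrow> supp f \<subseteq> annulus r R \<Longrightarrow>
      norm (u f) \<le> A * (\<Sum>js | length js \<le> N. SUP x. norm (partials js f x))"
    by auto
  let ?J = "{js :: 2 list. length js \<le> N}"
  have "norm (u f) \<le> \<bar>A\<bar> * card ?J * e" if f: "smooth f" "\<And>\<xi>. f \<xi> \<noteq> 0 \<Longrightarrow> \<xi> \<in> annulus r R"
      and e: "\<And>js \<xi>. length js \<le> N \<Longrightarrow> norm (partials js f \<xi>) \<le> e" for f :: "plane \<Rightarrow> complex" and e
  proof -
    have "norm (u f) \<le> A * (\<Sum>js\<in>?J. SUP x. norm (partials js f x))"
      using f T0I[OF _ assms] by (intro AN supp_subset closed_annulus) auto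
    \<comment> \<open>\<open>A\<close> may be negative; the suprema are nonnegative, and genuine
      ones thanks to \<open>e\<close>, so its absolute value can replace it.\<close>
    also have "\<dots> \<le> \<bar>A\<bar> * (\<Sum>js\<in>?J. SUP x. norm (partials js f x))"
    proof (rule mult_right_mono)
      have "0 \<le> (SUP x. norm (partials js f x))" if "js \<in> ?J" for js
        using e[of js] that by (intro cSUP_upper2[of _ _ 0] bdd_aboveI2[where M=e]) auto
      then show "0 \<le> (\<Sum>js\<in>?J. SUP x. norm (partials js f x))" by (rule sum_nonneg)
    qed simp
    also have "\<dots> \<le> \<bar>A\<bar> * (\<Sum>js\<in>?J. e)"
      using e by (intro mult_left_mono sum_mono cSUP_least) auto
    finally show ?thesis by (simp add: mult.assoc)
  qed
  then show ?thesis by (intro exI[of _ "\<bar>A\<bar> * card ?J"] conjI exI[of _ N]) auto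
qed

end

section \<open>Distributions applied to families of test functions\<close>

lemma psm_continuous_partials:
  "psm P H \<Longrightarrow> continuous_on (P \<times> B) (\<lambda>(p, x). partials js (H p) x)"
  by (rule continuous_on_subset[OF psm_continuous[OF psm_partials]]) auto

lemma finite_short_lists: "finite {js :: 2 list. length js \<le> N}"
  using finite_lists_length_le[of "UNIV :: 2 set" N] by simp

text \<open>Uniform continuity on the compact set \<open>P \<times> annulus r R\<close>, together
  with the vanishing of all derivatives outside the annulus. Only finitely many lists of length at
  most \<open>N\<close> occur, so the minimum of the \<open>d js\<close> stays positive.\<close>

lemma psm_uniform:
  fixes H :: "'p::metric_space \<Rightarrow> plane \<Rightarrow> 'b::real_normed_vector"
  assumes "psm P H" "compact P" and H: "annular P H r R" and "e > 0"
  shows "\<exists>d>0. \<forall>js p q \<xi>. length js \<le> N \<longrightarrow> p \<in> P \<longrightarrow> q \<in> P \<longrightarrow> dist p q < d \<longrightarrow>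
    norm (partials js (H p) \<xi> - partials js (H q) \<xi>) < e"
proof -
  have "\<exists>d>0. \<forall>p\<in>P. \<forall>q\<in>P. \<forall>\<xi>. dist p q < d \<longrightarrow> norm (partials js (H p) \<xi> - partials js (H q) \<xi>) < e" for js
  proof -
    have "uniformly_continuous_on (P \<times> annulus r R) (\<lambda>(p, \<xi>). partials js (H p) \<xi>)"
      by (intro compact_uniformly_continuous compact_Times psm_continuous_partials assms compact_annulus)
    then obtain d where d: "d > 0" "\<And>x y. x \<in> P \<times> annulus r R \<Longrightarrow> y \<in> P \<times> annulus r R \<Longrightarrow> dist y x < d \<Longrightarrow>
        dist (case y of (p, \<xi>) \<Rightarrow> partials js (H p) \<xi>) (case x of (p, \<xi>) \<Rightarrow> partials js (H p) \<xi>) < e"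
      using \<open>e > 0\<close> unfolding uniformly_continuous_on_def by metis
    have "norm (partials js (H p) \<xi> - partials js (H q) \<xi>) < e" if "p \<in> P" "q \<in> P" "dist p q < d" for p q \<xi>
    proof (cases "\<xi> \<in> annulus r R")
      case True
      then show ?thesis using d(2)[of "(q, \<xi>)" "(p, \<xi>)"] that by (simp add: dist_Pair_Pair dist_norm)
    next
      case False
      then show ?thesis
        using partials_support[OF closed_annulus, of "H p" r R \<xi> js] partials_support[OF closed_annulus, of "H q" r R \<xi> js]
          annularD[OF H] that \<open>e > 0\<close> by auto
    qed
    then show ?thesis using d(1) by blast
  qed
  then obtain d where d: "\<And>js. d js > 0" "\<And>js p q \<xi>. p \<in> P \<Longrightarrow> q \<in> P \<Longrightarrow> dist p q < d js \<Longrightarrow>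
      norm (partials js (H p) \<xi> - partials js (H q) \<xi>) < e" by metis
  let ?D = "Min (d ` {js. length js \<le> N})"
  have ne: "{js :: 2 list. length js \<le> N} \<noteq> {}" by (auto intro!: exI[of _ "[]"])
  have "?D > 0" using d(1) finite_short_lists ne by (subst Min_gr_iff) auto
  moreover have "norm (partials js (H p) \<xi> - partials js (H q) \<xi>) < e"
    if "length js \<le> N" "p \<in> P" "q \<in> P" "dist p q < ?D" for js p q \<xi>
  proof -
    have "?D \<le> d js" using that(1) finite_short_lists by (intro Min_le) auto
    then show ?thesis using d(2)[of p q js \<xi>] that by simp
  qed
  ultimately show ?thesis by (intro exI[of _ ?D]) simp
qed

lemma box_integral_partials:
  fixes H :: "'p::euclidean_space \<Rightarrow> plane \<Rightarrow> complex"
  assumes H: "psm (cbox a b) H" and supp: "annular (cbox a b) H r R"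
  shows "smooth (\<lambda>\<xi>. integral (cbox a b) (\<lambda>p. H p \<xi>))"
    "partials js (\<lambda>\<xi>. integral (cbox a b) (\<lambda>p. H p \<xi>)) = (\<lambda>\<xi>. integral (cbox a b) (\<lambda>p. partials js (H p) \<xi>))"
proof -
  let ?M = "restrict_space lborel (cbox a b)"
  have cont: "continuous_on (cbox a b) (\<lambda>p. partials js (H p) \<xi>)" for js \<xi>
    using continuous_on_compose2[OF psm_continuous[OF psm_partials[OF H, of js]], of "cbox a b" "\<lambda>p. (p, \<xi>)"]
    by (simp add: continuous_intros image_subset_iff)
  have eq: "integral (cbox a b) f = (LINT p|?M. f p)" if "continuous_on (cbox a b) f" for f :: "'p \<Rightarrow> complex"
  proof -
    have "set_integrable lborel (cbox a b) f"
      unfolding set_integrable_def using borel_integrable_compact[OF compact_cbox that] by simp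
    from set_borel_integral_eq_integral(2)[OF this] show ?thesis
      by (simp add: set_lebesgue_integral_def integral_restrict_space)
  qed
  have fin: "finite_measure ?M"
    using emeasure_lborel_cbox_finite[of a b]
    by (intro finite_measureI) (auto simp: space_restrict_space emeasure_restrict_space)
  \<comment> \<open>The box variable is the one integrated, so the remaining parameter is a dummy
    point. The majorants are constants: the derivatives are bounded on a compact product and zero
    elsewhere, and the box has finite measure.\<close>
  have "dominated_family {0::real} ?M (\<lambda>_. H)"
    unfolding dominated_family_def
  proof (intro conjI ballI allI)
    show "psm {0} (\<lambda>_. H p)" if "p \<in> space ?M" for p
      using that by (intro smooth_imp_psm psm_imp_smooth[OF H]) (simp add: space_restrict_space)
    show "(\<lambda>p. partials js (H p) \<xi>) \<in> borel_measurable ?M" for js \<xi>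
      using borel_measurable_continuous_on_restrict[OF cont]
      by (simp add: measurable_def space_restrict_space sets_restrict_space)
    show "\<exists>G. integrable ?M G \<and> (\<forall>q\<in>{0::real}. \<forall>p\<in>space ?M. \<forall>\<xi>. norm (partials js (H p) \<xi>) \<le> G p)" for js
    proof -
      have "compact ((\<lambda>(p, \<xi>). partials js (H p) \<xi>) ` (cbox a b \<times> annulus r R))"
        by (intro compact_continuous_image compact_Times psm_continuous_partials H compact_annulus compact_cbox)
      from compact_imp_bounded[OF this] obtain B where B0: "B > 0"
        "\<forall>z\<in>(\<lambda>(p, \<xi>). partials js (H p) \<xi>) ` (cbox a b \<times> annulus r R). norm z \<le> B"
        unfolding bounded_pos by (elim exE conjE)
      have B: "norm (partials js (H p) \<xi>) \<le> B" if "p \<in> cbox a b" "\<xi> \<in> annulus r R" for p \<xi>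
        by (rule B0(2)[rule_format]) (use that in \<open>auto intro: rev_image_eqI[of "(p, \<xi>)"]\<close>)
      have "norm (partials js (H p) \<xi>) \<le> B" if "p \<in> cbox a b" for p \<xi>
        using B0(1) B[of p \<xi>] partials_support[OF closed_annulus, of "H p" r R \<xi> js] annularD[OF supp] that
        by (cases "\<xi> \<in> annulus r R") auto
      then show ?thesis
        using finite_measure.integrable_const[OF fin, of B] by (intro exI[of _ "\<lambda>_. B"]) (auto simp: space_restrict_space)
    qed
  qed
  note D = this
  have I: "(\<lambda>\<xi>. integral (cbox a b) (\<lambda>p. partials js (H p) \<xi>)) = (\<lambda>\<xi>. LINT p|?M. partials js (H p) \<xi>)" for js
    using eq[OF cont] by simp
  show "smooth (\<lambda>\<xi>. integral (cbox a b) (\<lambda>p. H p \<xi>))"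
    using psm_integral[OF D] I[of "[]"] by (intro smoothI_psm) simp
  show "partials js (\<lambda>\<xi>. integral (cbox a b) (\<lambda>p. H p \<xi>)) = (\<lambda>\<xi>. integral (cbox a b) (\<lambda>p. partials js (H p) \<xi>))"
    using dominated_family_partials_integral[OF D, of 0 js] I[of "[]"] I[of js] by simp
qed

context punctured_distribution
begin

lemma uniform_continuity_param:
  fixes H :: "'p::metric_space \<Rightarrow> plane \<Rightarrow> complex"
  assumes "psm P H" "compact P" "0 < r" and H: "annular P H r R"
    and "e > 0"
  shows "\<exists>d>0. \<forall>p\<in>P. \<forall>q\<in>P. dist p q < d \<longrightarrow> norm (u (H p) - u (H q)) \<le> e"
proof -
  obtain A :: real and N where A1: "A \<ge> 0" and A2: "\<forall>f e. smooth f \<longrightarrow> (\<forall>\<xi>. f \<xi> \<noteq> 0 \<longrightarrow> \<xi> \<in> annulus r R) \<longrightarrow>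
    (\<forall>js \<xi>. length js \<le> N \<longrightarrow> norm (partials js f \<xi>) \<le> e) \<longrightarrow> norm (u f) \<le> A * e"
    using seminorm_bound[OF \<open>0 < r\<close>, of R] by (elim exE conjE)
  note A = A1 A2[rule_format]
  \<comment> \<open>\<open>A\<close> may be zero, hence the denominator
    \<open>A + 1\<close>.\<close>
  have "e / (A + 1) > 0" using A(1) \<open>e > 0\<close> by simp
  from psm_uniform[where N=N, OF assms(1,2) H this]
  obtain d where d0: "d > 0" "\<forall>js p q \<xi>. length js \<le> N \<longrightarrow> p \<in> P \<longrightarrow> q \<in> P \<longrightarrow> dist p q < d \<longrightarrow>
    norm (partials js (H p) \<xi> - partials js (H q) \<xi>) < e / (A + 1)" by blast
  note d = d0(1) d0(2)[rule_format]
  show ?thesis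
  proof (intro exI[of _ d] conjI ballI impI d(1))
    fix p q assume pq: "p \<in> P" "q \<in> P" "dist p q < d"
    have sm: "smooth (H p)" "smooth (H q)" using psm_imp_smooth[OF assms(1)] pq by auto
    then have sm': "smooth (\<lambda>\<xi>. - H q \<xi>)" using smooth_bounded_linear[OF bounded_linear_minus[OF bounded_linear_ident]] by blast
    have T: "H p \<in> T0" "H q \<in> T0" using T0I[OF sm(1) \<open>0 < r\<close> annularD[OF H pq(1)]] T0I[OF sm(2) \<open>0 < r\<close> annularD[OF H pq(2)]] by auto
    have "partials js (\<lambda>\<xi>. H p \<xi> - H q \<xi>) \<xi> = partials js (H p) \<xi> - partials js (H q) \<xi>" for js \<xi>
      using partials_add[OF sm(1) sm', of js]
        partials_bounded_linear[OF bounded_linear_minus[OF bounded_linear_ident] sm(2), of js] by simp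
    moreover have "\<xi> \<in> annulus r R" if "H p \<xi> - H q \<xi> \<noteq> 0" for \<xi>
      using that annularD[OF H pq(1), of \<xi>] annularD[OF H pq(2), of \<xi>] by (cases "H p \<xi> = 0") auto
    ultimately have "norm (u (\<lambda>\<xi>. H p \<xi> - H q \<xi>)) \<le> A * (e / (A + 1))"
      using d(2)[OF _ pq] T0_smooth[OF T0_diff[OF T]] by (intro A(2)) (auto intro: less_imp_le)
    also have "\<dots> \<le> e" using A(1) \<open>e > 0\<close> by (simp add: field_simps)
    finally show "norm (u (H p) - u (H q)) \<le> e" using diff[OF T] by simp
  qed
qed

lemma continuous_param:
  fixes H :: "'p::metric_space \<Rightarrow> plane \<Rightarrow> complex"
  assumes "psm P H" "compact P" "0 < r" and H: "annular P H r R"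
  shows "continuous_on P (\<lambda>p. u (H p))"
  unfolding continuous_on_iff
proof (intro ballI allI impI)
  fix p and e :: real assume p: "p \<in> P" "e > 0"
  then have "e / 2 > 0" by simp
  from uniform_continuity_param[OF assms this] obtain d where
    "d > 0" "\<And>p q. p \<in> P \<Longrightarrow> q \<in> P \<Longrightarrow> dist p q < d \<Longrightarrow> norm (u (H p) - u (H q)) \<le> e / 2"
    by blast
  then show "\<exists>d>0. \<forall>q\<in>P. dist q p < d \<longrightarrow> dist (u (H q)) (u (H p)) < e"
    using p by (intro exI[of _ d]) (fastforce simp: dist_norm)
qed

text \<open>Riemann sums converge to the integral uniformly together with all derivatives up to the
  order \<open>N\<close> of the distribution on the annulus, and by linearity \<open>u\<close> maps
  them to Riemann sums of \<open>p \<mapsto> u (H p)\<close>. A single fine division controls both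
  errors.\<close>

lemma box_integral:
  fixes H :: "'p::euclidean_space \<Rightarrow> plane \<Rightarrow> complex"
  assumes H: "psm (cbox a b) H" and r: "0 < r" and supp: "annular (cbox a b) H r R"
  shows "(\<lambda>\<xi>. integral (cbox a b) (\<lambda>p. H p \<xi>)) \<in> T0"
    "u (\<lambda>\<xi>. integral (cbox a b) (\<lambda>p. H p \<xi>)) = integral (cbox a b) (\<lambda>p. u (H p))"
proof -
  let ?I = "\<lambda>\<xi>. integral (cbox a b) (\<lambda>p. H p \<xi>)" and ?J = "integral (cbox a b) (\<lambda>p. u (H p))"
  have smI: "smooth ?I" by (rule box_integral_partials(1)[OF H supp])
  have suppI: "\<xi> \<in> annulus r R" if "?I \<xi> \<noteq> 0" for \<xi>
  proof (rule ccontr)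
    assume "\<xi> \<notin> annulus r R"
    then have "?I \<xi> = integral (cbox a b) (\<lambda>p. 0)" using annularD[OF supp] by (intro integral_cong) auto
    with that show False by simp
  qed
  show I: "?I \<in> T0" by (rule T0I[OF smI r suppI])
  obtain A :: real and N where A1: "A \<ge> 0" and A2: "\<forall>f e. smooth f \<longrightarrow> (\<forall>\<xi>. f \<xi> \<noteq> 0 \<longrightarrow> \<xi> \<in> annulus r R) \<longrightarrow>
    (\<forall>js \<xi>. length js \<le> N \<longrightarrow> norm (partials js f \<xi>) \<le> e) \<longrightarrow> norm (u f) \<le> A * e"
    using seminorm_bound[OF \<open>0 < r\<close>, of R] by (elim exE conjE)
  note A = A1 A2[rule_format]
  let ?c = "measure lborel (cbox a b)"
  have cont: "continuous_on (cbox a b) (\<lambda>p. partials js (H p) \<xi>)" for js \<xi>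
    using continuous_on_compose2[OF psm_continuous[OF psm_partials[OF H, of js]], of "cbox a b" "\<lambda>p. (p, \<xi>)"]
    by (simp add: continuous_intros image_subset_iff)
  have bnd: "norm (u ?I - ?J) \<le> e * ((A + 1) * ?c)" if "e > 0" for e
  proof -
    from psm_uniform[where N=N, OF H compact_cbox supp \<open>e > 0\<close>]
    obtain d1 where d1': "d1 > 0" "\<forall>js p q \<xi>. length js \<le> N \<longrightarrow> p \<in> cbox a b \<longrightarrow> q \<in> cbox a b \<longrightarrow> dist p q < d1 \<longrightarrow>
      norm (partials js (H p) \<xi> - partials js (H q) \<xi>) < e" by blast
    note d1 = d1'(1) d1'(2)[rule_format]
    from uniform_continuity_param[OF H compact_cbox r supp \<open>e > 0\<close>]
    obtain d2 where d2: "d2 > 0" "\<And>p q. p \<in> cbox a b \<Longrightarrow> q \<in> cbox a b \<Longrightarrow> dist p q < d2 \<Longrightarrow> norm (u (H p) - u (H q)) \<le> e"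
      by blast
    \<comment> \<open>\<open>d1\<close> controls the derivatives of the test functions,
      \<open>d2\<close> the values of the distribution.\<close>
    define d where "d = min d1 d2"
    have "gauge (\<lambda>x::'p. ball x d)" using d1 d2 by (simp add: d_def gauge_ball)
    then obtain p where p: "p tagged_division_of (cbox a b)" "(\<lambda>x. ball x d) fine p"
      using fine_division_exists by metis
    define S where "S \<xi> = (\<Sum>(x, k)\<in>p. of_real (measure lborel k) * H x \<xi>)" for \<xi>
    have tag: "x \<in> cbox a b" if "(x, k) \<in> p" for x k using tagged_division_ofD(2,3)[OF p(1) that] by auto
    have sm: "smooth (H x)" if "x \<in> cbox a b" for x using psm_imp_smooth[OF H that] .
    have T: "H x \<in> T0" if "x \<in> cbox a b" for x using T0I[OF sm[OF that] r annularD[OF supp that]] .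
    have T': "(\<lambda>\<xi>. case i of (x, k) \<Rightarrow> of_real (measure lborel k) * H x \<xi>) \<in> T0" if "i \<in> p" for i
      using that tag T by (cases i) (auto intro!: T0_cmult)
    have S: "S \<in> T0" unfolding S_def[abs_def] by (rule T0_sum) (rule T')
    have "u S = (\<Sum>(x, k)\<in>p. of_real (measure lborel k) * u (H x))"
      unfolding S_def[abs_def] using T' tag T by (subst sum) (auto intro!: sum.cong cmult)
    also have "\<dots> = (\<Sum>(x, k)\<in>p. measure lborel k *\<^sub>R u (H x))" by (simp add: scaleR_conv_of_real)
    finally have uS: "norm (u S - ?J) \<le> e * ?c"
      using riemann_sum_bound[OF continuous_param[OF H compact_cbox r supp] p, of e] d2(2)
      by (simp add: d_def)
    have dS: "partials js S \<xi> = (\<Sum>(x, k)\<in>p. measure lborel k *\<^sub>R partials js (H x) \<xi>)" for js \<xi>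
    proof -
      have "partials js S = (\<lambda>\<xi>. \<Sum>i\<in>p. partials js (\<lambda>\<xi>. case i of (x, k) \<Rightarrow> of_real (measure lborel k) * H x \<xi>) \<xi>)"
        unfolding S_def[abs_def] using T0_smooth[OF T'] by (rule partials_sum)
      moreover have "partials js (\<lambda>\<xi>. case i of (x, k) \<Rightarrow> of_real (measure lborel k) * H x \<xi>) \<xi>
          = (case i of (x, k) \<Rightarrow> measure lborel k *\<^sub>R partials js (H x) \<xi>)" if "i \<in> p" for i
        using partials_bounded_linear[OF bounded_linear_mult_right sm[OF tag]] that
        by (cases i) (auto simp: scaleR_conv_of_real)
      ultimately show ?thesis by simp
    qed
    have d: "partials js (\<lambda>\<xi>. S \<xi> - ?I \<xi>) \<xi> = partials js S \<xi> - integral (cbox a b) (\<lambda>p. partials js (H p) \<xi>)" for js \<xi>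
      using partials_add[OF T0_smooth[OF S] T0_smooth[OF T0_cmult[OF I, of "-1"]], of js]
        partials_bounded_linear[OF bounded_linear_minus[OF bounded_linear_ident] smI, of js]
        box_integral_partials(2)[OF H supp, of js] by simp
    have "norm (u (\<lambda>\<xi>. S \<xi> - ?I \<xi>)) \<le> A * (e * ?c)"
    proof (rule A(2))
      show "smooth (\<lambda>\<xi>. S \<xi> - ?I \<xi>)" by (rule T0_smooth[OF T0_diff[OF S I]])
      show "\<xi> \<in> annulus r R" if "S \<xi> - ?I \<xi> \<noteq> 0" for \<xi>
      proof (rule ccontr)
        assume *: "\<xi> \<notin> annulus r R"
        have "H x \<xi> = 0" if "(x, k) \<in> p" for x k
          using annularD[OF supp tag[OF that], of \<xi>] * by auto
        then have "S \<xi> = 0" unfolding S_def by (intro sum.neutral) auto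
        then show False using that suppI * by auto
      qed
      show "norm (partials js (\<lambda>\<xi>. S \<xi> - ?I \<xi>) \<xi>) \<le> e * ?c" if "length js \<le> N" for js \<xi>
        unfolding d dS using d1(2)[OF that] by (intro riemann_sum_bound[OF cont p]) (auto simp: d_def intro: less_imp_le)
    qed
    then have "norm (u S - u ?I) \<le> A * (e * ?c)" using diff[OF S I] by simp
    with uS have "norm (u ?I - ?J) \<le> A * (e * ?c) + e * ?c"
      by (metis norm_diff_triangle_le norm_minus_commute)
    then show ?thesis by (simp add: algebra_simps)
  qed
  \<comment> \<open>The added 1 keeps the divisor positive even for a box of measure zero.\<close>
  have *: "norm (u ?I - ?J) / ((A + 1) * ?c + 1) \<le> 0 + e" if "e > 0" for e
  proof -
    have "0 \<le> (A + 1) * ?c" using A(1) by simp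
    moreover have "norm (u ?I - ?J) \<le> e * ((A + 1) * ?c)" by (rule bnd[OF that])
    moreover have "e * ((A + 1) * ?c) \<le> e * ((A + 1) * ?c + 1)" using that by (simp add: algebra_simps)
    ultimately show ?thesis by (simp add: pos_divide_le_eq)
  qed
  have "norm (u ?I - ?J) / ((A + 1) * ?c + 1) \<le> 0" by (rule field_le_epsilon) (rule *)
  moreover have "(A + 1) * ?c + 1 > 0" using A(1) by (simp add: add_nonneg_pos)
  ultimately have "norm (u ?I - ?J) \<le> 0" by (simp add: divide_le_0_iff)
  then show "u ?I = ?J" by simp
qed

end

section \<open>Fourier inversion for test functions\<close>

text \<open>Unlike in \<open>T0\<close>, the support may contain the origin: inversion and decay are
  insensitive to it, and the cutoff \<open>\<psi>\<close> belongs to this class.\<close>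

definition Cc :: "(plane \<Rightarrow> complex) set" where
  "Cc = {g. smooth g \<and> (\<exists>R. \<forall>\<xi>. g \<xi> \<noteq> 0 \<longrightarrow> norm \<xi> \<le> R)}"

lemma Cc_smooth: "g \<in> Cc \<Longrightarrow> smooth g"
  by (simp add: Cc_def)

lemma T0_subset_Cc: assumes "f \<in> T0" shows "f \<in> Cc"
proof -
  obtain r R where "\<And>\<xi>. f \<xi> \<noteq> 0 \<Longrightarrow> \<xi> \<in> annulus r R" using T0E[OF assms] by blast
  then show ?thesis using T0_smooth[OF assms] by (auto simp: Cc_def annulus_def)
qed

lemma Cc_mult: "g \<in> Cc \<Longrightarrow> smooth f \<Longrightarrow> (\<lambda>x. f x * g x) \<in> Cc"
  unfolding Cc_def by (auto intro!: smooth_mult)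

lemma Cc_cmult: "g \<in> Cc \<Longrightarrow> (\<lambda>x. c * g x) \<in> Cc"
  by (rule Cc_mult) (simp_all add: smooth_const)

lemma Cc_add: assumes "f \<in> Cc" "g \<in> Cc" shows "(\<lambda>x. f x + g x) \<in> Cc"
proof -
  obtain R S where "\<forall>\<xi>. f \<xi> \<noteq> 0 \<longrightarrow> norm \<xi> \<le> R" "\<forall>\<xi>. g \<xi> \<noteq> 0 \<longrightarrow> norm \<xi> \<le> S"
    using assms unfolding Cc_def by auto
  then have "f \<xi> + g \<xi> \<noteq> 0 \<longrightarrow> norm \<xi> \<le> max R S" for \<xi>
    by (cases "f \<xi> = 0") (auto simp: le_max_iff_disj)
  then show ?thesis using assms unfolding Cc_def by (auto intro!: smooth_add)
qed

lemma Cc_partial: assumes "g \<in> Cc" shows "partial j g \<in> Cc"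
proof -
  obtain R where R: "\<forall>\<xi>. g \<xi> \<noteq> 0 \<longrightarrow> norm \<xi> \<le> R" using assms by (auto simp: Cc_def)
  have "partials [j] g \<xi> = 0" if "\<xi> \<notin> cball 0 R" for \<xi>
    by (rule partials_support[OF closed_cball _ that]) (use R in auto)
  then have "partial j g \<xi> \<noteq> 0 \<longrightarrow> norm \<xi> \<le> R" for \<xi> by (force simp: partials_Cons)
  then show ?thesis using assms by (auto simp: Cc_def intro: smooth_partial)
qed

lemma compact_support_integrable:
  fixes g :: "'a::euclidean_space \<Rightarrow> 'b::{banach, second_countable_topology}"
  assumes "continuous_on UNIV g" "compact K" "\<And>x. g x \<noteq> 0 \<Longrightarrow> x \<in> K"
  shows "integrable lborel g"
proof -
  have "(\<lambda>x. indicator K x *\<^sub>R g x) = g" using assms(3) by (auto simp: indicator_def fun_eq_iff)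
  moreover have "integrable lborel (\<lambda>x. indicator K x *\<^sub>R g x)"
    by (rule borel_integrable_compact[OF assms(2)]) (rule continuous_on_subset[OF assms(1)], simp)
  ultimately show ?thesis by simp
qed

lemma Cc_integrable_mult:
  assumes "g \<in> Cc" "continuous_on UNIV f"
  shows "integrable lborel (\<lambda>x. f x * g x)"
proof -
  obtain R where R: "\<forall>\<xi>. g \<xi> \<noteq> 0 \<longrightarrow> norm \<xi> \<le> R" using assms by (auto simp: Cc_def)
  show ?thesis
    by (rule compact_support_integrable[of _ "cball 0 R"])
      (use R in \<open>auto intro!: continuous_on_mult assms smooth_continuous[OF Cc_smooth[OF assms(1)]]\<close>)
qed

lemma Cc_integrable: "g \<in> Cc \<Longrightarrow> integrable lborel g"
  using Cc_integrable_mult[of g "\<lambda>_. 1"] by simp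

lemma integral_translate:
  fixes f :: "'a::euclidean_space \<Rightarrow> 'b::{banach, second_countable_topology}"
  assumes [measurable]: "f \<in> borel_measurable borel"
  shows "(LINT x|lborel. f (c + x)) = (LINT x|lborel. f x)"
proof -
  have "(LINT x|lborel. f x) = (LINT x|distr lborel borel ((+) c). f x)"
    by (simp add: lborel_distr_plus)
  also have "\<dots> = (LINT x|lborel. f (c + x))" by (rule integral_distr) simp_all
  finally show ?thesis ..
qed

lemma integral_scale:
  fixes f :: "'a::euclidean_space \<Rightarrow> 'b::{banach, second_countable_topology}"
  assumes "c \<noteq> 0" and [measurable]: "f \<in> borel_measurable borel"
  shows "(LINT x|lborel. f x) = \<bar>c\<bar> ^ DIM('a) *\<^sub>R (LINT x|lborel. f (t + c *\<^sub>R x))"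
proof -
  have "(LINT x|lborel. f x) = (LINT x|density (distr lborel borel (\<lambda>x. t + c *\<^sub>R x)) (\<lambda>_. \<bar>c\<bar> ^ DIM('a)). f x)"
    using lborel_affine[OF assms(1), of t] by simp
  also have "\<dots> = \<bar>c\<bar> ^ DIM('a) *\<^sub>R (LINT x|lborel. f (t + c *\<^sub>R x))"
    by (simp add: integral_density integral_distr)
  finally show ?thesis .
qed

lemma integral_reflect:
  fixes f :: "'a::euclidean_space \<Rightarrow> 'b::{banach, second_countable_topology}"
  assumes "f \<in> borel_measurable borel"
  shows "(LINT x|lborel. f (- x)) = (LINT x|lborel. f x)"
  using integral_scale[of "-1" f 0] assms by simp

lemma Cc_measurable: "g \<in> Cc \<Longrightarrow> g \<in> borel_measurable borel"
  by (intro borel_measurable_continuous_onI smooth_continuous Cc_smooth)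

text \<open>Each difference quotient integrates to zero by translation invariance of Lebesgue
  measure, and the quotients converge boundedly with supports in one ball.\<close>

lemma integral_partial:
  assumes g: "g \<in> Cc"
  shows "(LINT x|lborel. partial j g x) = 0"
proof -
  define e :: plane where "e = axis j 1"
  have ne: "norm e = 1" by (simp add: e_def norm_axis_1)
  obtain R where R: "\<And>\<xi>. g \<xi> \<noteq> 0 \<Longrightarrow> norm \<xi> \<le> R" using g by (auto simp: Cc_def)
  have [measurable]: "g \<in> borel_measurable borel" using g by (rule Cc_measurable)
  have dg: "(g has_derivative (\<lambda>h. \<Sum>k\<in>UNIV. (h $ k) *\<^sub>R partial k g x)) (at x)" for x
    by (rule has_derivative_partials) (rule smooth_differentiable[OF Cc_smooth[OF g]])
  obtain B where B: "B \<ge> 0" "\<And>k x. norm (partial k g x) \<le> B"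
  proof -
    have "\<exists>B. \<forall>x. norm (partial k g x) \<le> B" for k
    proof -
      obtain S where S: "\<And>\<xi>. partial k g \<xi> \<noteq> 0 \<Longrightarrow> norm \<xi> \<le> S" using Cc_partial[OF g, of k] by (auto simp: Cc_def)
      have "compact (partial k g ` cball 0 S)"
        by (intro compact_continuous_image smooth_continuous smooth_partial Cc_smooth g compact_cball)
      from compact_imp_bounded[OF this] obtain B where B: "B > 0" "\<And>x. x \<in> cball 0 S \<Longrightarrow> norm (partial k g x) \<le> B"
        unfolding bounded_pos by auto
      have "norm (partial k g x) \<le> B" for x
        using B(2)[of x] B(1) S[of x] by (cases "partial k g x = 0") auto
      then show ?thesis by blast
    qed
    then obtain b where b: "\<And>k x. norm (partial k g x) \<le> b k" by metis
    have "0 \<le> b k" for k using b[of k 0] norm_ge_zero order_trans by blast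
    then have "norm (partial k g x) \<le> (\<Sum>k\<in>UNIV. b k)" for k x
      using b[of k x] member_le_sum[of k UNIV b] by auto
    moreover have "0 \<le> (\<Sum>k\<in>UNIV. b k)" using \<open>\<And>k. 0 \<le> b k\<close> by (simp add: sum_nonneg)
    ultimately show thesis using that by blast
  qed
  have lip: "norm (g y - g x) \<le> 2 * B * norm (y - x)" for x y
  proof (rule differentiable_bound[OF convex_UNIV, where f'="\<lambda>x h. \<Sum>k\<in>UNIV. (h $ k) *\<^sub>R partial k g x"])
    show "onorm (\<lambda>h. \<Sum>k\<in>UNIV. (h $ k) *\<^sub>R partial k g x) \<le> 2 * B" for x
    proof (rule onorm_bound)
      fix h :: plane
      have "norm (\<Sum>k\<in>UNIV. (h $ k) *\<^sub>R partial k g x) \<le> (\<Sum>k\<in>(UNIV :: 2 set). norm h * B)"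
        by (intro sum_norm_le) (auto intro!: mult_mono component_le_norm_cart B)
      then show "norm (\<Sum>k\<in>UNIV. (h $ k) *\<^sub>R partial k g x) \<le> 2 * B * norm h" by (simp add: mult_ac)
    qed (use B in auto)
  qed (auto intro: has_derivative_at_withinI dg)
  define h where "h n = 1 / real (Suc n)" for n
  have h: "h n > 0" "h n \<le> 1" for n by (auto simp: h_def)
  have h0: "h \<longlonglongrightarrow> 0" unfolding h_def using LIMSEQ_inverse_real_of_nat by (simp add: inverse_eq_divide)
  define Q where "Q n x = (g (h n *\<^sub>R e + x) - g x) /\<^sub>R h n" for n x
  have "(\<lambda>n. LINT x|lborel. Q n x) \<longlonglongrightarrow> (LINT x|lborel. partial j g x)"
  proof (rule integral_dominated_convergence)
    \<comment> \<open>The steps \<open>h n\<close> are at most 1, so the ball of radius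
      \<open>R + 1\<close> contains the supports of all quotients; \<open>2 * B\<close> is a
      Lipschitz constant of \<open>g\<close>.\<close>
    show "integrable lborel (\<lambda>x. indicator (cball 0 (R + 1) :: plane set) x *\<^sub>R (2 * B))"
      by (rule borel_integrable_compact) auto
    show "partial j g \<in> borel_measurable lborel" using Cc_measurable[OF Cc_partial[OF g]] by simp
    show "Q n \<in> borel_measurable lborel" for n unfolding Q_def by measurable
    show "AE x in lborel. (\<lambda>n. Q n x) \<longlonglongrightarrow> partial j g x"
    proof (rule AE_I2)
      fix x
      have "((\<lambda>t. g (x + t *\<^sub>R e)) has_vector_derivative partial j g x) (at 0)"
      proof -
        have "((\<lambda>t. g (x + t *\<^sub>R e)) has_derivative (\<lambda>t. \<Sum>k\<in>UNIV. ((t *\<^sub>R e) $ k) *\<^sub>R partial k g x)) (at 0)"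
          using dg[of x] by (intro has_derivative_compose[of "\<lambda>t. x + t *\<^sub>R e" _ 0 UNIV g]) (auto intro!: derivative_eq_intros)
        moreover have "(\<Sum>k\<in>UNIV. ((t *\<^sub>R e) $ k) *\<^sub>R partial k g x) = t *\<^sub>R partial j g x" for t
          using sum_axis[of j "\<lambda>k. partial k g x"] by (simp add: e_def scaleR_sum_right[symmetric] flip: scaleR_scaleR)
        ultimately show ?thesis by (simp add: has_vector_derivative_def)
      qed
      then have "((\<lambda>t. (g (x + t *\<^sub>R e) - g x - t *\<^sub>R partial j g x) /\<^sub>R norm t) \<longlongrightarrow> 0) (at 0)"
        by (simp add: has_vector_derivative_def has_derivative_at_within)
      from tendsto_norm_zero[OF this]
      have "((\<lambda>t. norm ((g (x + t *\<^sub>R e) - g x) /\<^sub>R t - partial j g x)) \<longlongrightarrow> 0) (at 0)"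
      proof (rule Lim_transform_eventually)
        have "norm ((g (x + t *\<^sub>R e) - g x - t *\<^sub>R partial j g x) /\<^sub>R norm t) =
            norm ((g (x + t *\<^sub>R e) - g x) /\<^sub>R t - partial j g x)" if "t \<noteq> 0" for t
        proof -
          have "(g (x + t *\<^sub>R e) - g x) /\<^sub>R t - partial j g x = (g (x + t *\<^sub>R e) - g x - t *\<^sub>R partial j g x) /\<^sub>R t"
            using that by (simp add: scaleR_diff_right)
          then show ?thesis by simp
        qed
        then show "\<forall>\<^sub>F t in at 0. norm ((g (x + t *\<^sub>R e) - g x - t *\<^sub>R partial j g x) /\<^sub>R norm t) =
            norm ((g (x + t *\<^sub>R e) - g x) /\<^sub>R t - partial j g x)"
          by (auto simp: eventually_at_filter)
      qed
      then have q: "((\<lambda>t. (g (x + t *\<^sub>R e) - g x) /\<^sub>R t) \<longlongrightarrow> partial j g x) (at 0)"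
        by (metis (no_types) LIM_zero_cancel tendsto_norm_zero_cancel)
      have "filterlim h (at 0) sequentially"
        using h0 h(1) by (auto simp: filterlim_at intro!: always_eventually) (metis less_irrefl)
      from filterlim_compose[OF q this] show "(\<lambda>n. Q n x) \<longlonglongrightarrow> partial j g x"
        unfolding Q_def by (simp add: add.commute)
    qed
    show "AE x in lborel. norm (Q n x) \<le> indicator (cball 0 (R + 1)) x *\<^sub>R (2 * B)" for n
    proof (rule AE_I2)
      fix x
      show "norm (Q n x) \<le> indicator (cball 0 (R + 1)) x *\<^sub>R (2 * B)"
      proof (cases "x \<in> cball 0 (R + 1)")
        case True
        have "norm (Q n x) = norm (g (h n *\<^sub>R e + x) - g x) / h n"
          using h[of n] by (simp add: Q_def divide_inverse mult.commute)
        also have "\<dots> \<le> 2 * B * norm (h n *\<^sub>R e + x - x) / h n"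
          using lip[of "h n *\<^sub>R e + x" x] h[of n] by (intro divide_right_mono) auto
        also have "\<dots> = 2 * B" using h(1)[of n] ne by simp
        finally show ?thesis using True by simp
      next
        case False
        have "norm x \<le> norm (h n *\<^sub>R e + x) + norm (h n *\<^sub>R e)"
          by (metis add.commute add_diff_cancel_left' norm_triangle_sub norm_minus_commute add_diff_cancel norm_triangle_ineq4)
        then have "norm (h n *\<^sub>R e + x) > R" using False h[of n] ne by simp
        then have "g (h n *\<^sub>R e + x) = 0" "g x = 0" using R[of x] R[of "h n *\<^sub>R e + x"] False by force+
        then show ?thesis using False by (simp add: Q_def)
      qed
    qed
  qed
  moreover have "(LINT x|lborel. Q n x) = 0" for n
  proof -
    have i: "integrable lborel g" using g by (rule Cc_integrable)
    have "integrable lborel (\<lambda>x. g (h n *\<^sub>R e + x))"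
      using i integrable_distr_eq[of "(+) (h n *\<^sub>R e)" lborel borel g] by (simp add: lborel_distr_plus)
    with i show ?thesis unfolding Q_def by (simp add: integral_translate)
  qed
  ultimately show ?thesis using LIMSEQ_unique by (metis (no_types) LIMSEQ_const_iff ext)
qed

section \<open>Derivatives and decay of inverse Fourier transforms\<close>

definition imon :: "2 list \<Rightarrow> plane \<Rightarrow> complex" where
  "imon js \<xi> = (\<Prod>j\<leftarrow>js. \<i> * of_real (\<xi> $ j))"

lemma imon_Nil [simp]: "imon [] \<xi> = 1"
  and imon_Cons [simp]: "imon (j # js) \<xi> = \<i> * of_real (\<xi> $ j) * imon js \<xi>"
  by (simp_all add: imon_def)

lemma smooth_coord: "smooth (\<lambda>\<xi>::plane. complex_of_real (\<xi> $ j))"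
  by (rule smoothI_psm[OF psm_of_real[OF psm_coord]])

lemma smooth_imon: "smooth (imon js)"
proof (induction js)
  case Nil
  have "imon [] = (\<lambda>_. 1)" by auto
  then show ?case by (simp add: smooth_const)
next
  case (Cons j js)
  have "imon (j # js) = (\<lambda>\<xi>. \<i> * of_real (\<xi> $ j) * imon js \<xi>)" by auto
  then show ?case using Cons by (simp add: smooth_mult smooth_const smooth_coord)
qed

lemma norm_imon: "norm (imon js \<xi>) \<le> norm \<xi> ^ length js"
  by (induction js) (auto simp: norm_mult intro!: mult_mono component_le_norm_cart)

lemma partials_cis:
  "partials js (\<lambda>x. a * cis (x \<bullet> \<xi>)) = (\<lambda>x. a * imon js \<xi> * cis (x \<bullet> \<xi>))"
proof (induction js)
  case (Cons j js)
  have d: "(\<lambda>x::plane. x \<bullet> \<xi>) differentiable (at x)" for x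
    by (intro bounded_linear_imp_differentiable bounded_linear_inner_left)
  have p: "partial j (\<lambda>x::plane. x \<bullet> \<xi>) x = \<xi> $ j" for x
    using partial_eq[OF bounded_linear.has_derivative[OF bounded_linear_inner_left[of \<xi>] has_derivative_ident], of j x]
    by (simp add: inner_axis')
  have c: "(\<lambda>x. cis (x \<bullet> \<xi>)) differentiable (at x)" for x
    by (rule psm_differentiable[OF psm_cis[OF psm_fixed_linear[OF bounded_linear_inner_left]], of 0 "{0::real}"]) simp
  show ?case
    unfolding partials_Cons Cons.IH
    by (rule ext, subst partial_bounded_linear[OF bounded_linear_mult_right c])
      (simp add: partial_cis[OF d] p mult_ac)
qed simp

lemma smooth_cis_inner: "smooth (\<lambda>x. cis (x \<bullet> \<xi>))"
  by (rule smoothI_psm[OF psm_cis[OF psm_fixed_linear[OF bounded_linear_inner_left]]])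

lemma smooth_cis_inner_right: "smooth (\<lambda>x. cis (\<xi> \<bullet> x))"
  using smooth_cis_inner[of \<xi>] by (simp add: inner_commute)

text \<open>The exponential has modulus one, so differentiating in \<open>x\<close> costs only the
  factor \<open>imon js \<xi>\<close>, the symbol of \<open>partials js\<close>, which is integrable
  against the compactly supported \<open>g\<close>.\<close>

lemma Cc_dominated:
  assumes g: "g \<in> Cc"
  shows "dominated_family {0::real} lborel (\<lambda>_ \<xi> x. g \<xi> * cis (x \<bullet> \<xi>))"
  unfolding dominated_family_def
proof (intro conjI ballI allI)
  show "psm {0} (\<lambda>_ x. g \<xi> * cis (x \<bullet> \<xi>))" for \<xi>
    by (intro smooth_imp_psm smooth_mult smooth_const smooth_cis_inner)
  show "(\<lambda>\<xi>. partials js (\<lambda>x. g \<xi> * cis (x \<bullet> \<xi>)) x) \<in> borel_measurable lborel" for js x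
    using smooth_mult[OF smooth_mult[OF Cc_smooth[OF g] smooth_imon[of js]] smooth_cis_inner_right[of x]]
    by (simp add: partials_cis borel_measurable_continuous_onI smooth_continuous)
  show "\<exists>G. integrable lborel G \<and> (\<forall>q\<in>{0::real}. \<forall>\<xi>\<in>space lborel. \<forall>x. norm (partials js (\<lambda>x. g \<xi> * cis (x \<bullet> \<xi>)) x) \<le> G \<xi>)" for js
    using Cc_integrable[OF Cc_mult[OF g smooth_imon[of js]]]
    by (intro exI[of _ "\<lambda>\<xi>. norm (imon js \<xi> * g \<xi>)"] conjI ballI allI integrable_norm)
      (simp_all add: partials_cis norm_mult mult.commute)
qed

lemma inv_fourier_alt: "inv_fourier g x = of_real (1 / (2 * pi)\<^sup>2) * (LINT \<xi>|lborel. g \<xi> * cis (x \<bullet> \<xi>))"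
  by (simp add: inv_fourier_def mult.commute)

lemma smooth_inv_fourier:
  assumes g: "g \<in> Cc"
  shows "smooth (inv_fourier g)"
  unfolding inv_fourier_alt[abs_def]
  by (intro smooth_mult smooth_const smoothI_psm[OF psm_integral[OF Cc_dominated[OF g]]])

lemma partials_inv_fourier:
  assumes g: "g \<in> Cc"
  shows "partials js (inv_fourier g) = inv_fourier (\<lambda>\<xi>. imon js \<xi> * g \<xi>)"
proof -
  have "smooth (\<lambda>x. LINT \<xi>|lborel. g \<xi> * cis (x \<bullet> \<xi>))"
    by (rule smoothI_psm[OF psm_integral[OF Cc_dominated[OF g]]])
  note sm = this
  define c where "c = complex_of_real (1 / (2 * pi)\<^sup>2)"
  have c: "inv_fourier g = (\<lambda>x. c * (LINT \<xi>|lborel. g \<xi> * cis (x \<bullet> \<xi>)))" for g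
    by (simp add: inv_fourier_alt c_def fun_eq_iff)
  show ?thesis
    unfolding c
    using partials_bounded_linear[OF bounded_linear_mult_right sm, of js c]
    by (simp add: dominated_family_partials_integral[OF Cc_dominated[OF g], of 0] partials_cis mult_ac)
qed

lemma partial_inv_fourier:
  "g \<in> Cc \<Longrightarrow> partial j (inv_fourier g) = inv_fourier (\<lambda>\<xi>. \<i> * of_real (\<xi> $ j) * g \<xi>)"
  using partials_inv_fourier[of g "[j]"] by (simp add: partials_Cons)

lemma inv_fourier_cmult: "inv_fourier (\<lambda>\<xi>. c * g \<xi>) x = c * inv_fourier g x"
  by (simp add: inv_fourier_def mult.left_commute)

lemma integrable_cis:
  assumes "g \<in> Cc"
  shows "integrable lborel (\<lambda>\<xi>. cis (x \<bullet> \<xi>) * g \<xi>)"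
  by (rule Cc_integrable_mult[OF assms]) (rule smooth_continuous[OF smooth_cis_inner_right])

lemma inv_fourier_add:
  "f \<in> Cc \<Longrightarrow> g \<in> Cc \<Longrightarrow> inv_fourier (\<lambda>\<xi>. f \<xi> + g \<xi>) x = inv_fourier f x + inv_fourier g x"
  by (simp add: inv_fourier_def distrib_left integrable_cis)

text \<open>Integration by parts: the derivative of \<open>cis (x \<bullet> \<xi>) * g \<xi>\<close>
  in \<open>\<xi>\<close> has zero integral, and differentiating the exponential produces
  \<open>\<i> * x $ j\<close>.\<close>

lemma inv_fourier_coord:
  assumes g: "g \<in> Cc"
  shows "of_real (x $ j) * inv_fourier g x = inv_fourier (\<lambda>\<xi>. \<i> * partial j g \<xi>) x"
proof -
  let ?e = "\<lambda>\<xi>. cis (x \<bullet> \<xi>)"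
  have e: "smooth ?e" by (rule smooth_cis_inner_right)
  have p: "partial j ?e \<xi> = \<i> * of_real (x $ j) * ?e \<xi>" for \<xi>
    using partials_cis[of "[j]" 1 x] by (simp add: partials_Cons inner_commute fun_eq_iff)
  have "partial j (\<lambda>\<xi>. ?e \<xi> * g \<xi>) \<xi> = ?e \<xi> * partial j g \<xi> + \<i> * of_real (x $ j) * (?e \<xi> * g \<xi>)" for \<xi>
    using partial_mult[OF smooth_differentiable[OF e] smooth_differentiable[OF Cc_smooth[OF g]], of j \<xi>]
    by (simp add: p)
  then have "0 = (LINT \<xi>|lborel. ?e \<xi> * partial j g \<xi> + \<i> * of_real (x $ j) * (?e \<xi> * g \<xi>))"
    using integral_partial[OF Cc_mult[OF g e], of j] by simp
  also have "\<dots> = (LINT \<xi>|lborel. ?e \<xi> * partial j g \<xi>) + \<i> * of_real (x $ j) * (LINT \<xi>|lborel. ?e \<xi> * g \<xi>)"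
    using integrable_cis[OF g, of x] integrable_cis[OF Cc_partial[OF g], of x j]
    by (subst Bochner_Integration.integral_add) auto
  finally have "of_real (x $ j) * (LINT \<xi>|lborel. ?e \<xi> * g \<xi>) = \<i> * (LINT \<xi>|lborel. ?e \<xi> * partial j g \<xi>)"
    by (simp add: algebra_simps complex_eq_iff)
  then show ?thesis
    by (simp add: inv_fourier_def mult.left_commute)
qed

text \<open>A product of one-variable weights rather than \<open>1 + |x|^2\<close>, whose reciprocal
  fails to be integrable in the plane. The reciprocal of the product factorizes over the
  coordinates.\<close>

definition quad_weight :: "plane \<Rightarrow> real" where
  "quad_weight x = (\<Prod>b\<in>Basis. 1 + (x \<bullet> b)\<^sup>2)"

lemma quad_weight_eq: "quad_weight x = (1 + (x $ 1)\<^sup>2) * (1 + (x $ 2)\<^sup>2)"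
proof -
  have B: "(Basis :: plane set) = {axis 1 1, axis 2 1}"
    by (auto simp: Basis_vec_def exhaust_2) (metis exhaust_2)
  show ?thesis unfolding quad_weight_def B by (simp add: inner_axis axis_eq_axis)
qed

lemma quad_weight_pos: "quad_weight x > 0"
  unfolding quad_weight_eq by (intro mult_pos_pos add_pos_nonneg) auto

lemma inv_fourier_bounded: "\<exists>B. \<forall>x. norm (inv_fourier g x) \<le> B"
proof (intro exI allI)
  show "norm (inv_fourier g x) \<le> norm (of_real (1 / (2 * pi)\<^sup>2) :: complex) * (LINT \<xi>|lborel. norm (g \<xi>))" for x
  proof -
    have "norm (LINT \<xi>|lborel. cis (x \<bullet> \<xi>) * g \<xi>) \<le> (LINT \<xi>|lborel. norm (cis (x \<bullet> \<xi>) * g \<xi>))"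
      by (rule integral_norm_bound)
    also have "\<dots> = (LINT \<xi>|lborel. norm (g \<xi>))" by (simp add: norm_mult)
    finally show ?thesis unfolding inv_fourier_def norm_mult by (rule mult_left_mono) simp
  qed
qed

lemma inv_fourier_coord_power:
  assumes "g \<in> Cc"
  shows "\<exists>g'\<in>Cc. \<forall>x. of_real (x $ j) ^ n * inv_fourier g x = inv_fourier g' x"
proof (induction n)
  case (Suc n)
  then obtain h where h: "h \<in> Cc" "\<And>x. of_real (x $ j) ^ n * inv_fourier g x = inv_fourier h x" by auto
  show ?case
    using inv_fourier_coord[OF h(1), of _ j] h(2)
    by (intro bexI[of _ "\<lambda>\<xi>. \<i> * partial j h \<xi>"] Cc_cmult Cc_partial h(1)) (simp add: mult.assoc)
qed (use assms in auto)

lemma inv_fourier_weight: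
  assumes "g \<in> Cc"
  shows "\<exists>g'\<in>Cc. \<forall>x. of_real (quad_weight x) * inv_fourier g x = inv_fourier g' x"
proof -
  have 1: "\<exists>g'\<in>Cc. \<forall>x. of_real (1 + (x $ j)\<^sup>2) * inv_fourier g x = inv_fourier g' x" if g: "g \<in> Cc" for g and j :: 2
  proof -
    obtain h where "h \<in> Cc" "\<And>x. of_real (x $ j) ^ 2 * inv_fourier g x = inv_fourier h x"
      using inv_fourier_coord_power[OF g, of j 2] by auto
    then show ?thesis using g
      by (intro bexI[of _ "\<lambda>\<xi>. g \<xi> + h \<xi>"] Cc_add) (auto simp: inv_fourier_add algebra_simps)
  qed
  obtain h where h: "h \<in> Cc" "\<And>x. of_real (1 + (x $ 2)\<^sup>2) * inv_fourier g x = inv_fourier h x" using 1[OF assms, of 2] by auto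
  obtain k where k: "k \<in> Cc" "\<And>x. of_real (1 + (x $ 1)\<^sup>2) * inv_fourier h x = inv_fourier k x" using 1[OF h(1), of 1] by auto
  have "of_real (quad_weight x) * inv_fourier g x = inv_fourier k x" for x
    unfolding quad_weight_eq k(2)[symmetric] h(2)[symmetric] by simp
  then show ?thesis using k(1) by auto
qed

lemma norm_power_le:
  fixes x :: plane
  shows "norm x ^ n \<le> 2 ^ n * (\<bar>x $ 1\<bar> ^ n + \<bar>x $ 2\<bar> ^ n)"
proof -
  let ?m = "max \<bar>x $ 1\<bar> \<bar>x $ 2\<bar>"
  have "norm x \<le> \<bar>x $ 1\<bar> + \<bar>x $ 2\<bar>" using norm_le_l1_cart[of x] by (simp add: sum_2)
  also have "\<dots> \<le> 2 * ?m" by simp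
  finally have "norm x ^ n \<le> (2 * ?m) ^ n" by (intro power_mono) auto
  also have "\<dots> = 2 ^ n * ?m ^ n" by (simp add: power_mult_distrib)
  also have "?m ^ n \<le> \<bar>x $ 1\<bar> ^ n + \<bar>x $ 2\<bar> ^ n" by (auto simp: max_def)
  finally show ?thesis by simp
qed

lemma inv_fourier_decay:
  assumes g: "g \<in> Cc"
  shows "\<exists>B. \<forall>x. norm x ^ n * norm (inv_fourier g x) \<le> B"
proof -
  have "\<exists>B. \<forall>x. \<bar>x $ j\<bar> ^ n * norm (inv_fourier g x) \<le> B" for j
  proof -
    obtain h where h: "h \<in> Cc" "\<And>x. of_real (x $ j) ^ n * inv_fourier g x = inv_fourier h x"
      using inv_fourier_coord_power[OF g, of j n] by auto
    obtain B where B: "\<And>x. norm (inv_fourier h x) \<le> B" using inv_fourier_bounded[of h] by auto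
    have "\<bar>x $ j\<bar> ^ n * norm (inv_fourier g x) = norm (inv_fourier h x)" for x
      unfolding h(2)[symmetric] by (simp add: norm_mult norm_power)
    then show ?thesis using B by auto
  qed
  then obtain B where B: "\<And>j x. \<bar>x $ j\<bar> ^ n * norm (inv_fourier g x) \<le> B j" by metis
  show ?thesis
  proof (intro exI allI)
    fix x
    have "norm x ^ n * norm (inv_fourier g x) \<le> 2 ^ n * (\<bar>x $ 1\<bar> ^ n + \<bar>x $ 2\<bar> ^ n) * norm (inv_fourier g x)"
      by (intro mult_right_mono norm_power_le) simp
    also have "\<dots> = 2 ^ n * (\<bar>x $ 1\<bar> ^ n * norm (inv_fourier g x) + \<bar>x $ 2\<bar> ^ n * norm (inv_fourier g x))"
      by (simp add: algebra_simps)
    also have "\<dots> \<le> 2 ^ n * (B 1 + B 2)" by (intro mult_left_mono add_mono B) simp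
    finally show "norm x ^ n * norm (inv_fourier g x) \<le> 2 ^ n * (B 1 + B 2)" .
  qed
qed

lemma inv_fourier_schwartz:
  assumes g: "g \<in> Cc"
  shows "inv_fourier g \<in> schwartz"
  unfolding schwartz_def
proof (intro CollectI conjI allI)
  show "smooth (inv_fourier g)" by (rule smooth_inv_fourier[OF g])
  fix js k
  obtain B where "\<And>x. norm x ^ k * norm (inv_fourier (\<lambda>\<xi>. imon js \<xi> * g \<xi>) x) \<le> B"
    using inv_fourier_decay[OF Cc_mult[OF g smooth_imon[of js]], of k] by auto
  then show "bounded (range (\<lambda>x. norm x ^ k *\<^sub>R partials js (inv_fourier g) x))"
    unfolding bounded_iff partials_inv_fourier[OF g] by (intro exI[of _ B]) auto
qed

interpretation lborel_product: product_sigma_finite "\<lambda>_::'a::euclidean_space. lborel :: real measure" ..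

text \<open>Lebesgue measure is the image of the product of one-dimensional Lebesgue measures under
  the coordinate map, so products of one-variable functions integrate factor by factor.\<close>

lemma product_lborel:
  fixes f :: "'a::euclidean_space \<Rightarrow> real \<Rightarrow> 'b::{real_normed_field, banach, second_countable_topology}"
  assumes f: "\<And>b. b \<in> Basis \<Longrightarrow> integrable lborel (f b)"
  shows "integrable lborel (\<lambda>x::'a. \<Prod>b\<in>Basis. f b (x \<bullet> b))"
    and "(LINT x|lborel. (\<Prod>b\<in>Basis. f b (x \<bullet> b))) = (\<Prod>b\<in>(Basis :: 'a set). LINT t|lborel. f b t)"
proof -
  let ?P = "\<Pi>\<^sub>M b\<in>(Basis :: 'a set). (lborel :: real measure)"
  let ?T = "\<lambda>y. \<Sum>b\<in>Basis. y b *\<^sub>R b :: 'a"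
  have l: "lborel = distr ?P borel ?T" by (subst lborel_def) (simp add: lborel_eq_real)
  have [measurable]: "\<And>b. b \<in> Basis \<Longrightarrow> f b \<in> borel_measurable borel"
    using f borel_measurable_integrable by fastforce
  have [measurable]: "(\<lambda>x::'a. \<Prod>b\<in>Basis. f b (x \<bullet> b)) \<in> borel_measurable borel" by measurable
  have T: "?T \<in> ?P \<rightarrow>\<^sub>M borel" by measurable
  have e: "(\<lambda>y. \<Prod>b\<in>Basis. f b (?T y \<bullet> b)) = (\<lambda>y. \<Prod>b\<in>Basis. f b (y b))"
    by (intro ext prod.cong) auto
  show "integrable lborel (\<lambda>x::'a. \<Prod>b\<in>Basis. f b (x \<bullet> b))"
    unfolding l by (subst integrable_distr_eq[OF T]) (auto simp: e intro!: lborel_product.product_integrable_prod f)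
  show "(LINT x|lborel. (\<Prod>b\<in>Basis. f b (x \<bullet> b))) = (\<Prod>b\<in>(Basis :: 'a set). LINT t|lborel. f b t)"
    unfolding l by (subst integral_distr[OF T]) (auto simp: e intro!: lborel_product.product_integral_prod f)
qed

lemma integrable_quad_weight: "integrable lborel (\<lambda>x. inverse (quad_weight x))"
proof -
  have "integrable lborel (\<lambda>t::real. inverse (1 + t\<^sup>2))"
    using integrable_inverse_1_plus_square by (simp add: set_integrable_def)
  from product_lborel(1)[of "\<lambda>_. \<lambda>t. inverse (1 + t\<^sup>2)", OF this] show ?thesis
    by (simp add: quad_weight_def prod_inversef[symmetric] comp_def)
qed

text \<open>Multiplication by the weight leads to another inverse Fourier transform of a function in
  \<open>Cc\<close>, which decays at every order; dividing back gives an integrable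
  majorant.\<close>

lemma inv_fourier_integrable_power:
  assumes g: "g \<in> Cc"
  shows "integrable lborel (\<lambda>x. norm x ^ n * norm (inv_fourier g x))"
proof -
  obtain h where h: "h \<in> Cc" "\<And>x. of_real (quad_weight x) * inv_fourier g x = inv_fourier h x"
    using inv_fourier_weight[OF g] by auto
  obtain B where B: "\<And>x. norm x ^ n * norm (inv_fourier h x) \<le> B" using inv_fourier_decay[OF h(1), of n] by auto
  have *: "norm x ^ n * norm (inv_fourier g x) \<le> B * inverse (quad_weight x)" for x
  proof -
    have "norm (inv_fourier h x) = quad_weight x * norm (inv_fourier g x)"
      unfolding h(2)[symmetric] using quad_weight_pos[of x] by (simp add: norm_mult)
    then show ?thesis using B[of x] quad_weight_pos[of x] by (simp add: field_simps)
  qed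
  have "continuous_on UNIV (inv_fourier g)" by (rule smooth_continuous[OF smooth_inv_fourier[OF g]])
  then have meas: "(\<lambda>x. norm x ^ n * norm (inv_fourier g x)) \<in> borel_measurable lborel"
    by (auto intro!: borel_measurable_continuous_onI continuous_intros)
  show ?thesis
    by (rule Bochner_Integration.integrable_bound[OF integrable_mult_right[OF integrable_quad_weight, of B] meas])
      (auto intro!: AE_I2 order_trans[OF * abs_ge_self])
qed


text \<open>Inversion is obtained from Gaussian summation.\<close>

lemma char_gaussian:
  "(LINT t|lborel. cis (t * u) * of_real (exp (- t\<^sup>2 / 2))) = of_real (sqrt (2 * pi) * exp (- u\<^sup>2 / 2))"
  and integrable_gaussian: "integrable lborel (\<lambda>t::real. exp (- t\<^sup>2 / 2))"
proof -
  have d: "std_normal_density t = exp (- t\<^sup>2 / 2) / sqrt (2 * pi)" for t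
    by (simp add: std_normal_density_def)
  have "of_real (exp (- u\<^sup>2 / 2)) = (LINT t|std_normal_distribution. iexp (u * t))"
    using fun_cong[OF char_std_normal_distribution, of u] by (simp add: char_def)
  also have "\<dots> = (LINT t|lborel. std_normal_density t *\<^sub>R iexp (u * t))"
    by (rule integral_density) auto
  also have "\<dots> = (LINT t|lborel. cis (t * u) * of_real (exp (- t\<^sup>2 / 2)) / of_real (sqrt (2 * pi)))"
    by (intro Bochner_Integration.integral_cong) (simp_all add: d scaleR_conv_of_real cis_conv_exp mult_ac)
  finally show "(LINT t|lborel. cis (t * u) * of_real (exp (- t\<^sup>2 / 2))) = of_real (sqrt (2 * pi) * exp (- u\<^sup>2 / 2))"
    by (simp add: field_simps)
  have "integrable lborel (\<lambda>t. sqrt (2 * pi) * std_normal_density t)"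
    by (intro integrable_mult_right integrable_normal_density) simp
  then show "integrable lborel (\<lambda>t::real. exp (- t\<^sup>2 / 2))" by (simp add: d)
qed

lemma gaussian_fourier:
  assumes "s > 0"
  shows "integrable lborel (\<lambda>t::real. cis (t * u) * of_real (exp (- (t / s)\<^sup>2 / 2)))"
    and "(LINT t|lborel. cis (t * u) * of_real (exp (- (t / s)\<^sup>2 / 2))) = of_real (s * sqrt (2 * pi) * exp (- (s * u)\<^sup>2 / 2))"
proof -
  let ?f = "\<lambda>t. cis (t * u) * of_real (exp (- (t / s)\<^sup>2 / 2))"
  have m: "?f \<in> borel_measurable borel"
    by (intro borel_measurable_continuous_onI continuous_intros) (use assms in auto)
  have e: "?f (0 + s *\<^sub>R t) = cis (t * (s * u)) * of_real (exp (- t\<^sup>2 / 2))" for t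
    using assms by (simp add: mult_ac)
  have "(LINT t|lborel. ?f t) = \<bar>s\<bar> ^ DIM(real) *\<^sub>R (LINT t|lborel. ?f (0 + s *\<^sub>R t))"
    using assms m by (intro integral_scale) auto
  then show "(LINT t|lborel. ?f t) = of_real (s * sqrt (2 * pi) * exp (- (s * u)\<^sup>2 / 2))"
    unfolding e char_gaussian using assms by (simp add: scaleR_conv_of_real)
  have "integrable lborel (\<lambda>t. exp (- (t / s)\<^sup>2 / 2))"
    using lborel_integrable_real_affine[OF integrable_gaussian, of "1 / s" 0] assms by simp
  then show "integrable lborel ?f"
    by (rule Bochner_Integration.integrable_bound) (use m in \<open>auto simp: norm_mult\<close>)
qed

definition gauss :: "real \<Rightarrow> plane \<Rightarrow> real" where
  "gauss s x = exp (- (norm x / s)\<^sup>2 / 2)"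

lemma gauss_prod: "gauss s x = (\<Prod>b\<in>Basis. exp (- ((x \<bullet> b) / s)\<^sup>2 / 2))"
proof -
  have "(norm x / s)\<^sup>2 = (\<Sum>b\<in>Basis. ((x \<bullet> b) / s)\<^sup>2)"
    by (simp add: power_divide norm_eq_sqrt_inner euclidean_inner[of x x] power2_eq_square sum_nonneg sum_divide_distrib)
  then show ?thesis by (simp add: gauss_def exp_sum[symmetric] sum_negf sum_divide_distrib)
qed

lemma gauss_fourier:
  assumes "s > 0"
  shows "integrable lborel (\<lambda>x. cis (x \<bullet> \<eta>) * of_real (gauss s x))"
    and "(LINT x|lborel. cis (x \<bullet> \<eta>) * of_real (gauss s x)) = of_real (2 * pi * s\<^sup>2 * exp (- (s * norm \<eta>)\<^sup>2 / 2))"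
proof -
  let ?f = "\<lambda>b::plane. \<lambda>t. cis (t * (\<eta> \<bullet> b)) * of_real (exp (- (t / s)\<^sup>2 / 2))"
  have cis_sum: "cis (sum f A) = (\<Prod>b\<in>A. cis (f b))" if "finite A" for f and A :: "plane set"
    using that by induction (auto simp: cis_mult[symmetric])
  have e: "cis (x \<bullet> \<eta>) * of_real (gauss s x) = (\<Prod>b\<in>Basis. ?f b (x \<bullet> b))" for x
    unfolding gauss_prod by (subst euclidean_inner) (simp add: cis_sum prod.distrib)
  show "integrable lborel (\<lambda>x. cis (x \<bullet> \<eta>) * of_real (gauss s x))"
    unfolding e by (rule product_lborel) (rule gaussian_fourier[OF assms])
  have n: "(s * norm \<eta>)\<^sup>2 = (\<Sum>b\<in>Basis. (s * (\<eta> \<bullet> b))\<^sup>2)"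
  proof -
    have "(norm \<eta>)\<^sup>2 = (\<Sum>b\<in>Basis. (\<eta> \<bullet> b)\<^sup>2)"
      by (subst power2_norm_eq_inner, subst euclidean_inner) (simp add: power2_eq_square)
    then show ?thesis by (simp add: power_mult_distrib sum_distrib_left)
  qed
  have "(LINT x|lborel. cis (x \<bullet> \<eta>) * of_real (gauss s x)) = (\<Prod>b\<in>(Basis :: plane set). LINT t|lborel. ?f b t)"
    unfolding e by (rule product_lborel) (rule gaussian_fourier[OF assms])
  also have "\<dots> = (\<Prod>b\<in>(Basis :: plane set). of_real (s * sqrt (2 * pi) * exp (- (s * (\<eta> \<bullet> b))\<^sup>2 / 2)))"
    by (simp only: gaussian_fourier(2)[OF assms])
  also have "\<dots> = of_real ((s * sqrt (2 * pi))\<^sup>2 * exp (- (s * norm \<eta>)\<^sup>2 / 2))"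
  proof -
    have "(\<Prod>b\<in>(Basis :: plane set). c * exp (- (s * (\<eta> \<bullet> b))\<^sup>2 / 2)) = c\<^sup>2 * exp (- (s * norm \<eta>)\<^sup>2 / 2)" for c
      unfolding n prod.distrib by (simp add: exp_sum[symmetric] sum_negf sum_divide_distrib)
    then show ?thesis by (simp only: flip: of_real_prod)
  qed
  also have "(s * sqrt (2 * pi))\<^sup>2 = 2 * pi * s\<^sup>2" by (simp add: power_mult_distrib)
  finally show "(LINT x|lborel. cis (x \<bullet> \<eta>) * of_real (gauss s x)) = of_real (2 * pi * s\<^sup>2 * exp (- (s * norm \<eta>)\<^sup>2 / 2))" .
qed

lemma inv_fourier_integrable:
  assumes "g \<in> Cc"
  shows "integrable lborel (\<lambda>x. norm (inv_fourier g x))"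
  using inv_fourier_integrable_power[OF assms, of 0] by simp

text \<open>The double integral in \<open>x\<close> and \<open>\<xi>\<close> does not converge
  absolutely unless \<open>g\<close> is zero. A Gaussian of width \<open>n + 1\<close> in
  \<open>x\<close> makes it converge, and \<open>A n\<close> is evaluated in two ways: as
  \<open>n\<close> grows the Gaussian tends to 1, while after the exchange its transform
  concentrates at \<open>\<xi>0\<close>.\<close>

lemma fourier_inv_fourier:
  assumes g: "g \<in> Cc"
  shows "fourier (inv_fourier g) \<xi>0 = g \<xi>0"
proof -
  let ?c = "complex_of_real (1 / (2 * pi)\<^sup>2)"
  define A where "A n = (LINT x|lborel. of_real (gauss (real (Suc n)) x) * (cis (- (x \<bullet> \<xi>0)) * inv_fourier g x))" for n
  have cg: "continuous_on UNIV g" by (rule smooth_continuous[OF Cc_smooth[OF g]])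
  have ci: "continuous_on UNIV (inv_fourier g)" by (rule smooth_continuous[OF smooth_inv_fourier[OF g]])
  have cga: "continuous_on UNIV (gauss s)" for s
  proof -
    have "continuous_on UNIV (\<lambda>x::plane. exp (- (norm x * inverse s)\<^sup>2 * inverse 2))"
      by (intro continuous_on_exp continuous_on_mult continuous_on_minus continuous_on_power
        continuous_on_norm continuous_on_id continuous_on_const)
    then show ?thesis by (simp only: gauss_def[abs_def] divide_inverse)
  qed
  have ga: "0 \<le> gauss s x" "gauss s x \<le> 1" for s x by (auto simp: gauss_def)
  have "A \<longlonglongrightarrow> (LINT x|lborel. cis (- (x \<bullet> \<xi>0)) * inv_fourier g x)"
    unfolding A_def
  proof (rule integral_dominated_convergence)
    show "integrable lborel (\<lambda>x. norm (inv_fourier g x))" by (rule inv_fourier_integrable[OF g])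
    show "AE x in lborel. norm (of_real (gauss (real (Suc n)) x) * (cis (- (x \<bullet> \<xi>0)) * inv_fourier g x)) \<le> norm (inv_fourier g x)" for n
      using ga by (intro AE_I2) (auto simp: norm_mult intro!: mult_left_le_one_le)
    show "AE x in lborel. (\<lambda>n. of_real (gauss (real (Suc n)) x) * (cis (- (x \<bullet> \<xi>0)) * inv_fourier g x)) \<longlonglongrightarrow> cis (- (x \<bullet> \<xi>0)) * inv_fourier g x"
    proof (rule AE_I2)
      fix x :: plane
      have "(\<lambda>n. norm x / real (Suc n)) \<longlonglongrightarrow> 0"
        using tendsto_mult[OF tendsto_const[of "norm x"] LIMSEQ_inverse_real_of_nat] by (simp add: divide_inverse)
      then have "(\<lambda>n. gauss (real (Suc n)) x) \<longlonglongrightarrow> exp (- 0\<^sup>2 / 2)"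
        unfolding gauss_def by (intro tendsto_intros) auto
      then have "(\<lambda>n. of_real (gauss (real (Suc n)) x) * (cis (- (x \<bullet> \<xi>0)) * inv_fourier g x)) \<longlonglongrightarrow> of_real 1 * (cis (- (x \<bullet> \<xi>0)) * inv_fourier g x)"
        by (intro tendsto_intros) simp
      then show "(\<lambda>n. of_real (gauss (real (Suc n)) x) * (cis (- (x \<bullet> \<xi>0)) * inv_fourier g x)) \<longlonglongrightarrow> cis (- (x \<bullet> \<xi>0)) * inv_fourier g x"
        by simp
    qed
  qed (auto intro!: borel_measurable_continuous_onI continuous_intros ci continuous_on_subset[OF cga])
  then have lim1: "A \<longlonglongrightarrow> fourier (inv_fourier g) \<xi>0" by (simp add: fourier_def)
  have A: "A n = ?c * of_real (2 * pi) * (LINT y|lborel. g (\<xi>0 + (1 / real (Suc n)) *\<^sub>R y) * of_real (gauss 1 y))" for n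
  proof -
    let ?s = "real (Suc n)"
    let ?F = "\<lambda>x \<xi>. cis (x \<bullet> (\<xi> - \<xi>0)) * of_real (gauss ?s x) * g \<xi>"
    have s: "?s > 0" by simp
    have int: "integrable (lborel \<Otimes>\<^sub>M lborel) (case_prod ?F)"
    proof (rule lborel_pair.Fubini_integrable)
      have "continuous_on UNIV (case_prod ?F)"
        unfolding case_prod_beta
        by (intro continuous_intros continuous_on_compose2[OF cga] continuous_on_compose2[OF cg]) auto
      then show "case_prod ?F \<in> borel_measurable (lborel \<Otimes>\<^sub>M lborel)"
        using borel_measurable_continuous_onI[of "case_prod ?F"] by (simp add: lborel_prod)
      have "integrable lborel (\<lambda>x. gauss ?s x * (LINT \<xi>|lborel. norm (g \<xi>)))"
        using integrable_norm[OF gauss_fourier(1)[OF s, of 0]] ga[of ?s] by (intro integrable_mult_left) simp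
      then show "integrable lborel (\<lambda>x. LINT \<xi>|lborel. norm (case_prod ?F (x, \<xi>)))"
        using ga[of ?s] by (simp add: norm_mult)
      show "AE x in lborel. integrable lborel (\<lambda>\<xi>. case_prod ?F (x, \<xi>))"
        by (intro AE_I2) (auto intro!: Cc_integrable_mult g continuous_intros)
    qed
    have "A n = (LINT x|lborel. ?c * (LINT \<xi>|lborel. ?F x \<xi>))"
      unfolding A_def
    proof (intro Bochner_Integration.integral_cong refl)
      fix x
      have "(LINT \<xi>|lborel. ?F x \<xi>) = (LINT \<xi>|lborel. of_real (gauss ?s x) * cis (- (x \<bullet> \<xi>0)) * (cis (x \<bullet> \<xi>) * g \<xi>))"
      proof (intro Bochner_Integration.integral_cong refl)
        fix \<xi>
        have "cis (x \<bullet> (\<xi> - \<xi>0)) = cis (- (x \<bullet> \<xi>0)) * cis (x \<bullet> \<xi>)"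
          by (simp add: inner_diff_right cis_mult)
        then show "?F x \<xi> = of_real (gauss ?s x) * cis (- (x \<bullet> \<xi>0)) * (cis (x \<bullet> \<xi>) * g \<xi>)"
          by (simp only: mult_ac)
      qed
      also have "\<dots> = of_real (gauss ?s x) * cis (- (x \<bullet> \<xi>0)) * (LINT \<xi>|lborel. cis (x \<bullet> \<xi>) * g \<xi>)"
        by (rule integral_mult_right_zero)
      finally show "of_real (gauss ?s x) * (cis (- (x \<bullet> \<xi>0)) * inv_fourier g x) = ?c * (LINT \<xi>|lborel. ?F x \<xi>)"
        by (simp add: inv_fourier_def mult_ac)
    qed
    also have "\<dots> = ?c * (LINT x|lborel. LINT \<xi>|lborel. ?F x \<xi>)" by (rule integral_mult_right_zero)
    also have "(LINT x|lborel. LINT \<xi>|lborel. ?F x \<xi>) = (LINT \<xi>|lborel. LINT x|lborel. ?F x \<xi>)"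
      by (rule lborel_pair.Fubini_integral[symmetric]) (rule int)
    also have "\<dots> = (LINT \<xi>|lborel. g \<xi> * of_real (2 * pi * ?s\<^sup>2 * exp (- (?s * norm (\<xi> - \<xi>0))\<^sup>2 / 2)))"
    proof (intro Bochner_Integration.integral_cong refl)
      fix \<xi>
      have "(LINT x|lborel. ?F x \<xi>) = (LINT x|lborel. cis (x \<bullet> (\<xi> - \<xi>0)) * of_real (gauss ?s x)) * g \<xi>"
        by (rule integral_mult_left_zero)
      then show "(LINT x|lborel. ?F x \<xi>) = g \<xi> * of_real (2 * pi * ?s\<^sup>2 * exp (- (?s * norm (\<xi> - \<xi>0))\<^sup>2 / 2))"
        by (simp only: gauss_fourier(2)[OF s] mult.commute[of _ "g \<xi>"])
    qed
    \<comment> \<open>The substitution \<open>\<xi> = \<xi>0 + y / s\<close> turns the concentrating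
      kernel into a fixed Gaussian; the Jacobian cancels the factor \<open>s^2\<close> of the
      kernel.\<close>
    also have "\<dots> = \<bar>1 / ?s\<bar> ^ DIM(plane) *\<^sub>R (LINT y|lborel. g (\<xi>0 + (1 / ?s) *\<^sub>R y) * of_real (2 * pi * ?s\<^sup>2 * exp (- (?s * norm (\<xi>0 + (1 / ?s) *\<^sub>R y - \<xi>0))\<^sup>2 / 2)))"
      by (rule integral_scale) (auto intro!: borel_measurable_continuous_onI continuous_intros cg)
    also have "\<dots> = \<bar>1 / ?s\<bar> ^ 2 *\<^sub>R (LINT y|lborel. of_real (2 * pi * ?s\<^sup>2) * (g (\<xi>0 + (1 / ?s) *\<^sub>R y) * of_real (gauss 1 y)))"
      by (simp add: gauss_def mult_ac del: of_nat_Suc)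
    also have "\<dots> = of_real ((1 / ?s) ^ 2 * (2 * pi * ?s\<^sup>2)) * (LINT y|lborel. g (\<xi>0 + (1 / ?s) *\<^sub>R y) * of_real (gauss 1 y))"
      by (simp add: scaleR_conv_of_real del: of_nat_Suc)
    also have "(1 / ?s) ^ 2 * (2 * pi * ?s\<^sup>2) = 2 * pi" by (simp add: power_divide del: of_nat_Suc)
    finally show ?thesis by (simp only: mult.assoc)
  qed
  obtain B where B: "\<And>x. norm (g x) \<le> B"
  proof -
    obtain R where R: "\<And>\<xi>. g \<xi> \<noteq> 0 \<Longrightarrow> norm \<xi> \<le> R" using g by (auto simp: Cc_def)
    have "compact (g ` cball 0 R)"
      by (intro compact_continuous_image continuous_on_subset[OF cg] compact_cball) simp
    from compact_imp_bounded[OF this] obtain B where "B > 0" "\<And>x. x \<in> cball 0 R \<Longrightarrow> norm (g x) \<le> B"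
      unfolding bounded_pos by auto
    then have "norm (g x) \<le> B" for x using R[of x] by (cases "g x = 0") auto
    then show thesis using that by blast
  qed
  have ig: "integrable lborel (gauss 1)"
    using integrable_norm[OF gauss_fourier(1)[of 1 0]] ga[of 1] by simp
  have "(\<lambda>n. LINT y|lborel. g (\<xi>0 + (1 / real (Suc n)) *\<^sub>R y) * of_real (gauss 1 y)) \<longlonglongrightarrow> (LINT y|lborel. g \<xi>0 * of_real (gauss 1 y))"
  proof (rule integral_dominated_convergence)
    show "integrable lborel (\<lambda>y. B * gauss 1 y)" using ig by simp
    show "AE y in lborel. norm (g (\<xi>0 + (1 / real (Suc n)) *\<^sub>R y) * of_real (gauss 1 y)) \<le> B * gauss 1 y" for n
      using ga[of 1] B by (intro AE_I2) (auto simp: norm_mult intro!: mult_right_mono)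
    show "AE y in lborel. (\<lambda>n. g (\<xi>0 + (1 / real (Suc n)) *\<^sub>R y) * of_real (gauss 1 y)) \<longlonglongrightarrow> g \<xi>0 * of_real (gauss 1 y)"
    proof (rule AE_I2)
      fix y :: plane
      have 1: "(\<lambda>n. \<xi>0 + (1 / real (Suc n)) *\<^sub>R y) \<longlonglongrightarrow> \<xi>0 + 0 *\<^sub>R y"
        using LIMSEQ_inverse_real_of_nat by (intro tendsto_intros) (simp add: inverse_eq_divide)
      have "isCont g (\<xi>0 + 0 *\<^sub>R y)" using cg by (simp add: continuous_on_eq_continuous_at)
      from isCont_tendsto_compose[OF this 1] have "(\<lambda>n. g (\<xi>0 + (1 / real (Suc n)) *\<^sub>R y)) \<longlonglongrightarrow> g \<xi>0"
        by (simp only: scaleR_zero_left add_0_right)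
      then show "(\<lambda>n. g (\<xi>0 + (1 / real (Suc n)) *\<^sub>R y) * of_real (gauss 1 y)) \<longlonglongrightarrow> g \<xi>0 * of_real (gauss 1 y)"
        by (intro tendsto_intros)
    qed
  qed (auto intro!: borel_measurable_continuous_onI continuous_intros cg cga continuous_on_compose2[OF cg])
  \<comment> \<open>One factor \<open>2 * pi\<close> came from the transform of the Gaussian, this
    one is its total mass; together they cancel the normalization of
    \<open>inv_fourier\<close>.\<close>
  also have "(LINT y|lborel. g \<xi>0 * of_real (gauss 1 y)) = g \<xi>0 * of_real (2 * pi)"
    using gauss_fourier(2)[of 1 0] by simp
  finally have "A \<longlonglongrightarrow> ?c * of_real (2 * pi) * (g \<xi>0 * of_real (2 * pi))"
    unfolding A[abs_def] by (intro tendsto_intros)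
  also have "?c * of_real (2 * pi) * (g \<xi>0 * of_real (2 * pi)) = g \<xi>0"
    by (simp add: power2_eq_square)
  finally show ?thesis using lim1 LIMSEQ_unique by blast
qed

section \<open>Test functions with small trace-free Hessian\<close>

text \<open>The constant 1 keeps the logarithm of this polynomial smooth and nonnegative.\<close>

definition bump_arg :: "plane \<Rightarrow> plane \<Rightarrow> real" where
  "bump_arg a x = 1 + (\<Sum>j\<in>UNIV. (x $ j - a $ j)\<^sup>2)"

lemma bump_arg_ge: "bump_arg a x \<ge> 1"
  by (simp add: bump_arg_def sum_nonneg)

lemma smooth_nth: "smooth (\<lambda>x::plane. x $ j)"
  by (rule smoothI_psm[OF psm_coord])

lemma smooth_coord_diff: "smooth (\<lambda>x::plane. x $ j - a $ j)"
  using smooth_add[OF smooth_nth smooth_const[of "- (a $ j)"]] by simp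

lemma smooth_bump_arg: "smooth (bump_arg a)"
  unfolding bump_arg_def[abs_def] power2_eq_square
  by (intro smooth_add smooth_const smooth_sum smooth_mult smooth_coord_diff)

lemma partial_coord_diff: "partial k (\<lambda>x::plane. x $ j - a $ j) x = (if j = k then 1 else 0)"
  using partial_add[OF smooth_differentiable[OF smooth_nth[of j]] smooth_differentiable[OF smooth_const[of "- (a $ j)"]], where j=k and x=x]
  by (simp add: partial_coord)

lemma partial_sum:
  assumes "\<And>i. i \<in> I \<Longrightarrow> smooth (f i)"
  shows "partial j (\<lambda>x. \<Sum>i\<in>I. f i x) x = (\<Sum>i\<in>I. partial j (f i) x)"
  using partials_sum[OF assms, where js="[j]" and I=I] by (simp add: partials_Cons fun_eq_iff)

lemma partial_bump_arg: "partial k (bump_arg a) x = 2 * (x $ k - a $ k)"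
proof -
  have "partial k (\<lambda>x. (x $ j - a $ j) * (x $ j - a $ j)) x = (if j = k then 2 * (x $ k - a $ k) else 0)" for j
    using partial_mult[OF smooth_differentiable[OF smooth_coord_diff[of j a]] smooth_differentiable[OF smooth_coord_diff[of j a]], where j=k and x=x]
    by (simp add: partial_coord_diff)
  then have "partial k (\<lambda>x. \<Sum>j\<in>UNIV. (x $ j - a $ j) * (x $ j - a $ j)) x = 2 * (x $ k - a $ k)"
    by (subst partial_sum) (simp_all add: smooth_mult smooth_coord_diff)
  then show ?thesis
    unfolding bump_arg_def[abs_def] power2_eq_square
    by (subst partial_add) (simp_all add: smooth_differentiable smooth_const smooth_sum smooth_mult smooth_coord_diff)
qed

text \<open>The given Littlewood-Paley cutoff also supplies the one-variable profile of the
  truncation: its real part is restricted to the line through \<open>axis 1 1\<close>.\<close>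

lemma Re_smooth_ray_derivative:
  assumes "smooth \<psi>"
  shows "((\<lambda>t. Re (\<psi> (t *\<^sub>R axis 1 1))) has_real_derivative Re (partial 1 \<psi> (t *\<^sub>R axis 1 1))) (at t)"
proof -
  have "((\<lambda>t. \<psi> (t *\<^sub>R axis 1 1)) has_derivative (\<lambda>h. \<Sum>j\<in>UNIV. ((h *\<^sub>R axis 1 1 :: plane) $ j) *\<^sub>R partial j \<psi> (t *\<^sub>R axis 1 1))) (at t)"
    by (rule has_derivative_compose[OF _ has_derivative_partials[OF smooth_differentiable[OF assms]]])
      (auto intro!: derivative_eq_intros)
  also have "(\<lambda>h. \<Sum>j\<in>UNIV. ((h *\<^sub>R axis 1 1 :: plane) $ j) *\<^sub>R partial j \<psi> (t *\<^sub>R axis 1 1)) = (\<lambda>h. h *\<^sub>R partial 1 \<psi> (t *\<^sub>R axis 1 1))"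
    using sum_axis[of 1 "\<lambda>j. partial j \<psi> (t *\<^sub>R axis 1 1)"] by (simp add: scaleR_sum_right[symmetric] flip: scaleR_scaleR)
  finally show ?thesis
    unfolding has_field_derivative_def
    by (rule has_derivative_eq_rhs[OF bounded_linear.has_derivative[OF bounded_linear_Re]]) (auto simp: mult.commute)
qed

lemma bounded_supp_bounded:
  fixes f :: "plane \<Rightarrow> complex"
  assumes "smooth f" "\<And>x. f x \<noteq> 0 \<Longrightarrow> norm x \<le> R"
  shows "\<exists>B\<ge>0. \<forall>x. norm (f x) \<le> B"
proof -
  have "compact (f ` cball 0 R)"
    by (intro compact_continuous_image smooth_continuous assms compact_cball)
  from compact_imp_bounded[OF this] obtain B where "B > 0" "\<And>x. x \<in> cball 0 R \<Longrightarrow> norm (f x) \<le> B"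
    unfolding bounded_pos by auto
  then have "norm (f x) \<le> B" for x using assms(2)[of x] by (cases "f x = 0") auto
  then show ?thesis using \<open>B > 0\<close> by (intro exI[of _ B]) auto
qed

lemma lp_cutoffD:
  assumes "lp_cutoff \<psi>"
  shows "smooth \<psi>" "\<psi> \<in> Cc" "norm \<xi> \<le> 1/2 \<Longrightarrow> \<psi> \<xi> = 1" "\<psi> \<xi> \<noteq> 0 \<Longrightarrow> norm \<xi> \<le> 1"
proof -
  show s: "smooth \<psi>" and "norm \<xi> \<le> 1/2 \<Longrightarrow> \<psi> \<xi> = 1" using assms by (auto simp: lp_cutoff_def)
  have "norm \<xi> \<le> 1" if "\<psi> \<xi> \<noteq> 0" for \<xi>
    using supp_superset[of \<psi>, OF that] assms by (auto simp: lp_cutoff_def)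
  then show "\<psi> \<in> Cc" "\<psi> \<xi> \<noteq> 0 \<Longrightarrow> norm \<xi> \<le> 1" using s by (auto simp: Cc_def)
qed

text \<open>For \<open>p > 0\<close> a compactly supported truncation of \<open>1 + |x - a|\<^sup>2\<close>. The cutoff is logarithmic:
  this is what makes the trace-free Hessian of size \<open>O(p)\<close>.\<close>

definition log_bump :: "(plane \<Rightarrow> complex) \<Rightarrow> plane \<Rightarrow> real \<Rightarrow> plane \<Rightarrow> real" where
  "log_bump \<psi> a p x = bump_arg a x * Re (\<psi> ((p * ln (bump_arg a x)) *\<^sub>R axis 1 1))"

lemma smooth_log_bump:
  assumes "smooth \<psi>"
  shows "smooth (log_bump \<psi> a p)"
proof -
  have pos: "0 < bump_arg a x" for x using bump_arg_ge[of a x] by simp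
  have l: "psm {0::real} (\<lambda>_ x. ln (bump_arg a x))"
    by (rule psm_ln[OF smooth_imp_psm[OF smooth_bump_arg]]) (rule pos)
  have "psm {0::real} (\<lambda>_ x. (p * ln (bump_arg a x)) *\<^sub>R (axis 1 1 :: plane))"
    by (intro psm_scaleR psm_mult psm_const l)
  from psm_Re[OF psm_compose[OF this assms]]
  have "psm {0::real} (\<lambda>_. log_bump \<psi> a p)"
    unfolding log_bump_def[abs_def] by (intro psm_mult smooth_imp_psm[OF smooth_bump_arg])
  then show ?thesis by (rule smoothI_psm)
qed

lemma log_bump_support:
  assumes "lp_cutoff \<psi>" "p > 0" "log_bump \<psi> a p x \<noteq> 0"
  shows "norm (x - a) \<le> exp (1 / p)"
proof -
  have "\<psi> ((p * ln (bump_arg a x)) *\<^sub>R axis 1 1) \<noteq> 0" using assms(3) by (auto simp: log_bump_def)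
  from lp_cutoffD(4)[OF assms(1) this] have "p * ln (bump_arg a x) \<le> 1" by (simp add: norm_axis_1)
  then have "ln (bump_arg a x) \<le> 1 / p" using assms(2) by (simp add: field_simps)
  then have "bump_arg a x \<le> exp (1 / p)" using bump_arg_ge[of a x]
    by (metis exp_le_cancel_iff exp_ln less_le_trans zero_less_one)
  moreover have "(norm (x - a))\<^sup>2 = (\<Sum>j\<in>UNIV. (x $ j - a $ j)\<^sup>2)"
    by (simp add: norm_vec_def L2_set_def sum_nonneg)
  ultimately have "1 + (norm (x - a))\<^sup>2 \<le> exp (1 / p)" by (simp add: bump_arg_def)
  moreover have "norm (x - a) \<le> 1 + (norm (x - a))\<^sup>2"
    using zero_le_power2[of "norm (x - a) - 1"] by (simp add: power2_eq_square algebra_simps) (smt (verit) norm_ge_zero)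
  ultimately show ?thesis by simp
qed

lemma log_bump_test:
  assumes "lp_cutoff \<psi>" "p > 0"
  shows "log_bump \<psi> a p \<in> test_functions UNIV"
proof -
  have "supp (log_bump \<psi> a p) \<subseteq> cball a (exp (1 / p))"
  proof (rule supp_subset[OF closed_cball])
    fix x assume "log_bump \<psi> a p x \<noteq> 0"
    from log_bump_support[OF assms this] show "x \<in> cball a (exp (1 / p))"
      by (simp add: dist_norm norm_minus_commute)
  qed
  moreover have "closed (supp (log_bump \<psi> a p))" by (simp add: supp_def)
  ultimately have "compact (supp (log_bump \<psi> a p))"
    using compact_cball by (meson bounded_cball bounded_subset compact_eq_bounded_closed)
  then show ?thesis using smooth_log_bump[OF lp_cutoffD(1)[OF assms(1)]] by (simp add: test_functions_def)
qed

text \<open>For a function \<open>h(s)\<close> of \<open>s = 1 + |y|^2\<close> the Hessian has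
  entries \<open>4 h''(s) y_j y_l\<close>, plus \<open>2 h'(s)\<close> on the diagonal, so the
  trace-free part sees only \<open>h''\<close>. With \<open>h(s) = s g(p ln s)\<close> one has
  \<open>s h''(s) = p g' + p^2 g''\<close>, and the prefactor \<open>s\<close> absorbs the growth of
  \<open>y_j y_l\<close>.\<close>

lemma tf_hessian_log_bump:
  assumes "lp_cutoff \<psi>"
  shows "\<exists>K. \<forall>p\<in>{0<..1}. \<forall>x. norm (tf_hessian (log_bump \<psi> a p) x) \<le> K * p"
proof -
  note \<psi> = lp_cutoffD[OF assms]
  define g0 where "g0 t = Re (\<psi> (t *\<^sub>R axis 1 1))" for t
  define g1 where "g1 t = Re (partial 1 \<psi> (t *\<^sub>R axis 1 1))" for t
  define g2 where "g2 t = Re (partial 1 (partial 1 \<psi>) (t *\<^sub>R axis 1 1))" for t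
  have d0: "(g0 has_real_derivative g1 t) (at t)" for t
    unfolding g0_def g1_def by (rule Re_smooth_ray_derivative[OF \<psi>(1)])
  have d1: "(g1 has_real_derivative g2 t) (at t)" for t
    unfolding g1_def g2_def by (rule Re_smooth_ray_derivative[OF smooth_partial[OF \<psi>(1)]])
  have "\<exists>B\<ge>0. \<forall>x. norm (f x) \<le> B" if "f \<in> Cc" for f
    using that bounded_supp_bounded unfolding Cc_def by auto
  from this[OF Cc_partial[OF \<psi>(2)], of 1] this[OF Cc_partial[OF Cc_partial[OF \<psi>(2)]], of 1 1]
  obtain B1 B2 where B: "B1 \<ge> 0" "B2 \<ge> 0" "\<And>x. norm (partial 1 \<psi> x) \<le> B1" "\<And>x. norm (partial 1 (partial 1 \<psi>) x) \<le> B2"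
    by auto
  have b: "\<bar>g1 t\<bar> \<le> B1" "\<bar>g2 t\<bar> \<le> B2" for t
    unfolding g1_def g2_def using B(3,4) abs_Re_le_cmod order_trans by blast+
  \<comment> \<open>Four entries, each at most \<open>6 * (B1 + B2) * p\<close>; the 6 is the factor
    4 of the Hessian times the 3/2 from the matrix in \<open>y\<close>.\<close>
  have "norm (tf_hessian (log_bump \<psi> a p) x) \<le> 24 * (B1 + B2) * p" if p: "p \<in> {0<..1}" for p x
  proof -
    define h0 where "h0 s = s * g0 (p * ln s)" for s
    define h1 where "h1 s = g0 (p * ln s) + p * g1 (p * ln s)" for s
    define h2 where "h2 s = (p * g1 (p * ln s) + p\<^sup>2 * g2 (p * ln s)) / s" for s
    have h0': "(h0 has_vector_derivative h1 s) (at s)" if "s \<ge> 1" for s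
      unfolding has_real_derivative_iff_has_vector_derivative[symmetric] h0_def h1_def using that
      by (auto intro!: derivative_eq_intros DERIV_chain2[OF d0])
    have h1': "(h1 has_vector_derivative h2 s) (at s)" if "s \<ge> 1" for s
      unfolding has_real_derivative_iff_has_vector_derivative[symmetric] h1_def h2_def using that
      by (auto intro!: derivative_eq_intros DERIV_chain2[OF d0] DERIV_chain2[OF d1] simp: field_simps power2_eq_square)
    have e: "log_bump \<psi> a p = (\<lambda>x. h0 (bump_arg a x))" by (auto simp: log_bump_def h0_def g0_def)
    have sd: "bump_arg a differentiable (at x)" for x by (rule smooth_differentiable[OF smooth_bump_arg])
    have p1: "partial j (log_bump \<psi> a p) = (\<lambda>x. (2 * (x $ j - a $ j)) * h1 (bump_arg a x))" for j
      unfolding e by (rule ext, subst partial_real_compose[OF h0'[OF bump_arg_ge] sd]) (simp add: partial_bump_arg)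
    have p2: "partial k (partial j (log_bump \<psi> a p)) x
        = 4 * (x $ j - a $ j) * (x $ k - a $ k) * h2 (bump_arg a x) + 2 * (if j = k then 1 else 0) * h1 (bump_arg a x)" for k j x
    proof -
      have "(\<lambda>x. h1 (bump_arg a x)) differentiable (at x)"
        using has_derivative_real_compose[OF h1'[OF bump_arg_ge] sd] by (auto simp: differentiable_def)
      moreover have "(\<lambda>x::plane. 2 * (x $ j - a $ j)) differentiable (at x)"
        by (intro smooth_differentiable smooth_mult smooth_const smooth_coord_diff)
      moreover have "partial k (\<lambda>x::plane. 2 * (x $ j - a $ j)) x = 2 * (if j = k then 1 else 0)"
        by (subst partial_bounded_linear[OF bounded_linear_mult_right smooth_differentiable[OF smooth_coord_diff]])
          (simp add: partial_coord_diff)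
      ultimately show ?thesis
        unfolding p1 by (subst partial_mult)
          (auto simp: partial_real_compose[OF h1'[OF bump_arg_ge] sd] partial_bump_arg algebra_simps)
    qed
    define y where "y j = x $ j - a $ j" for j
    define H where "H = h2 (bump_arg a x)"
    have s: "bump_arg a x = 1 + (y 1)\<^sup>2 + (y 2)\<^sup>2" by (simp add: bump_arg_def y_def sum_2)
    have Hs: "\<bar>H\<bar> * bump_arg a x \<le> p * (B1 + B2)"
    proof -
      have "\<bar>H\<bar> * bump_arg a x = \<bar>p * g1 (p * ln (bump_arg a x)) + p\<^sup>2 * g2 (p * ln (bump_arg a x))\<bar>"
        using bump_arg_ge[of a x] by (simp add: H_def h2_def)
      also have "\<dots> \<le> p * B1 + p\<^sup>2 * B2"
        using p b by (intro order_trans[OF abs_triangle_ineq] add_mono) (auto simp: abs_mult intro!: mult_left_mono)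
      also have "p\<^sup>2 * B2 \<le> p * B2" using p B by (intro mult_right_mono) (auto simp: power2_eq_square mult_left_le)
      finally show ?thesis by (simp add: algebra_simps)
    qed
    have t: "tf_hessian (log_bump \<psi> a p) x $ j $ l = 4 * H * (y j * y l - (if j = l then ((y 1)\<^sup>2 + (y 2)\<^sup>2) / 2 else 0))" for j l
    proof -
      have p2': "partial k (partial j (log_bump \<psi> a p)) x = 4 * y j * y k * H + 2 * (if j = k then 1 else 0) * h1 (bump_arg a x)" for k j
        by (simp add: p2 y_def H_def)
      show ?thesis unfolding tf_hessian_def by (simp add: p2' sum_2 power2_eq_square field_simps)
    qed
    have ent: "\<bar>tf_hessian (log_bump \<psi> a p) x $ j $ l\<bar> \<le> 6 * (B1 + B2) * p" for j l
    proof -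
      have "\<bar>y j * y l - (if j = l then ((y 1)\<^sup>2 + (y 2)\<^sup>2) / 2 else 0)\<bar> \<le> 3 / 2 * bump_arg a x"
      proof -
        have "\<bar>y j * y l\<bar> \<le> (y 1)\<^sup>2 + (y 2)\<^sup>2"
        proof -
          have "2 * (\<bar>y j\<bar> * \<bar>y l\<bar>) \<le> (y j)\<^sup>2 + (y l)\<^sup>2"
            using sum_squares_bound[of "\<bar>y j\<bar>" "\<bar>y l\<bar>"] by (simp add: mult.assoc)
          moreover have "(y k)\<^sup>2 \<le> (y 1)\<^sup>2 + (y 2)\<^sup>2" for k using exhaust_2[of k] by auto
          from this[of j] this[of l] have "(y j)\<^sup>2 + (y l)\<^sup>2 \<le> 2 * ((y 1)\<^sup>2 + (y 2)\<^sup>2)" by simp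
          ultimately have "2 * \<bar>y j * y l\<bar> \<le> 2 * ((y 1)\<^sup>2 + (y 2)\<^sup>2)"
            unfolding abs_mult by (rule order_trans)
          then show ?thesis by simp
        qed
        moreover have "\<bar>if j = l then ((y 1)\<^sup>2 + (y 2)\<^sup>2) / 2 else 0\<bar> \<le> ((y 1)\<^sup>2 + (y 2)\<^sup>2) / 2" by simp
        ultimately have "\<bar>y j * y l - (if j = l then ((y 1)\<^sup>2 + (y 2)\<^sup>2) / 2 else 0)\<bar>
            \<le> ((y 1)\<^sup>2 + (y 2)\<^sup>2) + ((y 1)\<^sup>2 + (y 2)\<^sup>2) / 2"
          by (intro order_trans[OF abs_triangle_ineq4] add_mono)
        also have "\<dots> \<le> 3 / 2 * bump_arg a x" unfolding s by simp
        finally show ?thesis .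
      qed
      then have "4 * \<bar>H\<bar> * \<bar>y j * y l - (if j = l then ((y 1)\<^sup>2 + (y 2)\<^sup>2) / 2 else 0)\<bar> \<le> 4 * \<bar>H\<bar> * (3 / 2 * bump_arg a x)"
        by (intro mult_left_mono) auto
      then have "\<bar>tf_hessian (log_bump \<psi> a p) x $ j $ l\<bar> \<le> 4 * \<bar>H\<bar> * (3 / 2 * bump_arg a x)"
        unfolding t by (simp only: abs_mult abs_numeral)
      also have "\<dots> = 6 * (\<bar>H\<bar> * bump_arg a x)" by simp
      also have "\<dots> \<le> 6 * (p * (B1 + B2))" using Hs by simp
      finally show ?thesis by (simp add: mult_ac)
    qed
    have "norm (tf_hessian (log_bump \<psi> a p) x) \<le> (\<Sum>j\<in>UNIV. norm (tf_hessian (log_bump \<psi> a p) x $ j))"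
      unfolding norm_vec_def by (rule L2_set_le_sum) simp
    also have "\<dots> \<le> (\<Sum>j\<in>UNIV. \<Sum>l\<in>UNIV. \<bar>tf_hessian (log_bump \<psi> a p) x $ j $ l\<bar>)"
      by (intro sum_mono norm_le_l1_cart)
    also have "\<dots> \<le> (\<Sum>j\<in>(UNIV::2 set). \<Sum>l\<in>(UNIV::2 set). 6 * (B1 + B2) * p)"
      by (intro sum_mono ent)
    finally show ?thesis by (simp add: algebra_simps)
  qed
  then show ?thesis by blast
qed

lemma lebesgue_eq_box_integral:
  fixes F :: "'a::euclidean_space \<Rightarrow> complex"
  assumes "continuous_on (cbox a b) F" "\<And>x. x \<notin> cbox a b \<Longrightarrow> F x = 0"
  shows "integrable lborel F" "(LINT x|lborel. F x) = integral (cbox a b) F"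
proof -
  have e: "(\<lambda>x. indicator (cbox a b) x *\<^sub>R F x) = F" using assms(2) by (auto simp: indicator_def fun_eq_iff)
  have i: "set_integrable lborel (cbox a b) F"
    unfolding set_integrable_def using borel_integrable_compact[OF compact_cbox assms(1)] by simp
  then show "integrable lborel F" by (simp add: set_integrable_def e)
  show "(LINT x|lborel. F x) = integral (cbox a b) F"
    using set_borel_integral_eq_integral(2)[OF i] by (simp add: set_lebesgue_integral_def e)
qed

text \<open>The value \<open>p = 0\<close> is included: there a cutoff \<open>\<psi>\<close> takes
  the value \<open>\<psi> 0 = 1\<close>, so the untruncated polynomial is itself a member of the
  family.\<close>

lemma continuous_log_bump_param:
  assumes "smooth \<psi>"
  shows "continuous_on UNIV (\<lambda>p. log_bump \<psi> a p x)"
proof -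
  have "continuous_on UNIV (\<lambda>p. \<psi> ((p * ln (bump_arg a x)) *\<^sub>R axis 1 1))"
    by (rule continuous_on_compose2[OF smooth_continuous[OF assms, of UNIV]]) (auto intro!: continuous_intros)
  then show ?thesis unfolding log_bump_def by (intro continuous_intros)
qed


section \<open>The identities satisfied by the multiplier\<close>

text \<open>The norm \<open>N\<close> is arbitrary: it is only used that \<open>N \<theta>\<close> does not depend on \<open>\<phi>\<close>.\<close>

locale bounded_multiplier =
  fixes m :: "2 \<Rightarrow> (plane \<Rightarrow> complex) \<Rightarrow> complex" and \<psi> :: "plane \<Rightarrow> complex"
    and N :: "(plane \<Rightarrow> complex) \<Rightarrow> real" and C :: real
  assumes cutoff: "lp_cutoff \<psi>"
    and m_dist: "\<And>l. distribution_on (- {0}) (m l)"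
    and bound: "\<And>\<phi> \<theta>. \<phi> \<in> test_functions UNIV \<Longrightarrow> \<theta> \<in> schwartz0 \<Longrightarrow> range \<theta> \<subseteq> \<real> \<Longrightarrow>
      norm (LINT x|lborel. (\<Sum>l\<in>UNIV. of_real (\<phi> x) * multiplier_op (m l) \<theta> x * partial l \<theta> x))
        \<le> C * sup_norm (tf_hessian \<phi>) * (N \<theta>)\<^sup>2"
begin

sublocale m: punctured_distribution "m l" for l
  by unfold_locales (rule m_dist)

end

section \<open>The bilinear form on the Fourier side\<close>

lemma psm_cis_inner: "psm P (\<lambda>x \<xi>. cis (x \<bullet> \<xi>))"
  by (intro psm_cis psm_linear bounded_linear_inner_right continuous_intros)

lemma inv_fourier_real:
  assumes "f \<in> Cc" and sym: "\<And>\<xi>. f (- \<xi>) = cnj (f \<xi>)"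
  shows "inv_fourier f x \<in> \<real>"
proof -
  have m: "(\<lambda>\<xi>. cis (x \<bullet> \<xi>) * f \<xi>) \<in> borel_measurable borel"
    using borel_measurable_integrable[OF integrable_cis[OF assms(1), of x]] by simp
  have "cnj (LINT \<xi>|lborel. cis (x \<bullet> \<xi>) * f \<xi>) = (LINT \<xi>|lborel. cnj (cis (x \<bullet> \<xi>) * f \<xi>))"
    by (simp add: integral_cnj[symmetric] del: integral_cnj complex_cnj_mult)
  also have "\<dots> = (LINT \<xi>|lborel. cis (x \<bullet> - \<xi>) * f (- \<xi>))"
    by (simp add: sym cis_cnj)
  also have "\<dots> = (LINT \<xi>|lborel. cis (x \<bullet> \<xi>) * f \<xi>)" by (rule integral_reflect[OF m])
  finally have "(LINT \<xi>|lborel. cis (x \<bullet> \<xi>) * f \<xi>) \<in> \<real>" by (simp add: Reals_cnj_iff)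
  then show ?thesis unfolding inv_fourier_def by (intro Reals_mult) simp_all
qed

lemma inv_fourier_schwartz0:
  assumes f: "f \<in> T0"
  shows "inv_fourier f \<in> schwartz0" "fourier (inv_fourier f) = f"
proof -
  show e: "fourier (inv_fourier f) = f" using fourier_inv_fourier[OF T0_subset_Cc[OF f]] by auto
  show "inv_fourier f \<in> schwartz0"
    using inv_fourier_schwartz[OF T0_subset_Cc[OF f]] f e by (simp add: schwartz0_def test_functions_def)
qed

lemma bump_arg_le: "bump_arg a x \<le> 1 + 2 * (norm a)\<^sup>2 + 2 * (norm x)\<^sup>2"
proof -
  have "(norm (x - a))\<^sup>2 = (\<Sum>j\<in>UNIV. (x $ j - a $ j)\<^sup>2)"
    by (simp add: norm_vec_def L2_set_def sum_nonneg)
  moreover have "(norm (x - a))\<^sup>2 \<le> (norm x + norm a)\<^sup>2"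
    by (intro power_mono norm_triangle_ineq4) simp
  moreover have "(norm x + norm a)\<^sup>2 \<le> 2 * (norm x)\<^sup>2 + 2 * (norm a)\<^sup>2"
    using sum_squares_bound[of "norm x" "norm a"] by (simp add: power2_sum)
  ultimately show ?thesis by (simp add: bump_arg_def)
qed

text \<open>The Fourier transform of \<open>log_bump \<psi> a p * h\<close> at
  \<open>- \<xi>\<close>. The sign comes from the plane wave in \<open>multiplier_op\<close>,
  against which the remaining factors of the integrand are integrated.\<close>

definition bump_fourier :: "(plane \<Rightarrow> complex) \<Rightarrow> plane \<Rightarrow> (plane \<Rightarrow> complex) \<Rightarrow> real \<Rightarrow> plane \<Rightarrow> complex" where
  "bump_fourier \<psi> a h p \<xi> = (LINT x|lborel. of_real (log_bump \<psi> a p x) * h x * cis (\<xi> \<bullet> x))"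

text \<open>The supports of the truncations are not bounded as \<open>p\<close> tends to 0, but
  their values are at most a multiple of \<open>1 + |x|^2\<close> uniformly in \<open>p\<close>, and
  \<open>inv_fourier g\<close> decays faster than any power. Hence continuity reaches down to
  \<open>p = 0\<close>.\<close>

lemma psm_bump_fourier:
  assumes \<psi>: "lp_cutoff \<psi>" and g: "g \<in> Cc"
  shows "psm P (bump_fourier \<psi> a (inv_fourier g))"
proof -
  let ?h = "inv_fourier g"
  have ch: "continuous_on UNIV ?h" by (rule smooth_continuous[OF smooth_inv_fourier[OF g]])
  have cb: "continuous_on UNIV (log_bump \<psi> a p)" for p
    by (rule smooth_continuous[OF smooth_log_bump[OF lp_cutoffD(1)[OF \<psi>]]])
  obtain B where B: "B \<ge> 0" "\<And>x. norm (\<psi> x) \<le> B"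
    using bounded_supp_bounded[OF lp_cutoffD(1)[OF \<psi>] lp_cutoffD(4)[OF \<psi>]] by auto
  have p: "partials js (\<lambda>\<xi>. a' * cis (\<xi> \<bullet> x)) = (\<lambda>\<xi>. a' * imon js x * cis (\<xi> \<bullet> x))" for js a' x
    by (rule partials_cis)
  have "dominated_family P lborel (\<lambda>p x \<xi>. of_real (log_bump \<psi> a p x) * ?h x * cis (\<xi> \<bullet> x))"
    unfolding dominated_family_def
  proof (intro conjI ballI allI)
    fix x
    have "psm P (\<lambda>p \<xi>. (of_real (log_bump \<psi> a p x) * ?h x) * cis (\<xi> \<bullet> x))"
    proof (intro psm_mult)
      show "psm P (\<lambda>p \<xi>. of_real (log_bump \<psi> a p x) :: complex)"
        by (intro psm_param continuous_on_of_real continuous_on_subset[OF continuous_log_bump_param[OF lp_cutoffD(1)[OF \<psi>]]]) simp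
      show "psm P (\<lambda>p \<xi>. ?h x)" by (rule psm_const)
      show "psm P (\<lambda>p \<xi>. cis (\<xi> \<bullet> x))" by (rule smooth_imp_psm[OF smooth_cis_inner])
    qed
    then show "psm P (\<lambda>p \<xi>. of_real (log_bump \<psi> a p x) * ?h x * cis (\<xi> \<bullet> x))" .
  next
    fix js :: "2 list" and q \<xi>
    show "(\<lambda>x. partials js (\<lambda>\<xi>. of_real (log_bump \<psi> a q x) * ?h x * cis (\<xi> \<bullet> x)) \<xi>) \<in> borel_measurable lborel"
      unfolding p using smooth_continuous[OF smooth_imon[of js], of UNIV]
      by (auto intro!: borel_measurable_continuous_onI continuous_intros ch cb)
  next
    fix js :: "2 list"
    let ?k = "length js"
    \<comment> \<open>The power \<open>length js\<close> comes from differentiating in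
      \<open>\<xi>\<close>, the two extra powers from the quadratic growth of the bump.\<close>
    define G where "G x = B * ((1 + 2 * (norm a)\<^sup>2) * (norm x ^ ?k * norm (?h x)) + 2 * (norm x ^ (?k + 2) * norm (?h x)))" for x
    have "integrable lborel G"
      unfolding G_def by (intro integrable_mult_right Bochner_Integration.integrable_add inv_fourier_integrable_power g)
    moreover have "norm (partials js (\<lambda>\<xi>. of_real (log_bump \<psi> a q x) * ?h x * cis (\<xi> \<bullet> x)) \<xi>) \<le> G x" for q x \<xi>
    proof -
      have "\<bar>log_bump \<psi> a q x\<bar> \<le> (1 + 2 * (norm a)\<^sup>2 + 2 * (norm x)\<^sup>2) * B"
        unfolding log_bump_def abs_mult using bump_arg_ge[of a x] bump_arg_le[of a x]
        by (intro mult_mono order_trans[OF abs_Re_le_cmod B(2)]) auto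
      then have "\<bar>log_bump \<psi> a q x\<bar> * (norm (?h x) * norm (imon js x))
          \<le> (1 + 2 * (norm a)\<^sup>2 + 2 * (norm x)\<^sup>2) * B * (norm (?h x) * norm x ^ ?k)"
        using B(1) by (intro mult_mono norm_imon) auto
      also have "\<dots> = G x" by (simp add: G_def algebra_simps power_add power2_eq_square)
      finally show ?thesis unfolding p by (simp add: norm_mult mult.assoc)
    qed
    ultimately show "\<exists>G. integrable lborel G \<and> (\<forall>q\<in>P. \<forall>x\<in>space lborel. \<forall>\<xi>.
      norm (partials js (\<lambda>\<xi>. of_real (log_bump \<psi> a q x) * ?h x * cis (\<xi> \<bullet> x)) \<xi>) \<le> G x)"
      by blast
  qed
  from psm_integral[OF this] show ?thesis unfolding bump_fourier_def[abs_def] .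
qed

text \<open>Multiplication by \<open>1 + |x - a|^2\<close> seen in frequency: \<open>x $ j\<close>
  becomes \<open>\<i> * partial j\<close>, whence
  \<open>1 + |a|^2 - 2 \<i> a \<cdot> \<nabla> - \<Delta>\<close>.\<close>

definition quad_op :: "plane \<Rightarrow> (plane \<Rightarrow> complex) \<Rightarrow> plane \<Rightarrow> complex" where
  "quad_op a g \<xi> = of_real (1 + (norm a)\<^sup>2) * g \<xi> + (\<Sum>j\<in>UNIV. (- 2 * \<i> * of_real (a $ j)) * partial j g \<xi> + (- 1) * partial j (partial j g) \<xi>)"

lemma Cc_zero: "(\<lambda>x. 0) \<in> Cc"
  by (rule T0_subset_Cc[OF T0_zero])

lemma Cc_sum: "(\<And>i. i \<in> I \<Longrightarrow> f i \<in> Cc) \<Longrightarrow> (\<lambda>x. \<Sum>i\<in>I. f i x) \<in> Cc"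
  by (induction I rule: infinite_finite_induct) (simp_all add: Cc_zero Cc_add)

lemma Cc_quad_op: "g \<in> Cc \<Longrightarrow> quad_op a g \<in> Cc"
  unfolding quad_op_def[abs_def] by (intro Cc_add Cc_sum Cc_cmult Cc_partial)

lemma inv_fourier_quad_op:
  assumes g: "g \<in> Cc"
  shows "of_real (bump_arg a x) * inv_fourier g x = inv_fourier (quad_op a g) x"
proof -
  have c1: "inv_fourier (partial j g) x = - \<i> * of_real (x $ j) * inv_fourier g x" if "g \<in> Cc" for j g
    using arg_cong[OF inv_fourier_coord[OF that, of x j], of "\<lambda>z. - \<i> * z"]
    by (simp add: inv_fourier_cmult mult.assoc)
  have c2: "inv_fourier (partial j (partial j g)) x = - (of_real (x $ j) ^ 2 * inv_fourier g x)" for j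
  proof -
    have i: "\<i> * c * (\<i> * c * z) = (\<i> * \<i>) * (c\<^sup>2 * z)" for c z by (simp only: power2_eq_square mult_ac)
    show ?thesis using c1[OF Cc_partial[OF g], of j j] c1[OF g, of j] i by simp
  qed
  have s: "inv_fourier (\<lambda>\<xi>. \<Sum>j\<in>(UNIV :: 2 set). h j \<xi>) x = (\<Sum>j\<in>UNIV. inv_fourier (h j) x)" if "\<And>j. h j \<in> Cc" for h
    using that by (simp add: sum_2 inv_fourier_add)
  have "inv_fourier (quad_op a g) x = of_real (1 + (norm a)\<^sup>2) * inv_fourier g x
      + (\<Sum>j\<in>UNIV. (- 2 * \<i> * of_real (a $ j)) * inv_fourier (partial j g) x + (- 1) * inv_fourier (partial j (partial j g)) x)"
    unfolding quad_op_def[abs_def] using g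
    by (subst inv_fourier_add, (intro Cc_add Cc_sum Cc_cmult Cc_partial; assumption)+, subst s,
        (intro Cc_add Cc_sum Cc_cmult Cc_partial; assumption)+, subst inv_fourier_add)
      (intro Cc_add Cc_sum Cc_cmult Cc_partial; assumption | simp only: inv_fourier_cmult)+
  also have "(norm a)\<^sup>2 = (a $ 1)\<^sup>2 + (a $ 2)\<^sup>2"
    by (simp add: norm_vec_def L2_set_def sum_2)
  finally show ?thesis
    by (simp add: c1[OF g] c2 sum_2 bump_arg_def algebra_simps power2_eq_square)
qed

text \<open>\<open>\<psi> 0 = 1\<close> removes the truncation, and Fourier inversion evaluates the
  integral that is left.\<close>

lemma bump_fourier_0:
  assumes \<psi>: "lp_cutoff \<psi>" and g: "g \<in> Cc"
  shows "bump_fourier \<psi> a (inv_fourier g) 0 \<xi> = quad_op a g (- \<xi>)"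
proof -
  have "\<psi> 0 = 1" using lp_cutoffD(3)[OF \<psi>, of 0] by simp
  then have "bump_fourier \<psi> a (inv_fourier g) 0 \<xi> = (LINT x|lborel. cis (- (x \<bullet> - \<xi>)) * inv_fourier (quad_op a g) x)"
    unfolding bump_fourier_def by (simp add: log_bump_def inv_fourier_quad_op[OF g, symmetric] inner_commute mult_ac)
  also have "\<dots> = quad_op a g (- \<xi>)"
    using fourier_inv_fourier[OF Cc_quad_op[OF g], of a "- \<xi>"] by (simp add: fourier_def)
  finally show ?thesis .
qed

context bounded_multiplier
begin

text \<open>For \<open>p > 0\<close> the bump confines \<open>x\<close> to a box, so
  \<open>box_integral\<close> exchanges the distribution, acting in \<open>\<xi>\<close>, with the
  integral in \<open>x\<close>. The test function on the right, for \<open>h\<close> an inverse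
  Fourier transform from \<open>Cc\<close>, still makes sense at \<open>p = 0\<close>, where the box
  is lost.\<close>

lemma pairing_eq:
  assumes f: "f \<in> T0" and h: "continuous_on UNIV h" and p: "p > 0"
  shows "integrable lborel (\<lambda>x. of_real (log_bump \<psi> a p x) * multiplier_op (m l) (inv_fourier f) x * h x)"
    and "(LINT x|lborel. of_real (log_bump \<psi> a p x) * multiplier_op (m l) (inv_fourier f) x * h x)
      = of_real (1 / (2 * pi)\<^sup>2) * m l (\<lambda>\<xi>. bump_fourier \<psi> a h p \<xi> * f \<xi>)"
proof -
  let ?c = "complex_of_real (1 / (2 * pi)\<^sup>2)" and ?\<phi> = "log_bump \<psi> a p"
  obtain r R where f': "0 < r" "\<And>\<xi>. f \<xi> \<noteq> 0 \<Longrightarrow> \<xi> \<in> annulus r R" using T0E[OF f] by blast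
  have "bounded (cball a (exp (1 / p)))" by simp
  then obtain c d where box: "cball a (exp (1 / p)) \<subseteq> cbox c d" using bounded_subset_cbox_symmetric by metis
  have out: "?\<phi> x = 0" if "x \<notin> cbox c d" for x
    using log_bump_support[OF cutoff p, of a x] box that by (force simp: dist_norm norm_minus_commute)
  have cb: "continuous_on UNIV ?\<phi>"
    by (rule smooth_continuous[OF smooth_log_bump[OF lp_cutoffD(1)[OF cutoff]]])
  define E where "E x \<xi> = cis (x \<bullet> \<xi>) * f \<xi>" for x \<xi>
  define H where "H x \<xi> = (of_real (?\<phi> x) * h x) * E x \<xi>" for x \<xi>
  have psE: "psm P E" for P unfolding E_def[abs_def]
    by (intro psm_mult psm_cis_inner smooth_imp_psm T0_smooth f)
  have psH: "psm P H" for P unfolding H_def[abs_def]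
    by (intro psm_mult psE psm_param continuous_on_of_real continuous_on_mult continuous_on_subset[OF cb] continuous_on_subset[OF h]) auto
  have aE: "annular P E r R" and aH: "annular P H r R" for P
    using f'(2) by (auto simp: annular_def E_def H_def)
  have T: "E x \<in> T0" for x unfolding E_def by (rule T0_mult[OF f smooth_cis_inner_right])
  have cE: "continuous_on (cbox c d) (\<lambda>x. m l (E x))"
    by (rule m.continuous_param[OF psE compact_cbox f'(1) aE])
  have mH: "m l (H x) = of_real (?\<phi> x) * h x * m l (E x)" for x
    unfolding H_def[abs_def] by (rule m.cmult[OF T])
  have op: "multiplier_op (m l) (inv_fourier f) x = ?c * m l (E x)" for x
    unfolding multiplier_op_def inv_fourier_schwartz0(2)[OF f] E_def ..
  have eq: "(\<lambda>x. of_real (?\<phi> x) * multiplier_op (m l) (inv_fourier f) x * h x) = (\<lambda>x. ?c * m l (H x))"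
    unfolding op mH by (simp only: mult_ac)
  have cH: "continuous_on (cbox c d) (\<lambda>x. m l (H x))"
    by (rule m.continuous_param[OF psH compact_cbox f'(1) aH])
  have zH: "m l (H x) = 0" if "x \<notin> cbox c d" for x using out[OF that] by (simp add: mH)
  note L = lebesgue_eq_box_integral[OF cH zH]
  show "integrable lborel (\<lambda>x. of_real (?\<phi> x) * multiplier_op (m l) (inv_fourier f) x * h x)"
    unfolding eq using L(1) by (rule integrable_mult_right)
  have "(\<lambda>\<xi>. integral (cbox c d) (\<lambda>x. H x \<xi>)) = (\<lambda>\<xi>. bump_fourier \<psi> a h p \<xi> * f \<xi>)"
  proof
    fix \<xi>
    have "continuous_on (cbox c d) (\<lambda>x. H x \<xi>)" unfolding H_def E_def
      by (intro continuous_intros continuous_on_subset[OF cb] continuous_on_subset[OF h]) auto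
    from lebesgue_eq_box_integral(2)[OF this]
    have "integral (cbox c d) (\<lambda>x. H x \<xi>) = (LINT x|lborel. H x \<xi>)" using out by (simp add: H_def)
    also have "\<dots> = (LINT x|lborel. (of_real (?\<phi> x) * h x * cis (\<xi> \<bullet> x)) * f \<xi>)"
      by (simp add: H_def E_def inner_commute mult.assoc)
    also have "\<dots> = bump_fourier \<psi> a h p \<xi> * f \<xi>"
      unfolding bump_fourier_def by (rule integral_mult_left_zero)
    finally show "integral (cbox c d) (\<lambda>x. H x \<xi>) = bump_fourier \<psi> a h p \<xi> * f \<xi>" .
  qed
  with m.box_integral(2)[OF psH f'(1) aH, of l c d]
  have "m l (\<lambda>\<xi>. bump_fourier \<psi> a h p \<xi> * f \<xi>) = (LINT x|lborel. m l (H x))"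
    by (simp add: L(2))
  then show "(LINT x|lborel. of_real (?\<phi> x) * multiplier_op (m l) (inv_fourier f) x * h x)
      = ?c * m l (\<lambda>\<xi>. bump_fourier \<psi> a h p \<xi> * f \<xi>)"
    unfolding eq by (simp only: integral_mult_right_zero)
qed

text \<open>The hypothesis bounds the form by a multiple of \<open>p\<close>, and its Fourier side
  is continuous on the closed interval \<open>{0..1}\<close>; so the value at \<open>p = 0\<close>,
  where the polynomial is left, is zero. The conjugate symmetry of \<open>f\<close> makes
  \<open>inv_fourier f\<close> real, as the hypothesis requires.\<close>

lemma quad_identity:
  assumes f: "f \<in> T0" and sym: "\<And>\<xi>. f (- \<xi>) = cnj (f \<xi>)"
  shows "(\<Sum>l\<in>UNIV. m l (\<lambda>\<xi>. quad_op a (\<lambda>\<eta>. \<i> * of_real (\<eta> $ l) * f \<eta>) (- \<xi>) * f \<xi>)) = 0"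
proof -
  let ?c = "complex_of_real (1 / (2 * pi)\<^sup>2)" and ?\<theta> = "inv_fourier f"
  define g where "g l \<eta> = \<i> * of_real (\<eta> $ l) * f \<eta>" for l \<eta>
  define F where "F p = (\<Sum>l\<in>UNIV. m l (\<lambda>\<xi>. bump_fourier \<psi> a (inv_fourier (g l)) p \<xi> * f \<xi>))" for p
  have fC: "f \<in> Cc" by (rule T0_subset_Cc[OF f])
  have g: "g l \<in> Cc" for l
    unfolding g_def[abs_def] by (intro Cc_mult[OF fC] smooth_mult smooth_const smooth_coord)
  obtain r R where f': "0 < r" "\<And>\<xi>. f \<xi> \<noteq> 0 \<Longrightarrow> \<xi> \<in> annulus r R" using T0E[OF f] by blast
  have d: "partial l ?\<theta> = inv_fourier (g l)" for l
    unfolding g_def[abs_def] by (rule partial_inv_fourier[OF fC])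
  obtain K where K: "\<And>p x. p \<in> {0<..1} \<Longrightarrow> norm (tf_hessian (log_bump \<psi> a p) x) \<le> K * p"
    using tf_hessian_log_bump[OF cutoff, of a] by blast
  have F: "norm (?c * F p) \<le> \<bar>C\<bar> * K * (N ?\<theta>)\<^sup>2 * p" if p: "p \<in> {0<..1}" for p
  proof -
    have ch: "continuous_on UNIV (inv_fourier (g l))" for l by (rule smooth_continuous[OF smooth_inv_fourier[OF g]])
    have p0: "p > 0" using p by simp
    have "(LINT x|lborel. (\<Sum>l\<in>UNIV. of_real (log_bump \<psi> a p x) * multiplier_op (m l) ?\<theta> x * partial l ?\<theta> x))
      = (\<Sum>l\<in>UNIV. (LINT x|lborel. of_real (log_bump \<psi> a p x) * multiplier_op (m l) ?\<theta> x * partial l ?\<theta> x))"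
      unfolding d by (rule Bochner_Integration.integral_sum) (rule pairing_eq(1)[OF f ch p0])
    also have "\<dots> = ?c * F p"
      unfolding d F_def sum_distrib_left by (intro sum.cong refl pairing_eq(2)[OF f ch p0])
    finally have "norm (?c * F p) \<le> C * sup_norm (tf_hessian (log_bump \<psi> a p)) * (N ?\<theta>)\<^sup>2"
      using bound[OF log_bump_test[OF cutoff p0, of a] inv_fourier_schwartz0(1)[OF f]] inv_fourier_real[OF fC sym]
      by (metis image_subsetI)
    \<comment> \<open>The sign of \<open>C\<close> is unknown; the Hessian bound makes the supremum
      a genuine one and hence nonnegative.\<close>
    also have "\<dots> \<le> \<bar>C\<bar> * sup_norm (tf_hessian (log_bump \<psi> a p)) * (N ?\<theta>)\<^sup>2"
    proof (intro mult_right_mono)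
      show "0 \<le> sup_norm (tf_hessian (log_bump \<psi> a p))"
        unfolding sup_norm_def by (rule cSUP_upper2[of _ _ 0]) (auto intro!: bdd_aboveI2[where M="K * p"] K[OF p])
    qed auto
    also have "\<dots> \<le> \<bar>C\<bar> * (K * p) * (N ?\<theta>)\<^sup>2"
      unfolding sup_norm_def by (intro mult_right_mono mult_left_mono cSUP_least K[OF p]) auto
    finally show ?thesis by (simp add: mult_ac)
  qed
  have cF: "continuous_on {0..1} F"
    unfolding F_def
  proof (intro continuous_on_sum)
    fix l
    show "continuous_on {0..1} (\<lambda>p. m l (\<lambda>\<xi>. bump_fourier \<psi> a (inv_fourier (g l)) p \<xi> * f \<xi>))"
    proof (rule m.continuous_param[OF _ compact_Icc f'(1), where R=R])
      show "psm {0..1} (\<lambda>p \<xi>. bump_fourier \<psi> a (inv_fourier (g l)) p \<xi> * f \<xi>)"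
        by (intro psm_mult psm_bump_fourier cutoff g smooth_imp_psm T0_smooth f)
      show "annular {0..1} (\<lambda>p \<xi>. bump_fourier \<psi> a (inv_fourier (g l)) p \<xi> * f \<xi>) r R"
        using f'(2) by (auto simp: annular_def)
    qed
  qed
  define q where "q n = 1 / real (Suc n)" for n
  have q: "q n \<in> {0<..1}" for n by (auto simp: q_def)
  have q0: "q \<longlonglongrightarrow> 0" unfolding q_def using LIMSEQ_inverse_real_of_nat by (simp add: inverse_eq_divide)
  have "(\<lambda>n. F (q n)) \<longlonglongrightarrow> F 0"
    using cF[unfolded continuous_on_sequentially, rule_format, of 0 q] q0 q
    by (auto simp: comp_def less_imp_le)
  then have "(\<lambda>n. norm (?c * F (q n))) \<longlonglongrightarrow> norm (?c * F 0)" by (intro tendsto_intros)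
  moreover have "(\<lambda>n. \<bar>C\<bar> * K * (N ?\<theta>)\<^sup>2 * q n) \<longlonglongrightarrow> \<bar>C\<bar> * K * (N ?\<theta>)\<^sup>2 * 0"
    by (intro tendsto_intros q0)
  ultimately have "norm (?c * F 0) \<le> \<bar>C\<bar> * K * (N ?\<theta>)\<^sup>2 * 0"
    by (rule LIMSEQ_le) (use F[OF q] in auto)
  then have "F 0 = 0" by simp
  then show ?thesis unfolding F_def bump_fourier_0[OF cutoff g] unfolding g_def[abs_def] .
qed

end

section \<open>Polarization to identities linear in the test function\<close>

lemma bounded_linear_neg: "bounded_linear (\<lambda>x::plane. - x)"
  by (rule bounded_linear_minus[OF bounded_linear_ident])

lemma smooth_reflect: "smooth f \<Longrightarrow> smooth (\<lambda>x. f (- x))"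
  by (rule smoothI_psm[OF psm_compose[OF psm_fixed_linear[OF bounded_linear_neg]]])

lemma T0_reflect: assumes "f \<in> T0" shows "(\<lambda>x. f (- x)) \<in> T0"
proof -
  obtain r R where f: "0 < r" "\<And>\<xi>. f \<xi> \<noteq> 0 \<Longrightarrow> \<xi> \<in> annulus r R" using T0E[OF assms] by blast
  show ?thesis
  proof (rule T0I[OF smooth_reflect[OF T0_smooth[OF assms]] f(1)])
    show "\<xi> \<in> annulus r R" if "f (- \<xi>) \<noteq> 0" for \<xi> using f(2)[OF that] by (simp add: annulus_def)
  qed
qed

lemma T0_cnj: assumes "f \<in> T0" shows "(\<lambda>x. cnj (f x)) \<in> T0"
proof -
  obtain r R where f: "0 < r" "\<And>\<xi>. f \<xi> \<noteq> 0 \<Longrightarrow> \<xi> \<in> annulus r R" using T0E[OF assms] by blast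
  show ?thesis
    by (rule T0I[OF smooth_bounded_linear[OF bounded_linear_cnj T0_smooth[OF assms]] f(1), where R=R]) (simp add: f(2))
qed

lemma T0_partial: assumes "f \<in> T0" shows "partial j f \<in> T0"
proof -
  obtain r R where f: "0 < r" "\<And>\<xi>. f \<xi> \<noteq> 0 \<Longrightarrow> \<xi> \<in> annulus r R" using T0E[OF assms] by blast
  show ?thesis
  proof (rule T0I[OF smooth_partial[OF T0_smooth[OF assms]] f(1)])
    show "\<xi> \<in> annulus r R" if "partial j f \<xi> \<noteq> 0" for \<xi>
      using partials_support[OF closed_annulus f(2), where x=\<xi> and js="[j]"] that by (auto simp: partials_Cons)
  qed
qed

definition coord_mult :: "2 \<Rightarrow> (plane \<Rightarrow> complex) \<Rightarrow> plane \<Rightarrow> complex" where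
  "coord_mult l f \<xi> = of_real (\<xi> $ l) * f \<xi>"

lemma smooth_coord_mult: "smooth f \<Longrightarrow> smooth (coord_mult l f)"
  unfolding coord_mult_def[abs_def] by (intro smooth_mult smooth_coord)

lemma T0_coord_mult: "f \<in> T0 \<Longrightarrow> coord_mult l f \<in> T0"
  unfolding coord_mult_def[abs_def] by (intro T0_mult smooth_coord)

lemma partial_coord_mult:
  assumes "smooth f"
  shows "partial j (coord_mult l f) \<xi> = (if l = j then f \<xi> else 0) + of_real (\<xi> $ l) * partial j f \<xi>"
proof -
  have "partial j (\<lambda>\<xi>::plane. complex_of_real (\<xi> $ l)) \<xi> = (if l = j then 1 else 0)"
    by (subst partial_of_real[OF smooth_differentiable[OF smooth_nth]]) (simp add: partial_coord)
  then show ?thesis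
    unfolding coord_mult_def[abs_def]
    by (subst partial_mult) (auto simp: smooth_differentiable smooth_coord assms)
qed

text \<open>Symmetrizing \<open>\<psi>\<close> gives a real even cutoff \<open>\<Psi>\<close>, and a
  difference of two dilates is one on an annulus. Being real and even, \<open>w\<close> has the
  conjugate symmetry demanded on the diagonal.\<close>

lemma even_real_cutoff:
  assumes \<psi>: "lp_cutoff \<psi>" and r: "0 < r" "r \<le> R"
  obtains w where "w \<in> T0" "\<And>\<xi>. w (- \<xi>) = w \<xi>" "\<And>\<xi>. cnj (w \<xi>) = w \<xi>"
    "\<And>\<xi>. r / 2 < norm \<xi> \<Longrightarrow> norm \<xi> < 2 * R \<Longrightarrow> w \<xi> = 1"
proof -
  define \<Psi> where "\<Psi> \<xi> = complex_of_real (Re (\<psi> \<xi>) * Re (\<psi> (- \<xi>)))" for \<xi>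
  \<comment> \<open>Division by \<open>4 * R\<close> sends \<open>|\<xi>| < 2 * R\<close> into the
    ball where \<open>\<Psi>\<close> is 1; division by \<open>r / 2\<close> sends
    \<open>|\<xi>| > r / 2\<close> to where it vanishes.\<close>
  define w where "w \<xi> = \<Psi> ((1 / (4 * R)) *\<^sub>R \<xi>) - \<Psi> ((2 / r) *\<^sub>R \<xi>)" for \<xi>
  have s: "smooth \<Psi>"
    unfolding \<Psi>_def[abs_def]
    by (intro smooth_bounded_linear[OF bounded_linear_of_real] smooth_mult
        smooth_bounded_linear[OF bounded_linear_Re] smooth_reflect lp_cutoffD(1)[OF \<psi>])
  have sc: "smooth (\<lambda>\<xi>. \<Psi> (c *\<^sub>R \<xi>))" for c
    by (rule smoothI_psm[OF psm_compose[OF psm_fixed_linear[OF bounded_linear_scaleR_right] s]])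
  have "smooth (\<lambda>\<xi>. \<Psi> ((1 / (4 * R)) *\<^sub>R \<xi>) + (-1) * \<Psi> ((2 / r) *\<^sub>R \<xi>))"
    by (intro smooth_add sc smooth_mult smooth_const)
  then have sm: "smooth w" by (simp add: w_def[abs_def])
  have one: "\<Psi> \<xi> = 1" if "norm \<xi> \<le> 1/2" for \<xi> using that lp_cutoffD(3)[OF \<psi>] by (simp add: \<Psi>_def)
  have zero: "\<Psi> \<xi> = 0" if "norm \<xi> > 1" for \<xi> using that lp_cutoffD(4)[OF \<psi>, of \<xi>] by (force simp: \<Psi>_def)
  have R: "R > 0" using r by simp
  have n1: "norm ((1 / (4 * R)) *\<^sub>R \<xi>) = norm \<xi> / (4 * R)" and n2: "norm ((2 / r) *\<^sub>R \<xi>) = 2 * norm \<xi> / r" for \<xi> :: plane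
    using r R by auto
  show thesis
  proof (rule that[of w])
    show "w \<in> T0"
    proof (rule T0I[OF sm])
      show "0 < r / 4" using r by simp
      show "\<xi> \<in> annulus (r / 4) (4 * R)" if "w \<xi> \<noteq> 0" for \<xi>
      proof (rule ccontr)
        assume "\<xi> \<notin> annulus (r / 4) (4 * R)"
        then consider "norm \<xi> < r / 4" | "norm \<xi> > 4 * R" by (force simp: annulus_def)
        then have "w \<xi> = 0"
        proof cases
          case 1
          then have "\<Psi> ((1 / (4 * R)) *\<^sub>R \<xi>) = 1" using r R by (intro one) (simp add: n1 field_simps)
          moreover have "\<Psi> ((2 / r) *\<^sub>R \<xi>) = 1" using 1 r by (intro one) (simp add: n2 field_simps)
          ultimately show ?thesis by (simp add: w_def)
        next
          case 2
          then have "\<Psi> ((1 / (4 * R)) *\<^sub>R \<xi>) = 0" using R by (intro zero) (simp add: n1 field_simps)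
          moreover have "\<Psi> ((2 / r) *\<^sub>R \<xi>) = 0" using 2 r by (intro zero) (simp add: n2 field_simps)
          ultimately show ?thesis by (simp add: w_def)
        qed
        with that show False by simp
      qed
    qed
    show "w (- \<xi>) = w \<xi>" "cnj (w \<xi>) = w \<xi>" for \<xi> by (simp_all add: w_def \<Psi>_def mult.commute)
    show "w \<xi> = 1" if "r / 2 < norm \<xi>" "norm \<xi> < 2 * R" for \<xi>
    proof -
      have "\<Psi> ((1 / (4 * R)) *\<^sub>R \<xi>) = 1" using that R by (intro one) (simp add: n1 field_simps)
      moreover have "\<Psi> ((2 / r) *\<^sub>R \<xi>) = 0" using that r by (intro zero) (simp add: n2 field_simps)
      ultimately show ?thesis by (simp add: w_def)
    qed
  qed
qed

text \<open>Common ground of the identity, the first derivatives and the Laplacian, the three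
  ingredients of \<open>quad_op\<close>. Linearity is asked on smooth functions, because
  \<open>partial\<close> is unspecified where the derivative does not exist.\<close>

definition lin_op :: "((plane \<Rightarrow> complex) \<Rightarrow> plane \<Rightarrow> complex) \<Rightarrow> bool" where
  "lin_op P \<longleftrightarrow> (\<forall>f. smooth f \<longrightarrow> smooth (P f)) \<and>
     (\<forall>f g. smooth f \<longrightarrow> smooth g \<longrightarrow> P (\<lambda>x. f x + g x) = (\<lambda>x. P f x + P g x)) \<and>
     (\<forall>c f. smooth f \<longrightarrow> P (\<lambda>x. c * f x) = (\<lambda>x. c * P f x))"

definition laplacian :: "(plane \<Rightarrow> complex) \<Rightarrow> plane \<Rightarrow> complex" where
  "laplacian f x = (\<Sum>j\<in>UNIV. partial j (partial j f) x)"

lemma partial_add_smooth: "smooth f \<Longrightarrow> smooth g \<Longrightarrow> partial j (\<lambda>x. f x + g x) = (\<lambda>x. partial j f x + partial j g x)"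
  using partials_add[of f g "[j]"] by (simp add: partials_Cons)

lemma partial_cmult_smooth: "smooth f \<Longrightarrow> partial j (\<lambda>x. c * f x) = (\<lambda>x. c * partial j f x :: complex)"
  using partials_bounded_linear[OF bounded_linear_mult_right, of f "[j]" c] by (simp add: partials_Cons)

lemma lin_op_id: "lin_op (\<lambda>f. f)" by (simp add: lin_op_def)

lemma lin_op_partial: "lin_op (partial j)"
  by (simp add: lin_op_def smooth_partial partial_add_smooth partial_cmult_smooth)

lemma lin_op_laplacian: "lin_op laplacian"
  unfolding lin_op_def laplacian_def[abs_def]
  by (simp add: smooth_sum smooth_partial partial_add_smooth partial_cmult_smooth sum.distrib sum_distrib_left)

context bounded_multiplier
begin

text \<open>The two occurrences of \<open>\<theta>\<close> are separated: the first slot is the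
  transform of the differentiated factor, the second the transform inside the operator. No
  conjugation occurs, so the form is complex bilinear.\<close>

definition pair_form :: "((plane \<Rightarrow> complex) \<Rightarrow> plane \<Rightarrow> complex) \<Rightarrow> (plane \<Rightarrow> complex) \<Rightarrow> (plane \<Rightarrow> complex) \<Rightarrow> complex" where
  "pair_form P f g = (\<Sum>l\<in>UNIV. m l (\<lambda>\<xi>. P (coord_mult l f) (- \<xi>) * g \<xi>))"

lemma pair_form_T0:
  "lin_op P \<Longrightarrow> f \<in> T0 \<Longrightarrow> g \<in> T0 \<Longrightarrow> (\<lambda>\<xi>. P (coord_mult l f) (- \<xi>) * g \<xi>) \<in> T0"
  by (intro T0_mult smooth_reflect) (auto simp: lin_op_def intro: smooth_coord_mult T0_smooth)

lemma pair_form_add_right: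
  assumes "lin_op P" "f \<in> T0" "g \<in> T0" "h \<in> T0"
  shows "pair_form P f (\<lambda>\<xi>. g \<xi> + h \<xi>) = pair_form P f g + pair_form P f h"
  unfolding pair_form_def sum.distrib[symmetric]
  by (intro sum.cong refl) (simp only: distrib_left m.add pair_form_T0 assms)

lemma pair_form_cmult_right:
  assumes "lin_op P" "f \<in> T0" "g \<in> T0"
  shows "pair_form P f (\<lambda>\<xi>. c * g \<xi>) = c * pair_form P f g"
  unfolding pair_form_def sum_distrib_left
  by (intro sum.cong refl) (simp only: mult.left_commute[of _ c] m.cmult pair_form_T0 assms)

lemma pair_form_add_left:
  assumes P: "lin_op P" and "f \<in> T0" "g \<in> T0" "h \<in> T0"
  shows "pair_form P (\<lambda>\<xi>. f \<xi> + g \<xi>) h = pair_form P f h + pair_form P g h"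
proof -
  have "P (coord_mult l (\<lambda>\<xi>. f \<xi> + g \<xi>)) = (\<lambda>\<xi>. P (coord_mult l f) \<xi> + P (coord_mult l g) \<xi>)" for l
    using P smooth_coord_mult[OF T0_smooth] assms(2,3)
    by (simp add: lin_op_def coord_mult_def[abs_def] distrib_left)
  then show ?thesis
    unfolding pair_form_def sum.distrib[symmetric]
    by (intro sum.cong refl) (simp only: distrib_right m.add pair_form_T0 assms)
qed

lemma pair_form_cmult_left:
  assumes P: "lin_op P" and "f \<in> T0" "g \<in> T0"
  shows "pair_form P (\<lambda>\<xi>. c * f \<xi>) g = c * pair_form P f g"
proof -
  have "P (coord_mult l (\<lambda>\<xi>. c * f \<xi>)) = (\<lambda>\<xi>. c * P (coord_mult l f) \<xi>)" for l
    using P smooth_coord_mult[OF T0_smooth] assms(2)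
    by (simp add: lin_op_def coord_mult_def[abs_def] mult.left_commute)
  then show ?thesis
    unfolding pair_form_def sum_distrib_left
    by (intro sum.cong refl) (simp only: mult.assoc m.cmult pair_form_T0 assms)
qed

text \<open>Diagonal values are known on the real subspace of conjugate-symmetric functions. Every
  \<open>f\<close> is \<open>u + \<i> v\<close> with \<open>u\<close> and \<open>v\<close> in this
  subspace, and complex bilinearity extends the symmetrized identity from there.\<close>

lemma polarization:
  assumes P: "lin_op P" and diag: "\<And>f. f \<in> T0 \<Longrightarrow> (\<And>\<xi>. f (- \<xi>) = cnj (f \<xi>)) \<Longrightarrow> pair_form P f f = 0"
    and f: "f \<in> T0" and w: "w \<in> T0" "\<And>\<xi>. w (- \<xi>) = cnj (w \<xi>)"
  shows "pair_form P f w + pair_form P w f = 0"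
proof -
  have real: "pair_form P g w + pair_form P w g = 0" if g: "g \<in> T0" "\<And>\<xi>. g (- \<xi>) = cnj (g \<xi>)" for g
  proof -
    have "pair_form P (\<lambda>\<xi>. g \<xi> + w \<xi>) (\<lambda>\<xi>. g \<xi> + w \<xi>) = 0"
      using g w by (intro diag T0_add) auto
    then show ?thesis
      using diag[OF g] diag[OF w] g(1) w(1) P
      by (simp add: pair_form_add_left pair_form_add_right T0_add)
  qed
  define u where "u \<xi> = 1 / 2 * (f \<xi> + cnj (f (- \<xi>)))" for \<xi>
  define v where "v \<xi> = - \<i> / 2 * (f \<xi> + (-1) * cnj (f (- \<xi>)))" for \<xi>
  have T: "(\<lambda>\<xi>. cnj (f (- \<xi>))) \<in> T0" by (intro T0_cnj T0_reflect f)
  have u: "u \<in> T0" unfolding u_def[abs_def] by (intro T0_cmult T0_add f T)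
  have v: "v \<in> T0" unfolding v_def[abs_def] by (intro T0_cmult T0_add f T)
  have iv: "(\<lambda>\<xi>. \<i> * v \<xi>) \<in> T0" by (rule T0_cmult[OF v])
  have fe: "f = (\<lambda>\<xi>. u \<xi> + \<i> * v \<xi>)" by (rule ext) (simp add: u_def v_def algebra_simps)
  have ru: "pair_form P u w + pair_form P w u = 0" by (rule real[OF u]) (simp add: u_def)
  have rv: "pair_form P v w + pair_form P w v = 0" by (rule real[OF v]) (simp add: v_def algebra_simps)
  have "pair_form P f w + pair_form P w f = (pair_form P u w + pair_form P w u) + \<i> * (pair_form P v w + pair_form P w v)"
    unfolding fe using P u v iv w(1)
    by (simp add: pair_form_add_left pair_form_add_right pair_form_cmult_left pair_form_cmult_right algebra_simps)
  then show ?thesis using ru rv by simp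
qed

text \<open>Linearity of \<open>m\<close> exhibits the identity as a polynomial in \<open>a\<close>
  whose coefficients are values of \<open>pair_form\<close>.\<close>

lemma quad_identity_expanded:
  assumes f: "f \<in> T0" and sym: "\<And>\<xi>. f (- \<xi>) = cnj (f \<xi>)"
  shows "of_real (1 + (norm a)\<^sup>2) * pair_form (\<lambda>f. f) f f
    + (\<Sum>j\<in>UNIV. (- 2 * \<i> * of_real (a $ j)) * pair_form (partial j) f f) - pair_form laplacian f f = 0"
proof -
  define A where "A l = (\<lambda>\<xi>. coord_mult l f (- \<xi>) * f \<xi>)" for l
  define B where "B j l = (\<lambda>\<xi>. partial j (coord_mult l f) (- \<xi>) * f \<xi>)" for j l
  define L where "L l = (\<lambda>\<xi>. laplacian (coord_mult l f) (- \<xi>) * f \<xi>)" for l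
  have T: "A l \<in> T0" "B j l \<in> T0" "L l \<in> T0" for j l
    unfolding A_def B_def L_def
    using pair_form_T0[OF lin_op_id f f] pair_form_T0[OF lin_op_partial f f] pair_form_T0[OF lin_op_laplacian f f] by auto
  have e: "(\<lambda>\<xi>. quad_op a (\<lambda>\<eta>. \<i> * of_real (\<eta> $ l) * f \<eta>) (- \<xi>) * f \<xi>) =
    (\<lambda>\<xi>. \<i> * (of_real (1 + (norm a)\<^sup>2) * A l \<xi> + (\<Sum>j\<in>UNIV. (- 2 * \<i> * of_real (a $ j)) * B j l \<xi>) + (-1) * L l \<xi>))" for l
  proof -
    have 1: "(\<lambda>\<eta>. \<i> * of_real (\<eta> $ l) * f \<eta>) = (\<lambda>\<eta>. \<i> * coord_mult l f \<eta>)"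
      by (simp add: coord_mult_def[abs_def] mult.assoc)
    have 2: "partial j (\<lambda>\<eta>. \<i> * coord_mult l f \<eta>) = (\<lambda>\<eta>. \<i> * partial j (coord_mult l f) \<eta>)" for j
      by (rule partial_cmult_smooth[OF smooth_coord_mult[OF T0_smooth[OF f]]])
    have 3: "partial j (\<lambda>\<eta>. \<i> * partial j (coord_mult l f) \<eta>) = (\<lambda>\<eta>. \<i> * partial j (partial j (coord_mult l f)) \<eta>)" for j
      by (rule partial_cmult_smooth[OF smooth_partial[OF smooth_coord_mult[OF T0_smooth[OF f]]]])
    show ?thesis
      unfolding quad_op_def 1 2 3 A_def B_def L_def laplacian_def
      by (rule ext) (simp add: sum_2 algebra_simps)
  qed
  have S: "(\<lambda>\<xi>. \<Sum>j\<in>UNIV. (- 2 * \<i> * of_real (a $ j)) * B j l \<xi>) \<in> T0" for l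
    by (intro T0_sum T0_cmult T)
  have "m l (\<lambda>\<xi>. quad_op a (\<lambda>\<eta>. \<i> * of_real (\<eta> $ l) * f \<eta>) (- \<xi>) * f \<xi>)
    = \<i> * (of_real (1 + (norm a)\<^sup>2) * m l (A l) + (\<Sum>j\<in>UNIV. (- 2 * \<i> * of_real (a $ j)) * m l (B j l)) - m l (L l))" for l
  proof -
    have s: "m l (\<lambda>\<xi>. \<Sum>j\<in>UNIV. (- 2 * \<i> * of_real (a $ j)) * B j l \<xi>) = (\<Sum>j\<in>UNIV. (- 2 * \<i> * of_real (a $ j)) * m l (B j l))"
      by (subst m.sum) (intro T0_cmult T sum.cong refl m.cmult)+
    have t1: "(\<lambda>\<xi>. of_real (1 + (norm a)\<^sup>2) * A l \<xi>) \<in> T0" and t3: "(\<lambda>\<xi>. (-1) * L l \<xi>) \<in> T0"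
      by (intro T0_cmult T)+
    show ?thesis
      unfolding e m.cmult[OF T0_add[OF T0_add[OF t1 S] t3]] m.add[OF T0_add[OF t1 S] t3] m.add[OF t1 S] s
        m.cmult[OF T(1)] m.cmult[OF T(3)] by simp
  qed
  then have "0 = \<i> * (\<Sum>l\<in>UNIV. of_real (1 + (norm a)\<^sup>2) * m l (A l) + (\<Sum>j\<in>UNIV. (- 2 * \<i> * of_real (a $ j)) * m l (B j l)) - m l (L l))"
    using quad_identity[OF f sym, of a] by (simp only: sum_distrib_left)
  moreover have "X = 0" if "0 = \<i> * X" for X using that by simp
  ultimately have "(\<Sum>l\<in>UNIV. of_real (1 + (norm a)\<^sup>2) * m l (A l) + (\<Sum>j\<in>UNIV. (- 2 * \<i> * of_real (a $ j)) * m l (B j l)) - m l (L l)) = 0"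
    by blast
  then show ?thesis
    unfolding pair_form_def A_def B_def L_def by (simp add: sum_2 algebra_simps)
qed

text \<open>With \<open>A\<close>, \<open>B k\<close>, \<open>L\<close> for the three forms, the
  polynomial in \<open>a\<close> gives \<open>A = L\<close> at the origin and
  \<open>2 A - L = 2 \<i> B k\<close>, \<open>2 A - L = - 2 \<i> B k\<close> at the two unit vectors
  along axis \<open>k\<close>. The last two force both sides to vanish, and then everything
  does.\<close>

lemma diagonal_identities:
  assumes f: "f \<in> T0" and sym: "\<And>\<xi>. f (- \<xi>) = cnj (f \<xi>)"
  shows "pair_form (\<lambda>f. f) f f = 0" "pair_form (partial j) f f = 0" "pair_form laplacian f f = 0"
proof -
  let ?A = "pair_form (\<lambda>f. f) f f" and ?B = "\<lambda>j. pair_form (partial j) f f" and ?L = "pair_form laplacian f f"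
  note Q = quad_identity_expanded[OF f sym]
  have z: "?A - ?L = 0" using Q[of 0] by simp
  have ax: "(\<Sum>j\<in>UNIV. (- 2 * \<i> * of_real ((c *\<^sub>R axis k 1 :: plane) $ j)) * ?B j) = - 2 * \<i> * of_real c * ?B k" for k c
    using exhaust_2[of k] by (auto simp: sum_2 axis_def)
  have p: "2 * ?A - 2 * \<i> * ?B k - ?L = 0" and n: "2 * ?A + 2 * \<i> * ?B k - ?L = 0" for k
    using Q[of "1 *\<^sub>R axis k 1"] Q[of "(-1) *\<^sub>R axis k 1"] unfolding ax by (simp_all add: norm_axis_1 del: scaleR_minus1_left)
  have "2 * (2 * ?A - ?L) = 0" using p[of 1] n[of 1] by algebra
  with z show a: "?A = 0" by algebra
  then show "?L = 0" using z by simp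
  have "4 * \<i> * ?B j = 0" using p[of j] n[of j] by algebra
  then show "?B j = 0" by simp
qed


section \<open>The identities of order zero, one and two\<close>

definition D :: "(plane \<Rightarrow> complex) \<Rightarrow> complex" where
  "D f = (\<Sum>l\<in>UNIV. m l (coord_mult l f))"

lemma D_reflect:
  "m l (\<lambda>\<xi>. coord_mult l f (- \<xi>)) = - m l (coord_mult l (\<lambda>\<xi>. f (- \<xi>)))" if "f \<in> T0"
proof -
  have "(\<lambda>\<xi>. coord_mult l f (- \<xi>)) = (\<lambda>\<xi>. (-1) * coord_mult l (\<lambda>\<xi>. f (- \<xi>)) \<xi>)"
    by (simp add: coord_mult_def fun_eq_iff)
  then show ?thesis using m.cmult[OF T0_coord_mult[OF T0_reflect[OF that]], of l "-1" l] by simp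
qed

text \<open>With \<open>w = 1\<close> near the support of \<open>f\<close> and near its mirror
  image, locality of \<open>P\<close> removes \<open>w\<close> from both products: one keeps only
  the \<open>f\<close> factor, the other keeps \<open>P\<close> applied to the bare coordinate. The
  polarized identity becomes linear in \<open>f\<close>.\<close>

lemma cutoff_pairing:
  assumes P: "P = (\<lambda>f. f) \<or> (\<exists>j. P = partial j) \<or> P = laplacian" and f: "f \<in> T0"
  obtains w where "w \<in> T0" "pair_form P f w + pair_form P w f = 0"
    "\<And>l. (\<lambda>\<xi>. P (coord_mult l f) (- \<xi>) * w \<xi>) = (\<lambda>\<xi>. P (coord_mult l f) (- \<xi>))"
    "\<And>l. (\<lambda>\<xi>. P (coord_mult l w) (- \<xi>) * f \<xi>) = (\<lambda>\<xi>. P (\<lambda>\<eta>. of_real (\<eta> $ l)) (- \<xi>) * f \<xi>)"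
proof -
  obtain r R where f': "0 < r" "r \<le> R" "\<And>\<xi>. f \<xi> \<noteq> 0 \<Longrightarrow> \<xi> \<in> annulus r R" using T0E[OF f] by blast
  obtain w where w: "w \<in> T0" "\<And>\<xi>. w (- \<xi>) = w \<xi>" "\<And>\<xi>. cnj (w \<xi>) = w \<xi>"
    "\<And>\<xi>. r / 2 < norm \<xi> \<Longrightarrow> norm \<xi> < 2 * R \<Longrightarrow> w \<xi> = 1" by (rule even_real_cutoff[OF cutoff f'(1,2)]) blast
  have lin: "lin_op P" using P lin_op_id lin_op_partial lin_op_laplacian by blast
  have diag: "pair_form P g g = 0" if "g \<in> T0" "\<And>\<xi>. g (- \<xi>) = cnj (g \<xi>)" for g
    using diagonal_identities[OF that] P by auto
  define U where "U = {\<xi>::plane. r / 2 < norm \<xi> \<and> norm \<xi> < 2 * R}"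
  have U: "open U" unfolding U_def
    by (intro open_Collect_conj open_Collect_less continuous_intros)
  \<comment> \<open>\<open>P\<close> involves derivatives of order at most two, so lists of length
    zero, one and two are enough.\<close>
  have local: "P g \<xi> = P h \<xi>" if "open S" "\<xi> \<in> S" "\<And>\<eta>. \<eta> \<in> S \<Longrightarrow> g \<eta> = h \<eta>" for g h \<xi> S
  proof -
    have "partials js g \<xi> = partials js h \<xi>" for js using partials_cong_open[OF that(1,3,2)] .
    from this[of "[]"] this[of "[_]"] this[of "[_, _]"] show ?thesis
      using P by (auto simp: partials_Cons laplacian_def)
  qed
  have annU: "\<xi> \<in> U" if "\<xi> \<in> annulus r R" for \<xi> using that f' by (auto simp: annulus_def U_def)
  have supp: "P (coord_mult l f) \<xi> = 0" if "\<xi> \<notin> annulus r R" for l \<xi>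
  proof -
    have "P (coord_mult l f) \<xi> = P (\<lambda>_. 0) \<xi>"
      by (rule local[of "- annulus r R"]) (use that f'(3) closed_annulus in \<open>auto simp: coord_mult_def open_Compl\<close>)
    also have "\<dots> = 0" using P by (auto simp: laplacian_def)
    finally show ?thesis .
  qed
  show thesis
  proof (rule that[of w])
    show "w \<in> T0" by fact
    show "pair_form P f w + pair_form P w f = 0"
      by (rule polarization[OF lin diag f w(1)]) (simp_all add: w(2,3))
    show "(\<lambda>\<xi>. P (coord_mult l f) (- \<xi>) * w \<xi>) = (\<lambda>\<xi>. P (coord_mult l f) (- \<xi>))" for l
    proof
      fix \<xi>
      show "P (coord_mult l f) (- \<xi>) * w \<xi> = P (coord_mult l f) (- \<xi>)"
        using supp[of "- \<xi>" l] annU[of "- \<xi>"] w(4)[of \<xi>] by (cases "- \<xi> \<in> annulus r R") (auto simp: U_def)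
    qed
    show "(\<lambda>\<xi>. P (coord_mult l w) (- \<xi>) * f \<xi>) = (\<lambda>\<xi>. P (\<lambda>\<eta>. of_real (\<eta> $ l)) (- \<xi>) * f \<xi>)" for l
    proof
      fix \<xi>
      show "P (coord_mult l w) (- \<xi>) * f \<xi> = P (\<lambda>\<eta>. of_real (\<eta> $ l)) (- \<xi>) * f \<xi>"
      proof (cases "f \<xi> = 0")
        case False
        then have "- \<xi> \<in> U" using annU[OF f'(3)] by (simp add: U_def)
        then have "P (coord_mult l w) (- \<xi>) = P (\<lambda>\<eta>. of_real (\<eta> $ l)) (- \<xi>)"
          by (rule local[OF U]) (simp add: coord_mult_def w(4) U_def)
        then show ?thesis by simp
      qed simp
    qed
  qed
qed

text \<open>With \<open>P\<close> the identity, both products contain a coordinate at the reflected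
  point. Its sign appears in both terms, so \<open>D\<close> of the reflection and \<open>D\<close>
  itself add up to zero.\<close>

lemma D_odd:
  assumes f: "f \<in> T0"
  shows "D (\<lambda>\<xi>. f (- \<xi>)) = - D f"
proof -
  obtain w where w: "w \<in> T0" "pair_form (\<lambda>f. f) f w + pair_form (\<lambda>f. f) w f = 0"
    "\<And>l. (\<lambda>\<xi>. coord_mult l f (- \<xi>) * w \<xi>) = (\<lambda>\<xi>. coord_mult l f (- \<xi>))"
    "\<And>l. (\<lambda>\<xi>. coord_mult l w (- \<xi>) * f \<xi>) = (\<lambda>\<xi>. of_real ((- \<xi>) $ l) * f \<xi>)"
    by (rule cutoff_pairing[of "\<lambda>f. f" f]) (use f in auto)
  have n: "(\<lambda>\<xi>. of_real ((- \<xi>) $ l) * f \<xi>) = (\<lambda>\<xi>. (-1) * coord_mult l f \<xi>)" for l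
    by (simp add: coord_mult_def fun_eq_iff)
  have "m l (\<lambda>\<xi>. (-1) * coord_mult l f \<xi>) = - m l (coord_mult l f)" for l
    using m.cmult[OF T0_coord_mult[OF f], of l "-1" l] by simp
  then have "- D (\<lambda>\<xi>. f (- \<xi>)) - D f = 0"
    using w(2) unfolding pair_form_def w(3,4) n D_reflect[OF f] D_def by (simp add: sum_negf)
  then show ?thesis by (metis eq_iff_diff_eq_0 minus_equation_iff)
qed

lemma D_diff: "f \<in> T0 \<Longrightarrow> g \<in> T0 \<Longrightarrow> D (\<lambda>\<xi>. f \<xi> - g \<xi>) = D f - D g"
  and D_add: "f \<in> T0 \<Longrightarrow> g \<in> T0 \<Longrightarrow> D (\<lambda>\<xi>. f \<xi> + g \<xi>) = D f + D g"
  and D_cmult: "f \<in> T0 \<Longrightarrow> D (\<lambda>\<xi>. c * f \<xi>) = c * D f"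
proof -
  have "coord_mult l (\<lambda>\<xi>. f \<xi> - g \<xi>) = (\<lambda>\<xi>. coord_mult l f \<xi> - coord_mult l g \<xi>)"
    "coord_mult l (\<lambda>\<xi>. f \<xi> + g \<xi>) = (\<lambda>\<xi>. coord_mult l f \<xi> + coord_mult l g \<xi>)"
    "coord_mult l (\<lambda>\<xi>. c * f \<xi>) = (\<lambda>\<xi>. c * coord_mult l f \<xi>)" for l
    by (simp_all add: coord_mult_def fun_eq_iff algebra_simps)
  then show "f \<in> T0 \<Longrightarrow> g \<in> T0 \<Longrightarrow> D (\<lambda>\<xi>. f \<xi> - g \<xi>) = D f - D g"
    "f \<in> T0 \<Longrightarrow> g \<in> T0 \<Longrightarrow> D (\<lambda>\<xi>. f \<xi> + g \<xi>) = D f + D g"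
    "f \<in> T0 \<Longrightarrow> D (\<lambda>\<xi>. c * f \<xi>) = c * D f"
    by (simp_all add: D_def m.diff m.add m.cmult T0_coord_mult sum_subtractf sum.distrib sum_distrib_left)
qed

text \<open>The \<open>m j\<close> terms arise where \<open>partial j\<close> hits the coordinate,
  the last term where it hits \<open>f\<close>, with the sign settled by \<open>D_odd\<close>. This
  is the weak form of the gradient equation for \<open>D\<close>: a distributional derivative
  carries a minus sign, which collects all terms on one side.\<close>

lemma first_order_identity:
  assumes f: "f \<in> T0"
  shows "m j f + m j (\<lambda>\<xi>. f (- \<xi>)) + D (partial j f) = 0"
proof -
  obtain w where w: "w \<in> T0" "pair_form (partial j) f w + pair_form (partial j) w f = 0"
    "\<And>l. (\<lambda>\<xi>. partial j (coord_mult l f) (- \<xi>) * w \<xi>) = (\<lambda>\<xi>. partial j (coord_mult l f) (- \<xi>))"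
    "\<And>l. (\<lambda>\<xi>. partial j (coord_mult l w) (- \<xi>) * f \<xi>) = (\<lambda>\<xi>. partial j (\<lambda>\<eta>. of_real (\<eta> $ l)) (- \<xi>) * f \<xi>)"
    by (rule cutoff_pairing[of "partial j" f]) (use f in auto)
  note T = T0_reflect[OF f] T0_partial[OF f, of j]
  have p: "partial j (\<lambda>\<eta>::plane. complex_of_real (\<eta> $ l)) \<xi> = (if l = j then 1 else 0)" for l \<xi>
    by (subst partial_of_real[OF smooth_differentiable[OF smooth_nth]]) (simp add: partial_coord)
  have 1: "pair_form (partial j) w f = m j f"
  proof -
    have "m l (\<lambda>\<xi>. partial j (coord_mult l w) (- \<xi>) * f \<xi>) = (if l = j then m j f else 0)" for l
      unfolding w(4) p by (simp add: m.zero)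
    then show ?thesis unfolding pair_form_def by simp
  qed
  have 2: "pair_form (partial j) f w = m j (\<lambda>\<xi>. f (- \<xi>)) + D (partial j f)"
  proof -
    have "m l (\<lambda>\<xi>. partial j (coord_mult l f) (- \<xi>))
        = (if l = j then m j (\<lambda>\<xi>. f (- \<xi>)) else 0) + m l (\<lambda>\<xi>. coord_mult l (partial j f) (- \<xi>))" for l
    proof -
      have e: "(\<lambda>\<xi>. partial j (coord_mult l f) (- \<xi>)) = (\<lambda>\<xi>. (if l = j then f (- \<xi>) else 0) + coord_mult l (partial j f) (- \<xi>))"
        by (simp add: partial_coord_mult[OF T0_smooth[OF f]] coord_mult_def[of l "partial j f"])
      have "(\<lambda>\<xi>. if l = j then f (- \<xi>) else 0) \<in> T0" using T(1) by (cases "l = j") (simp_all add: T0_zero)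
      then show ?thesis
        unfolding e by (subst m.add) (auto intro: T0_reflect T0_coord_mult T m.zero)
    qed
    then have "pair_form (partial j) f w = m j (\<lambda>\<xi>. f (- \<xi>)) - D (\<lambda>\<xi>. partial j f (- \<xi>))"
      unfolding pair_form_def w(3) by (simp add: sum.distrib D_reflect[OF T(2)] D_def sum_negf sum_subtractf)
    then show ?thesis using D_odd[OF T(2)] by simp
  qed
  show ?thesis using w(2) unfolding 1 2 by (simp add: algebra_simps)
qed

text \<open>The Laplacian of a coordinate is zero, so the term in which \<open>w\<close> is
  differentiated drops out.\<close>

lemma second_order_identity:
  assumes f: "f \<in> T0"
  shows "(\<Sum>l\<in>UNIV. m l (\<lambda>\<xi>. laplacian (coord_mult l f) (- \<xi>))) = 0"
proof -
  obtain w where w: "w \<in> T0" "pair_form laplacian f w + pair_form laplacian w f = 0"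
    "\<And>l. (\<lambda>\<xi>. laplacian (coord_mult l f) (- \<xi>) * w \<xi>) = (\<lambda>\<xi>. laplacian (coord_mult l f) (- \<xi>))"
    "\<And>l. (\<lambda>\<xi>. laplacian (coord_mult l w) (- \<xi>) * f \<xi>) = (\<lambda>\<xi>. laplacian (\<lambda>\<eta>. of_real (\<eta> $ l)) (- \<xi>) * f \<xi>)"
    by (rule cutoff_pairing[of laplacian f]) (use f in auto)
  have p: "partial j (\<lambda>\<eta>::plane. complex_of_real (\<eta> $ l)) = (\<lambda>_. if l = j then 1 else 0)" for l j
    by (rule ext, subst partial_of_real[OF smooth_differentiable[OF smooth_nth]]) (simp add: partial_coord)
  have "laplacian (\<lambda>\<eta>. of_real (\<eta> $ l)) \<xi> = 0" for l \<xi> by (simp add: laplacian_def p)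
  then have "pair_form laplacian w f = 0" unfolding pair_form_def w(4) by (simp add: m.zero)
  then show ?thesis using w(2) unfolding pair_form_def w(3) by simp
qed


end

section \<open>Weighted components and complex multiplication\<close>

lemma norm_plane_sq: "(norm \<xi>)\<^sup>2 = (\<xi> $ 1)\<^sup>2 + (\<xi> $ 2)\<^sup>2" for \<xi> :: plane
  by (simp add: norm_vec_def L2_set_def sum_2)

text \<open>Near the origin \<open>|\<xi>|\<^sup>2\<close> is made positive by adding a smooth cutoff, so that it can be inverted.\<close>

lemma T0_over_norm_sq:
  assumes \<psi>: "lp_cutoff \<psi>" and f: "f \<in> T0"
  shows "(\<lambda>\<xi>. f \<xi> / of_real ((norm \<xi>)\<^sup>2)) \<in> T0"
proof -
  obtain r R where f': "0 < r" "\<And>\<xi>. f \<xi> \<noteq> 0 \<Longrightarrow> \<xi> \<in> annulus r R" using T0E[OF f] by blast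
  define q where "q \<xi> = (norm (\<psi> ((2 / r) *\<^sub>R \<xi>)))\<^sup>2" for \<xi>
  define b where "b \<xi> = (norm \<xi>)\<^sup>2 + q \<xi>" for \<xi> :: plane
  have sq: "smooth (\<lambda>\<xi>. \<psi> ((2 / r) *\<^sub>R \<xi>))"
    by (rule smoothI_psm[OF psm_compose[OF psm_fixed_linear[OF bounded_linear_scaleR_right] lp_cutoffD(1)[OF \<psi>]]])
  have q: "q = (\<lambda>\<xi>. Re (\<psi> ((2 / r) *\<^sub>R \<xi>) * cnj (\<psi> ((2 / r) *\<^sub>R \<xi>))))"
    by (rule ext) (unfold q_def cmod_power2, simp add: power2_eq_square)
  have "smooth q" unfolding q
    by (intro smooth_bounded_linear[OF bounded_linear_Re] smooth_mult sq smooth_bounded_linear[OF bounded_linear_cnj])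
  then have sb: "smooth b"
    unfolding b_def[abs_def] norm_plane_sq unfolding power2_eq_square
    by (intro smooth_add smooth_mult smooth_nth)
  have pos: "b \<xi> > 0" for \<xi>
  proof (cases "\<xi> = 0")
    case True
    then show ?thesis using lp_cutoffD(3)[OF \<psi>, of 0] by (simp add: b_def q_def)
  qed (simp add: b_def q_def add_pos_nonneg)
  have "psm {0::real} (\<lambda>_ \<xi>. exp ((-1) * ln (b \<xi>)))"
    by (intro psm_exp psm_mult psm_const psm_ln smooth_imp_psm sb pos)
  then have "smooth (\<lambda>\<xi>. complex_of_real (exp ((-1) * ln (b \<xi>))))"
    by (intro smoothI_psm psm_of_real)
  then have sm: "smooth (\<lambda>\<xi>. complex_of_real (exp ((-1) * ln (b \<xi>))) * f \<xi>)"
    by (rule smooth_mult[OF _ T0_smooth[OF f]])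
  have e: "complex_of_real (exp ((-1) * ln (b \<xi>))) * f \<xi> = f \<xi> / of_real ((norm \<xi>)\<^sup>2)" for \<xi>
  proof (cases "f \<xi> = 0")
    case False
    then have n: "r \<le> norm \<xi>" using f'(2) by (auto simp: annulus_def)
    then have "norm ((2 / r) *\<^sub>R \<xi>) > 1" using f'(1) by (simp add: field_simps)
    then have "q \<xi> = 0" using lp_cutoffD(4)[OF \<psi>, of "(2 / r) *\<^sub>R \<xi>"] by (force simp: q_def)
    moreover have "exp ((-1) * ln (b \<xi>)) = inverse (b \<xi>)" using pos[of \<xi>] by (simp add: exp_minus)
    ultimately show ?thesis by (simp add: b_def divide_inverse mult.commute)
  qed simp
  show ?thesis
    using sm unfolding e by (rule T0I[OF _ f'(1), where R=R]) (use f'(2) in auto)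
qed

context bounded_multiplier
begin

text \<open>Covers the radial component \<open>D\<close> and the tangential component
  \<open>v\<close>, both with linear weights, so that dilations and flows are treated once.\<close>

definition weighted :: "(2 \<Rightarrow> plane \<Rightarrow> complex) \<Rightarrow> (plane \<Rightarrow> complex) \<Rightarrow> complex" where
  "weighted w f = (\<Sum>l\<in>UNIV. m l (\<lambda>\<xi>. w l \<xi> * f \<xi>))"

lemma D_weighted: "D f = weighted (\<lambda>l \<xi>. of_real (\<xi> $ l)) f"
  by (simp add: D_def weighted_def coord_mult_def[abs_def])

lemma weighted_cmult: "(\<And>l. smooth (w l)) \<Longrightarrow> f \<in> T0 \<Longrightarrow> weighted w (\<lambda>\<xi>. c * f \<xi>) = c * weighted w f"
  unfolding weighted_def sum_distrib_left
  by (intro sum.cong refl) (simp only: mult.left_commute[of _ c] m.cmult T0_mult)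

lemma weighted_diff: "(\<And>l. smooth (w l)) \<Longrightarrow> f \<in> T0 \<Longrightarrow> g \<in> T0 \<Longrightarrow> weighted w (\<lambda>\<xi>. f \<xi> - g \<xi>) = weighted w f - weighted w g"
  by (simp add: weighted_def right_diff_distrib m.diff T0_mult sum_subtractf)

lemma weighted_box_integral:
  fixes H :: "'p::euclidean_space \<Rightarrow> plane \<Rightarrow> complex"
  assumes w: "\<And>l. smooth (w l)" and H: "psm (cbox a b) H" and r: "0 < r" and aH: "annular (cbox a b) H r R"
  shows "continuous_on (cbox a b) (\<lambda>p. weighted w (H p))"
    "weighted w (\<lambda>\<xi>. integral (cbox a b) (\<lambda>p. H p \<xi>)) = integral (cbox a b) (\<lambda>p. weighted w (H p))"
proof -
  have p: "psm (cbox a b) (\<lambda>p \<xi>. w l \<xi> * H p \<xi>)" for l by (intro psm_mult smooth_imp_psm w H)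
  have q: "annular (cbox a b) (\<lambda>p \<xi>. w l \<xi> * H p \<xi>) r R" for l using aH by (auto simp: annular_def)
  have c: "continuous_on (cbox a b) (\<lambda>p. m l (\<lambda>\<xi>. w l \<xi> * H p \<xi>))" for l
    by (rule m.continuous_param[OF p compact_cbox r q])
  then show "continuous_on (cbox a b) (\<lambda>p. weighted w (H p))"
    unfolding weighted_def by (intro continuous_on_sum)
  have "m l (\<lambda>\<xi>. w l \<xi> * integral (cbox a b) (\<lambda>p. H p \<xi>)) = integral (cbox a b) (\<lambda>p. m l (\<lambda>\<xi>. w l \<xi> * H p \<xi>))" for l
    using m.box_integral(2)[OF p r q, of l] by (simp add: integral_mult_right)
  then show "weighted w (\<lambda>\<xi>. integral (cbox a b) (\<lambda>p. H p \<xi>)) = integral (cbox a b) (\<lambda>p. weighted w (H p))"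
    unfolding weighted_def by (subst Henstock_Kurzweil_Integration.integral_sum) (auto intro!: integrable_continuous c)
qed

end

text \<open>Complex multiplication on the plane: it contains both dilations and rotations.\<close>

definition cmul :: "plane \<Rightarrow> plane \<Rightarrow> plane" where
  "cmul a x = (\<chi> i. if i = 1 then a $ 1 * x $ 1 - a $ 2 * x $ 2 else a $ 1 * x $ 2 + a $ 2 * x $ 1)"

lemma cmul_nth [simp]: "cmul a x $ 1 = a $ 1 * x $ 1 - a $ 2 * x $ 2" "cmul a x $ 2 = a $ 1 * x $ 2 + a $ 2 * x $ 1"
  by (simp_all add: cmul_def)

lemma plane_eq_iff: "x = y \<longleftrightarrow> x $ 1 = y $ 1 \<and> x $ 2 = y $ 2" for x y :: plane
  by (simp add: vec_eq_iff forall_2)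

lemma cmul_commute: "cmul a b = cmul b a"
  by (simp add: plane_eq_iff algebra_simps)

lemma cmul_assoc: "cmul (cmul a b) x = cmul a (cmul b x)"
  by (simp add: plane_eq_iff algebra_simps)

lemma bounded_bilinear_cmul: "bounded_bilinear cmul"
proof (rule bilinear_conv_bounded_bilinear[THEN iffD1])
  show "bilinear cmul"
    unfolding bilinear_def
    by (auto intro!: linearI simp: plane_eq_iff algebra_simps)
qed

lemma bounded_linear_cmul: "bounded_linear (cmul a)"
  by (rule bounded_bilinear.bounded_linear_right[OF bounded_bilinear_cmul])

lemma norm_cmul: "norm (cmul a x) = norm a * norm x"
proof -
  have "(norm (cmul a x))\<^sup>2 = (norm a * norm x)\<^sup>2"
    by (simp add: norm_plane_sq power_mult_distrib) algebra
  then show ?thesis by (simp add: power2_eq_iff_nonneg)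
qed

lemma cmul_axis_1 [simp]: "cmul (c *\<^sub>R axis 1 1) x = c *\<^sub>R x"
  by (simp add: plane_eq_iff axis_def)

text \<open>The complex inverse, conjugate over squared modulus; division by zero gives it the value
  0 at 0.\<close>

definition cinv :: "plane \<Rightarrow> plane" where
  "cinv a = (1 / (norm a)\<^sup>2) *\<^sub>R (\<chi> i. if i = 1 then a $ 1 else - a $ 2)"

lemma cinv_nth: "cinv a $ 1 = a $ 1 / (norm a)\<^sup>2" "cinv a $ 2 = - a $ 2 / (norm a)\<^sup>2"
  by (simp_all add: cinv_def)

lemma cmul_cinv: assumes "a \<noteq> 0" shows "cmul a (cinv a) = axis 1 1"
proof -
  have "(norm a)\<^sup>2 \<noteq> 0" using assms by simp
  moreover have "a $ 1 * a $ 1 + a $ 2 * a $ 2 = (norm a)\<^sup>2" unfolding norm_plane_sq by (simp add: power2_eq_square)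
  ultimately have "(a $ 1 * a $ 1 + a $ 2 * a $ 2) / (norm a)\<^sup>2 = 1" by simp
  then show ?thesis
    by (simp add: plane_eq_iff cinv_nth axis_def add_divide_distrib diff_divide_distrib)
qed

lemma norm_cinv: "norm (cinv a) = 1 / norm a"
proof (cases "a = 0")
  case False
  then have "norm a * norm (cinv a) = 1" using norm_cmul[of a "cinv a"] cmul_cinv[OF False] by (simp add: norm_axis_1)
  then show ?thesis using False by (simp add: field_simps)
qed (simp add: cinv_def)

lemma cinv_cmul: assumes "a \<noteq> 0" "x \<noteq> 0" shows "cinv (cmul a x) = cmul (cinv a) (cinv x)"
proof -
  have "cmul (cmul a x) (cmul (cinv a) (cinv x)) = cmul (cmul a (cinv a)) (cmul x (cinv x))"
    by (metis cmul_assoc cmul_commute)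
  also have "\<dots> = axis 1 1" using assms cmul_axis_1[of 1 "axis 1 1"] by (simp add: cmul_cinv)
  finally have e: "cmul (cmul a x) (cmul (cinv a) (cinv x)) = axis 1 1" .
  have nz: "cmul a x \<noteq> 0" using assms norm_cmul[of a x] by (metis mult_eq_0_iff norm_eq_zero)
  have one: "cmul (axis 1 1) y = y" for y using cmul_axis_1[of 1 y] by simp
  have "cinv (cmul a x) = cmul (cinv (cmul a x)) (axis 1 1)" by (metis one cmul_commute)
  also have "\<dots> = cmul (cmul (cmul a x) (cinv (cmul a x))) (cmul (cinv a) (cinv x))"
    unfolding e[symmetric] by (metis cmul_assoc cmul_commute)
  also have "\<dots> = cmul (cinv a) (cinv x)" by (simp add: cmul_cinv[OF nz] one)
  finally show ?thesis .
qed

lemma psm_cmul: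
  assumes "smooth f" "continuous_on P a"
  shows "psm P (\<lambda>p \<xi>. f (cmul (a p) \<xi>))"
  by (intro psm_compose[OF psm_linear assms(1)] bounded_linear_cmul
      bounded_bilinear.continuous_on[OF bounded_bilinear_cmul] assms(2) continuous_on_const)

lemma annular_cmul:
  assumes f: "\<And>\<xi>. f \<xi> \<noteq> 0 \<Longrightarrow> \<xi> \<in> annulus r R" and a: "\<And>p. p \<in> P \<Longrightarrow> s \<le> norm (a p) \<and> norm (a p) \<le> S" and s: "0 < s"
  shows "annular P (\<lambda>p \<xi>. f (cmul (a p) \<xi>)) (r / S) (R / s)"
  unfolding annular_def
proof (intro ballI allI impI)
  fix p \<xi> assume p: "p \<in> P" and nz: "f (cmul (a p) \<xi>) \<noteq> 0"
  from f[OF nz] have b: "r \<le> norm (a p) * norm \<xi>" "norm (a p) * norm \<xi> \<le> R" by (simp_all add: annulus_def norm_cmul)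
  have "s * norm \<xi> \<le> norm (a p) * norm \<xi>" "norm (a p) * norm \<xi> \<le> S * norm \<xi>"
    using a[OF p] by (intro mult_right_mono; simp)+
  with b have "r \<le> S * norm \<xi>" "s * norm \<xi> \<le> R" by linarith+
  moreover have "0 < S" using a[OF p] s by linarith
  ultimately show "\<xi> \<in> annulus (r / S) (R / s)" using s by (simp add: annulus_def field_simps)
qed

lemma T0_cmul: assumes "f \<in> T0" "a \<noteq> 0" shows "(\<lambda>\<xi>. f (cmul a \<xi>)) \<in> T0"
proof -
  obtain r R where f: "0 < r" "\<And>\<xi>. f \<xi> \<noteq> 0 \<Longrightarrow> \<xi> \<in> annulus r R" using T0E[OF assms(1)] by blast
  have n: "0 < norm a" using assms(2) by simp
  have "annular {0::real} (\<lambda>_ \<xi>. f (cmul a \<xi>)) (r / norm a) (R / norm a)"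
    by (rule annular_cmul[where a="\<lambda>_. a"]) (use f n in auto)
  moreover have "smooth (\<lambda>\<xi>. f (cmul a \<xi>))"
    by (rule smoothI_psm[OF psm_cmul[OF T0_smooth[OF assms(1)] continuous_on_const]])
  ultimately show ?thesis using f(1) n by (intro T0I[where r="r / norm a" and R="R / norm a"]) (auto simp: annular_def)
qed

text \<open>The derivative along the one-parameter group of multiplications generated by \<open>c\<close>.\<close>

definition gen :: "plane \<Rightarrow> (plane \<Rightarrow> complex) \<Rightarrow> plane \<Rightarrow> complex" where
  "gen c f \<xi> = (\<Sum>j\<in>UNIV. of_real (cmul c \<xi> $ j) * partial j f \<xi>)"

lemma T0_gen: assumes "f \<in> T0" shows "gen c f \<in> T0"
proof -
  have "smooth (\<lambda>\<xi>. complex_of_real (cmul c \<xi> $ j))" for j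
    by (rule smoothI_psm[OF psm_of_real[OF psm_nth[OF psm_fixed_linear[OF bounded_linear_cmul]]]])
  then show ?thesis unfolding gen_def[abs_def] by (intro T0_sum T0_mult T0_partial assms)
qed

lemma gen_eq_sum_scaleR:
  assumes "smooth f"
  shows "(\<Sum>j\<in>UNIV. (cmul c \<xi> $ j) *\<^sub>R partial j f \<xi>) = gen c f \<xi>"
  by (simp add: gen_def scaleR_conv_of_real)

text \<open>The multiplicative group is commutative, so its generators commute with all its
  elements.\<close>

lemma gen_cmul:
  assumes "smooth f"
  shows "gen c (\<lambda>\<xi>. f (cmul a \<xi>)) \<xi> = gen c f (cmul a \<xi>)"
proof -
  have s: "smooth (\<lambda>\<xi>. f (cmul a \<xi>))"
    by (rule smoothI_psm[OF psm_cmul[OF assms continuous_on_const]])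
  have "((\<lambda>\<xi>. f (cmul a \<xi>)) has_derivative (\<lambda>h. \<Sum>j\<in>UNIV. (cmul a h $ j) *\<^sub>R partial j f (cmul a \<xi>))) (at \<xi>)"
    by (rule has_derivative_compose[OF bounded_linear_imp_has_derivative[OF bounded_linear_cmul] has_derivative_partials[OF smooth_differentiable[OF assms]]])
  from has_derivative_unique[OF this has_derivative_partials[OF smooth_differentiable[OF s]]]
  have "(\<Sum>j\<in>UNIV. (cmul a h $ j) *\<^sub>R partial j f (cmul a \<xi>)) = (\<Sum>j\<in>UNIV. (h $ j) *\<^sub>R partial j (\<lambda>\<xi>. f (cmul a \<xi>)) \<xi>)" for h
    by metis
  from this[of "cmul c \<xi>"] have "(\<Sum>j\<in>UNIV. (cmul c (cmul a \<xi>) $ j) *\<^sub>R partial j f (cmul a \<xi>)) = gen c (\<lambda>\<xi>. f (cmul a \<xi>)) \<xi>"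
    unfolding gen_eq_sum_scaleR[OF s] using cmul_assoc[of a c \<xi>] cmul_assoc[of c a \<xi>] cmul_commute[of a c] by simp
  then show ?thesis by (simp only: gen_eq_sum_scaleR[OF assms])
qed

text \<open>The fundamental theorem of calculus along \<open>t \<mapsto> cmul (a t) \<xi>\<close>:
  as the derivative of \<open>a\<close> is \<open>cmul c (a t)\<close>, the velocity at each point
  of the curve is \<open>cmul c\<close> of that point.\<close>

lemma flow_integral:
  assumes f: "smooth f" and "0 \<le> T" and a: "\<And>t. (a has_vector_derivative cmul c (a t)) (at t)"
  shows "integral {0..T} (\<lambda>t. gen c f (cmul (a t) \<xi>)) = f (cmul (a T) \<xi>) - f (cmul (a 0) \<xi>)"
proof (rule integral_unique, rule fundamental_theorem_of_calculus[OF \<open>0 \<le> T\<close>])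
  fix t assume "t \<in> {0..T}"
  have "((\<lambda>t. f (cmul (a t) \<xi>)) has_derivative (\<lambda>h. \<Sum>j\<in>UNIV. (cmul (h *\<^sub>R cmul c (a t)) \<xi> $ j) *\<^sub>R partial j f (cmul (a t) \<xi>))) (at t)"
    by (rule has_derivative_compose[OF _ has_derivative_partials[OF smooth_differentiable[OF f]]])
      (rule bounded_linear.has_derivative[OF bounded_bilinear.bounded_linear_left[OF bounded_bilinear_cmul] a[unfolded has_vector_derivative_def]])
  also have "(\<lambda>h. \<Sum>j\<in>UNIV. (cmul (h *\<^sub>R cmul c (a t)) \<xi> $ j) *\<^sub>R partial j f (cmul (a t) \<xi>)) = (\<lambda>h. h *\<^sub>R gen c f (cmul (a t) \<xi>))"
    unfolding gen_eq_sum_scaleR[OF f, symmetric] scaleR_sum_right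
    by (simp add: bounded_bilinear.scaleR_left[OF bounded_bilinear_cmul] cmul_assoc)
  finally show "((\<lambda>t. f (cmul (a t) \<xi>)) has_vector_derivative gen c f (cmul (a t) \<xi>)) (at t within {0..T})"
    unfolding has_vector_derivative_def by (rule has_derivative_at_withinI)
qed

section \<open>Vanishing radial component, oddness and zero divergence\<close>

locale homogeneous_multiplier = bounded_multiplier +
  fixes \<delta> :: real
  assumes \<delta>: "0 \<le> \<delta>" "\<delta> \<le> 1/2"
    and homog: "\<And>l. homogeneous_dist (-1 + 2 * \<delta>) (m l)"
    and reality: "\<And>l. reality_condition (m l)"
begin

text \<open>\<open>flow_integral\<close> is passed through the distribution by
  \<open>weighted_box_integral\<close>. On a compact time interval the nonvanishing curve
  \<open>a\<close> has norm between positive bounds, which provides the common annulus.\<close>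

lemma weighted_flow:
  assumes w: "\<And>l. smooth (w l)" and f: "f \<in> T0" and T: "0 \<le> T" and a: "\<And>t. (a has_vector_derivative cmul c (a t)) (at t)"
    and nz: "\<And>t. a t \<noteq> 0"
  shows "continuous_on {0..T} (\<lambda>t. weighted w (\<lambda>\<xi>. gen c f (cmul (a t) \<xi>)))"
    and "weighted w (\<lambda>\<xi>. f (cmul (a T) \<xi>)) - weighted w (\<lambda>\<xi>. f (cmul (a 0) \<xi>)) =
      integral {0..T} (\<lambda>t. weighted w (\<lambda>\<xi>. gen c f (cmul (a t) \<xi>)))"
proof -
  have ca: "continuous_on {0..T} a"
    using a has_vector_derivative_continuous by (metis continuous_at_imp_continuous_on)
  have cn: "compact ((\<lambda>t. norm (a t)) ` {0..T})"
    by (intro compact_continuous_image continuous_on_norm ca compact_Icc)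
  have ne: "(\<lambda>t. norm (a t)) ` {0..T} \<noteq> {}" using T by auto
  obtain t1 where t1: "\<forall>t\<in>{0..T}. norm (a t1) \<le> norm (a t)" "t1 \<in> {0..T}"
    using compact_attains_inf[OF cn ne] by auto
  obtain t2 where t2: "\<forall>t\<in>{0..T}. norm (a t) \<le> norm (a t2)"
    using compact_attains_sup[OF cn ne] by auto
  have s: "0 < norm (a t1)" "0 < norm (a t2)" using nz by auto
  obtain r R where g: "0 < r" "\<And>\<xi>. gen c f \<xi> \<noteq> 0 \<Longrightarrow> \<xi> \<in> annulus r R" using T0E[OF T0_gen[OF f, of c]] by blast
  have H: "psm (cbox 0 T) (\<lambda>t \<xi>. gen c f (cmul (a t) \<xi>))"
    using psm_cmul[OF T0_smooth[OF T0_gen[OF f]] ca] by simp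
  have aH: "annular (cbox 0 T) (\<lambda>t \<xi>. gen c f (cmul (a t) \<xi>)) (r / norm (a t2)) (R / norm (a t1))"
    by (rule annular_cmul[OF g(2) _ s(1)]) (use t1 t2 in auto)
  have r: "0 < r / norm (a t2)" using g(1) s by simp
  note W = weighted_box_integral[OF w H r aH]
  show "continuous_on {0..T} (\<lambda>t. weighted w (\<lambda>\<xi>. gen c f (cmul (a t) \<xi>)))" using W(1) by simp
  have "weighted w (\<lambda>\<xi>. f (cmul (a T) \<xi>)) - weighted w (\<lambda>\<xi>. f (cmul (a 0) \<xi>)) = weighted w (\<lambda>\<xi>. f (cmul (a T) \<xi>) - f (cmul (a 0) \<xi>))"
    by (rule weighted_diff[OF w T0_cmul[OF f nz] T0_cmul[OF f nz], symmetric])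
  also have "(\<lambda>\<xi>. f (cmul (a T) \<xi>) - f (cmul (a 0) \<xi>)) = (\<lambda>\<xi>. integral {0..T} (\<lambda>t. gen c f (cmul (a t) \<xi>)))"
    using flow_integral[OF T0_smooth[OF f] T a] by simp
  finally show "weighted w (\<lambda>\<xi>. f (cmul (a T) \<xi>)) - weighted w (\<lambda>\<xi>. f (cmul (a 0) \<xi>)) =
      integral {0..T} (\<lambda>t. weighted w (\<lambda>\<xi>. gen c f (cmul (a t) \<xi>)))"
    using W(2) by simp
qed

text \<open>A linear weight raises the degree of homogeneity by one.\<close>

lemma weighted_dilate:
  assumes w: "\<And>l. smooth (w l)" "\<And>l c \<xi>. w l (c *\<^sub>R \<xi>) = of_real c * w l \<xi>" and f: "f \<in> T0" and s: "s > 0"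
  shows "weighted w (\<lambda>\<xi>. f (s *\<^sub>R \<xi>)) = of_real (s powr (- 2 - 2 * \<delta>)) * weighted w f"
proof -
  define r where "r = 1 / s"
  have r: "r > 0" using s by (simp add: r_def)
  have "m l (\<lambda>\<xi>. w l \<xi> * f (s *\<^sub>R \<xi>)) = of_real (s powr (- 2 - 2 * \<delta>)) * m l (\<lambda>\<xi>. w l \<xi> * f \<xi>)" for l
  proof -
    have T: "(\<lambda>\<xi>. w l \<xi> * f \<xi>) \<in> T0" by (intro T0_mult f w)
    have "(\<lambda>\<xi>. w l \<xi> * f (s *\<^sub>R \<xi>)) = (\<lambda>\<xi>. (\<lambda>\<eta>. of_real r * (w l \<eta> * f \<eta>)) (\<xi> /\<^sub>R r))"
      using s by (simp add: r_def w(2))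
    then have "m l (\<lambda>\<xi>. w l \<xi> * f (s *\<^sub>R \<xi>)) = m l (\<lambda>\<xi>. (\<lambda>\<eta>. of_real r * (w l \<eta> * f \<eta>)) (\<xi> /\<^sub>R r))"
      by (rule arg_cong)
    also have "\<dots> = of_real (r powr (-1 + 2 * \<delta> + 2)) * m l (\<lambda>\<eta>. of_real r * (w l \<eta> * f \<eta>))"
      by (rule homog[of l, unfolded homogeneous_dist_def, rule_format, OF r T0_cmult[OF T, of "of_real r"]])
    also have "\<dots> = of_real (r powr (-1 + 2 * \<delta> + 2) * r) * m l (\<lambda>\<xi>. w l \<xi> * f \<xi>)"
      unfolding m.cmult[OF T] by simp
    also have "r powr (-1 + 2 * \<delta> + 2) * r = r powr (2 + 2 * \<delta>)"
      using r powr_add[of r "-1 + 2 * \<delta> + 2" 1] by (simp add: algebra_simps)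
    also have "\<dots> = s powr (- 2 - 2 * \<delta>)"
      using s unfolding r_def by (simp add: powr_divide powr_minus_divide[symmetric])
    finally show ?thesis .
  qed
  then show ?thesis unfolding weighted_def by (simp add: sum_distrib_left)
qed

text \<open>The Euler operator is \<open>div (\<xi> f) - 2 f\<close>. Applying
  \<open>first_order_identity\<close> to the functions \<open>coord_mult j f\<close> and summing
  gives \<open>D (div (\<xi> f)) = - 2 D f\<close> because \<open>D\<close> is odd, and the two
  contributions add up to \<open>- 4\<close>.\<close>

lemma D_gen: assumes f: "f \<in> T0" shows "D (gen (axis 1 1) f) = - 4 * D f"
proof -
  have e: "gen (axis 1 1) f = (\<lambda>\<xi>. (\<Sum>j\<in>UNIV. partial j (coord_mult j f) \<xi>) - 2 * f \<xi>)"
    using cmul_axis_1[of 1]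
    by (simp add: fun_eq_iff gen_def partial_coord_mult[OF T0_smooth[OF f]] sum.distrib sum_2)
  have "m j (coord_mult j f) - m j (coord_mult j (\<lambda>\<xi>. f (- \<xi>))) + D (partial j (coord_mult j f)) = 0" for j
    using first_order_identity[OF T0_coord_mult[OF f, of j], of j] D_reflect[OF f, of j] by simp
  then have "(\<Sum>j\<in>UNIV. m j (coord_mult j f) - m j (coord_mult j (\<lambda>\<xi>. f (- \<xi>))) + D (partial j (coord_mult j f))) = 0"
    by simp
  then have "D f - D (\<lambda>\<xi>. f (- \<xi>)) + (\<Sum>j\<in>UNIV. D (partial j (coord_mult j f))) = 0"
    by (simp add: D_def sum.distrib sum_subtractf)
  then have *: "2 * D f + (\<Sum>j\<in>UNIV. D (partial j (coord_mult j f))) = 0" unfolding D_odd[OF f] by simp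
  have T: "partial j (coord_mult j f) \<in> T0" for j by (intro T0_partial T0_coord_mult f)
  have Ts: "(\<lambda>\<xi>. \<Sum>j\<in>UNIV. partial j (coord_mult j f) \<xi>) \<in> T0" by (rule T0_sum) (rule T)
  have "D (\<lambda>\<xi>. \<Sum>j\<in>UNIV. partial j (coord_mult j f) \<xi>) = (\<Sum>j\<in>UNIV. D (partial j (coord_mult j f)))"
    by (simp add: sum_2 D_add T)
  then have "D (gen (axis 1 1) f) = (\<Sum>j\<in>UNIV. D (partial j (coord_mult j f))) - 2 * D f"
    unfolding e using D_diff[OF Ts T0_cmult[OF f, of 2]] D_cmult[OF f, of 2] by simp
  then show ?thesis using * by algebra
qed

text \<open>Dilations act on \<open>D\<close> with two competing rates: homogeneity gives
  \<open>exp (- \<kappa> * t)\<close>, while the generator contributes the factor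
  \<open>- 4\<close>. Comparing them over \<open>{0..1}\<close> leaves
  \<open>1 - 4 / \<kappa>\<close> times \<open>D f\<close>, and \<open>\<kappa> < 4\<close> says
  that the degree \<open>2 * \<delta>\<close> is below 2.\<close>

lemma D_zero: assumes f: "f \<in> T0" shows "D f = 0"
proof -
  define \<kappa> where "\<kappa> = 2 + 2 * \<delta>"
  have \<kappa>: "0 < \<kappa>" "\<kappa> < 4" using \<delta> by (auto simp: \<kappa>_def)
  define a :: "real \<Rightarrow> plane" where "a t = exp t *\<^sub>R axis 1 1" for t
  have a: "(a has_vector_derivative cmul (axis 1 1) (a t)) (at t)" for t
    unfolding a_def using cmul_axis_1[of 1]
    by (auto intro!: derivative_eq_intros simp: has_vector_derivative_def)
  have nz: "a t \<noteq> 0" for t by (simp add: a_def)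
  let ?w = "\<lambda>(l::2) (\<xi>::plane). complex_of_real (\<xi> $ l)"
  have sc: "D (\<lambda>\<xi>. g (exp t *\<^sub>R \<xi>)) = of_real (exp (- \<kappa> * t)) * D g" if "g \<in> T0" for g t
    unfolding D_weighted
    by (subst weighted_dilate[OF smooth_coord _ that]) (simp_all add: powr_def \<kappa>_def algebra_simps)
  have "D (\<lambda>\<xi>. f (cmul (a 1) \<xi>)) - D (\<lambda>\<xi>. f (cmul (a 0) \<xi>)) = integral {0..1} (\<lambda>t. D (\<lambda>\<xi>. gen (axis 1 1) f (cmul (a t) \<xi>)))"
    using weighted_flow(2)[OF smooth_coord f _ a nz, of 1] unfolding D_weighted by simp
  then have "of_real (exp (- \<kappa>)) * D f - D f = integral {0..1} (\<lambda>t. of_real (exp (- \<kappa> * t)) * (- 4 * D f))"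
    unfolding a_def cmul_axis_1 sc[OF f] sc[OF T0_gen[OF f]] D_gen[OF f] by simp
  also have "\<dots> = of_real (exp (- \<kappa> * 1) / (- \<kappa>)) * (- 4 * D f) - of_real (exp (- \<kappa> * 0) / (- \<kappa>)) * (- 4 * D f)"
  proof (rule integral_unique, rule fundamental_theorem_of_calculus)
    fix t :: real
    have "((\<lambda>t. exp (- \<kappa> * t) / (- \<kappa>)) has_real_derivative exp (- \<kappa> * t)) (at t within {0..1})"
      using \<kappa> by (auto intro!: derivative_eq_intros)
    then show "((\<lambda>t. of_real (exp (- \<kappa> * t) / (- \<kappa>)) * (- 4 * D f)) has_vector_derivative of_real (exp (- \<kappa> * t)) * (- 4 * D f)) (at t within {0..1})"
      by (intro has_vector_derivative_mult_left has_vector_derivative_of_real)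
        (simp add: has_real_derivative_iff_has_vector_derivative)
  qed simp
  finally have "of_real ((exp (- \<kappa>) - 1) * (1 - 4 / \<kappa>)) * D f = 0"
    using \<kappa> by (simp add: field_simps)
  moreover have "exp (- \<kappa>) - 1 \<noteq> 0" "1 - 4 / \<kappa> \<noteq> 0" using \<kappa> by (auto simp: field_simps)
  ultimately show ?thesis by (metis mult_eq_0_iff of_real_eq_0_iff)
qed

lemma m_odd: "f \<in> T0 \<Longrightarrow> m j (\<lambda>\<xi>. f (- \<xi>)) = - m j f"
  using first_order_identity[of f j] D_zero[OF T0_partial[of f j]] by (simp add: eq_neg_iff_add_eq_0 add.commute)

text \<open>By the product rule the Laplacian of \<open>\<xi>_l f\<close> is
  \<open>\<xi>_l \<Delta>f\<close> plus twice the derivative of \<open>f\<close> in direction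
  \<open>l\<close>. The first terms sum to \<open>D (laplacian f) = 0\<close>, oddness removes the
  reflection, and the second order identity is left with the divergence.\<close>

lemma divergence_free: assumes f: "f \<in> T0" shows "(\<Sum>l\<in>UNIV. m l (partial l f)) = 0"
proof -
  have s: "smooth f" by (rule T0_smooth[OF f])
  have L: "laplacian f \<in> T0" unfolding laplacian_def[abs_def] by (intro T0_sum T0_partial f)
  have lap: "laplacian (coord_mult l f) = (\<lambda>\<xi>. coord_mult l (laplacian f) \<xi> + 2 * partial l f \<xi>)" for l
  proof
    fix \<xi>
    have e: "partial j (coord_mult l f) = (\<lambda>\<xi>. (if l = j then f \<xi> else 0) + coord_mult l (partial j f) \<xi>)" for j
      by (rule ext) (simp add: partial_coord_mult[OF s] coord_mult_def)
    have "smooth (\<lambda>\<xi>. if l = j then f \<xi> else 0)" for j using s by (cases "l = j") (simp_all add: smooth_const)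
    then have "partial j (partial j (coord_mult l f)) \<xi> = (if l = j then partial j f \<xi> else 0) + ((if l = j then partial j f \<xi> else 0) + of_real (\<xi> $ l) * partial j (partial j f) \<xi>)" for j
      unfolding e by (subst partial_add) (auto simp: smooth_differentiable smooth_coord_mult smooth_partial s partial_coord_mult)
    then show "laplacian (coord_mult l f) \<xi> = coord_mult l (laplacian f) \<xi> + 2 * partial l f \<xi>"
      using exhaust_2[of l] by (auto simp: laplacian_def coord_mult_def sum_2 algebra_simps)
  qed
  have T: "laplacian (coord_mult l f) \<in> T0" for l
    unfolding lap by (intro T0_add T0_cmult T0_coord_mult T0_partial L f)
  have "0 = (\<Sum>l\<in>UNIV. m l (laplacian (coord_mult l f)))"
    using second_order_identity[OF f] unfolding m_odd[OF T] by (simp add: sum_negf)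
  also have "\<dots> = (\<Sum>l\<in>UNIV. m l (coord_mult l (laplacian f)) + 2 * m l (partial l f))"
    unfolding lap by (intro sum.cong refl) (simp add: m.add m.cmult T0_cmult T0_coord_mult T0_partial L f)
  also have "\<dots> = D (laplacian f) + 2 * (\<Sum>l\<in>UNIV. m l (partial l f))"
    by (simp add: D_def sum.distrib sum_distrib_left)
  finally show ?thesis using D_zero[OF L] by simp
qed

end

section \<open>Averaging over complex multiplications\<close>

lemma det_cmul: "det (matrix (cmul a)) = (norm a)\<^sup>2"
  unfolding norm_plane_sq by (simp add: det_2 matrix_def axis_def power2_eq_square)

lemma surj_cmul: assumes "a \<noteq> 0" shows "range (cmul a) = UNIV"
proof -
  have "x = cmul a (cmul (cinv a) x)" for x
    unfolding cmul_assoc[symmetric] cmul_cinv[OF assms] using cmul_axis_1[of 1 x] by simp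
  then show ?thesis by blast
qed

lemma integral_cmul:
  fixes F :: "plane \<Rightarrow> complex"
  assumes F: "continuous_on UNIV F" and K: "\<And>x. F x \<noteq> 0 \<Longrightarrow> norm x \<le> R" and a: "a \<noteq> 0"
  shows "(LINT x|lborel. F x) = of_real ((norm a)\<^sup>2) * (LINT x|lborel. F (cmul a x))"
proof -
  \<comment> \<open>The linear change of variables is applied to functions with values in real
    coordinates, so real and imaginary part are packed into a plane vector and unpacked by
    \<open>L\<close>. The Jacobian is the determinant \<open>|a|^2\<close>.\<close>
  define g :: "plane \<Rightarrow> plane" where "g x = (\<chi> i. if i = 1 then Re (F x) else Im (F x))" for x
  define L :: "plane \<Rightarrow> complex" where "L y = of_real (y $ 1) + \<i> * of_real (y $ 2)" for y
  have L: "bounded_linear L" unfolding L_def[abs_def]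
    by (intro bounded_linear_add bounded_linear_compose[OF bounded_linear_of_real bounded_linear_vec_nth]
        bounded_linear_compose[OF bounded_linear_mult_right] )
  have Lg: "L (g x) = F x" for x by (simp add: L_def g_def complex_eq_iff)
  have gF: "F x \<noteq> 0" if "g x \<noteq> 0" for x using that by (auto simp: g_def vec_eq_iff split: if_splits)
  have cg: "continuous_on UNIV g" unfolding g_def
  proof (rule continuous_on_vec_lambda)
    show "continuous_on UNIV (\<lambda>x. if i = 1 then Re (F x) else Im (F x))" for i :: 2
      by (cases "i = 1") (auto intro!: continuous_intros F)
  qed
  have n: "0 < norm a" using a by simp
  have cc: "continuous_on UNIV (cmul a)" by (rule linear_continuous_on[OF bounded_linear_cmul])
  have i1: "integrable lborel g"
    by (rule compact_support_integrable[OF cg compact_cball[of 0 R]]) (use gF K in auto)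
  have i2: "integrable lborel (\<lambda>x. g (cmul a x))"
  proof (rule compact_support_integrable[of _ "cball 0 (R / norm a)"])
    show "continuous_on UNIV (\<lambda>x. g (cmul a x))" by (rule continuous_on_compose2[OF cg cc]) simp
    show "x \<in> cball 0 (R / norm a)" if "g (cmul a x) \<noteq> 0" for x
      using K[OF gF[OF that]] n by (simp add: norm_cmul field_simps)
  qed simp
  have "g absolutely_integrable_on UNIV"
    using i1 borel_measurable_integrable[OF i1] by (simp add: set_integrable_def integrable_completion)
  then have "integral (range (cmul a)) g = \<bar>det (matrix (cmul a))\<bar> *\<^sub>R integral UNIV (g \<circ> cmul a)"
    using surj_cmul[OF a] by (intro integral_change_of_variables_linear bounded_linear.linear bounded_linear_cmul) simp
  then have "(LINT x|lborel. g x) = (norm a)\<^sup>2 *\<^sub>R (LINT x|lborel. g (cmul a x))"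
    using integral_lborel[OF i1] integral_lborel[OF i2] by (simp add: surj_cmul[OF a] det_cmul comp_def)
  then have "L (LINT x|lborel. g x) = (norm a)\<^sup>2 *\<^sub>R L (LINT x|lborel. g (cmul a x))"
    by (simp only: linear_cmul[OF bounded_linear.linear[OF L]])
  then have "(LINT x|lborel. F x) = (norm a)\<^sup>2 *\<^sub>R (LINT x|lborel. F (cmul a x))"
    unfolding integral_bounded_linear[OF L i1, symmetric] integral_bounded_linear[OF L i2, symmetric] Lg .
  then show ?thesis by (simp add: scaleR_conv_of_real)
qed

lemma coord_mult_commute: "coord_mult i (coord_mult j f) = coord_mult j (coord_mult i f)"
  by (simp add: coord_mult_def fun_eq_iff)

context homogeneous_multiplier
begin

text \<open>The component of \<open>m\<close> in the direction \<open>(- \<xi>\<^sub>2, \<xi>\<^sub>1)\<close>, the only one that survives.\<close>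

definition rot_weight :: "2 \<Rightarrow> plane \<Rightarrow> complex" where
  "rot_weight l \<xi> = of_real (if l = 1 then - (\<xi> $ 2) else \<xi> $ 1)"

definition v :: "(plane \<Rightarrow> complex) \<Rightarrow> complex" where
  "v = weighted rot_weight"

lemma smooth_rot_weight: "smooth (rot_weight l)"
proof -
  have "smooth (\<lambda>\<xi>. (-1) * complex_of_real (\<xi> $ 2))" by (intro smooth_mult smooth_const smooth_coord)
  then show ?thesis unfolding rot_weight_def[abs_def] by (cases "l = 1") (simp_all add: smooth_coord)
qed

lemma v_eq: assumes "f \<in> T0" shows "v f = m 2 (coord_mult 1 f) - m 1 (coord_mult 2 f)"
proof -
  have "(\<lambda>\<xi>. rot_weight 1 \<xi> * f \<xi>) = (\<lambda>\<xi>. (-1) * coord_mult 2 f \<xi>)" "(\<lambda>\<xi>. rot_weight 2 \<xi> * f \<xi>) = coord_mult 1 f"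
    by (simp_all add: rot_weight_def coord_mult_def fun_eq_iff)
  then show ?thesis
    unfolding v_def weighted_def using m.cmult[OF T0_coord_mult[OF assms], of 1 "-1" 2] by (simp add: sum_2)
qed

lemma D_zero_pair: "h \<in> T0 \<Longrightarrow> m 2 (coord_mult 2 h) = - m 1 (coord_mult 1 h)"
  using D_zero[of h] by (simp add: D_def sum_2 eq_neg_iff_add_eq_0 add.commute)

text \<open>\<open>divergence_free\<close> is applied to \<open>n\<close>, which is
  \<open>|\<xi>|^2 q\<close>; differentiating the weight contributes \<open>2 D q = 0\<close>. The
  four remaining terms are those of \<open>v (gen (axis 2 1) q)\<close> once
  \<open>D_zero_pair\<close> has traded mixed monomials for squares.\<close>

lemma v_gen_rotation: assumes q: "q \<in> T0" shows "v (gen (axis 2 1) q) = 0"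
proof -
  let ?x = coord_mult and ?d = "\<lambda>l. partial l q"
  have d: "?d l \<in> T0" for l by (rule T0_partial[OF q])
  have T: "?x i (?x j (?d l)) \<in> T0" for i j l by (intro T0_coord_mult d)
  have e: "gen (axis 2 1) q = (\<lambda>\<xi>. ?x 1 (?d 2) \<xi> - ?x 2 (?d 1) \<xi>)"
    by (simp add: gen_def fun_eq_iff sum_2 coord_mult_def axis_def)
  have c: "?x i (gen (axis 2 1) q) = (\<lambda>\<xi>. ?x i (?x 1 (?d 2)) \<xi> - ?x i (?x 2 (?d 1)) \<xi>)" for i
    unfolding e by (simp add: coord_mult_def fun_eq_iff algebra_simps)
  define n where "n = (\<lambda>\<xi>. ?x 1 (?x 1 q) \<xi> + ?x 2 (?x 2 q) \<xi>)"
  have n: "n \<in> T0" unfolding n_def by (intro T0_add T0_coord_mult q)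
  have xx: "partial l (?x i (?x i q)) \<xi> = (if i = l then 2 * ?x i q \<xi> else 0) + ?x i (?x i (?d l)) \<xi>" for i l \<xi>
    using T0_smooth[OF q] by (subst partial_coord_mult[OF smooth_coord_mult]) (auto simp: partial_coord_mult coord_mult_def algebra_simps)
  have pn: "partial l n = (\<lambda>\<xi>. (2 * ?x l q \<xi> + ?x 1 (?x 1 (?d l)) \<xi>) + ?x 2 (?x 2 (?d l)) \<xi>)" for l
    unfolding n_def using T0_smooth[OF q] exhaust_2[of l]
    by (subst partial_add_smooth) (auto simp: smooth_coord_mult xx fun_eq_iff)
  have "m l (partial l n) = 2 * m l (?x l q) + m l (?x 1 (?x 1 (?d l))) + m l (?x 2 (?x 2 (?d l)))" for l
    unfolding pn by (simp add: m.add m.cmult T0_add T0_cmult T0_coord_mult d q)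
  then have "(\<Sum>l\<in>UNIV. 2 * m l (?x l q) + m l (?x 1 (?x 1 (?d l))) + m l (?x 2 (?x 2 (?d l)))) = 0"
    using divergence_free[OF n] by simp
  then have z: "m 1 (?x 1 (?x 1 (?d 1))) + m 1 (?x 2 (?x 2 (?d 1))) + (m 2 (?x 1 (?x 1 (?d 2))) + m 2 (?x 2 (?x 2 (?d 2)))) = 0"
    using D_zero_pair[OF q] by (simp add: sum_2 algebra_simps)
  have "v (gen (axis 2 1) q) = m 2 (?x 1 (?x 1 (?d 2))) - m 2 (?x 1 (?x 2 (?d 1))) - (m 1 (?x 2 (?x 1 (?d 2))) - m 1 (?x 2 (?x 2 (?d 1))))"
    unfolding v_eq[OF T0_gen[OF q]] c by (simp add: m.diff T)
  also have "m 2 (?x 1 (?x 2 (?d 1))) = - m 1 (?x 1 (?x 1 (?d 1)))"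
    using D_zero_pair[OF T0_coord_mult[OF d], of 1 1] by (simp add: coord_mult_commute[of 1 2])
  also have "m 1 (?x 2 (?x 1 (?d 2))) = - m 2 (?x 2 (?x 2 (?d 2)))"
    using D_zero_pair[OF T0_coord_mult[OF d], of 2 2] by (simp add: coord_mult_commute[of 2 1])
  finally show ?thesis using z by (simp add: algebra_simps)
qed

text \<open>Polar decomposition of \<open>a\<close>: along the rotation curve the derivative
  vanishes by \<open>v_gen_rotation\<close>, applied to the rotated test function, and the modulus
  is handled by \<open>weighted_dilate\<close>.\<close>

lemma v_cmul:
  assumes f: "f \<in> T0" and a: "a \<noteq> 0"
  shows "v (\<lambda>\<xi>. f (cmul a \<xi>)) = of_real (norm a powr (- 2 - 2 * \<delta>)) * v f"
proof -
  define s where "s = norm a"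
  have s: "s > 0" using a by (simp add: s_def)
  have "(a $ 1 / s)\<^sup>2 + (a $ 2 / s)\<^sup>2 = (norm a)\<^sup>2 / s\<^sup>2"
    by (simp add: norm_plane_sq power_divide add_divide_distrib)
  also have "\<dots> = 1" using s by (simp add: s_def)
  finally obtain T where T: "0 \<le> T" "a $ 1 / s = cos T" "a $ 2 / s = sin T" using sincos_total_2pi_le by blast
  \<comment> \<open>The unit circle as a curve, generated by \<open>axis 2 1\<close>, the imaginary
    unit.\<close>
  define p :: "real \<Rightarrow> plane" where "p t = cos t *\<^sub>R axis 1 1 + sin t *\<^sub>R axis 2 1" for t
  have p12: "p t $ 1 = cos t" "p t $ 2 = sin t" for t by (simp_all add: p_def axis_def)
  have pT: "a = s *\<^sub>R p T" using T s by (simp add: plane_eq_iff p12 field_simps)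
  have nz: "p t \<noteq> 0" for t
  proof
    assume "p t = 0"
    then have "cos t = 0" "sin t = 0" using p12[of t] by auto
    then show False using sin_cos_squared_add[of t] by simp
  qed
  have dp: "(p has_vector_derivative cmul (axis 2 1) (p t)) (at t)" for t
  proof -
    have "(p has_vector_derivative (- sin t) *\<^sub>R axis 1 1 + cos t *\<^sub>R axis 2 1) (at t)"
      unfolding p_def has_vector_derivative_def by (auto intro!: derivative_eq_intros simp: algebra_simps)
    also have "(- sin t) *\<^sub>R axis 1 1 + cos t *\<^sub>R axis 2 1 = cmul (axis 2 1) (p t)"
      by (simp add: plane_eq_iff p12 axis_def)
    finally show ?thesis .
  qed
  have "v (\<lambda>\<xi>. gen (axis 2 1) f (cmul (p t) \<xi>)) = 0" for t
  proof -
    have "gen (axis 2 1) (\<lambda>\<xi>. f (cmul (p t) \<xi>)) = (\<lambda>\<xi>. gen (axis 2 1) f (cmul (p t) \<xi>))"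
      by (rule ext) (rule gen_cmul[OF T0_smooth[OF f]])
    then show ?thesis using v_gen_rotation[OF T0_cmul[OF f nz], of t] by simp
  qed
  then have "v (\<lambda>\<xi>. f (cmul (p T) \<xi>)) = v (\<lambda>\<xi>. f (cmul (p 0) \<xi>))"
    using weighted_flow(2)[where w=rot_weight, OF smooth_rot_weight f T(1) dp nz] by (simp add: v_def)
  also have "p 0 = 1 *\<^sub>R axis 1 1" by (simp add: p_def)
  finally have rot: "v (\<lambda>\<xi>. f (cmul (p T) \<xi>)) = v f" unfolding cmul_axis_1 by simp
  have "(\<lambda>\<xi>. f (cmul a \<xi>)) = (\<lambda>\<xi>. (\<lambda>\<eta>. f (cmul (p T) \<eta>)) (s *\<^sub>R \<xi>))"
    unfolding pT by (simp add: bounded_bilinear.scaleR_left[OF bounded_bilinear_cmul] bounded_bilinear.scaleR_right[OF bounded_bilinear_cmul])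
  then have "v (\<lambda>\<xi>. f (cmul a \<xi>)) = weighted rot_weight (\<lambda>\<xi>. (\<lambda>\<eta>. f (cmul (p T) \<eta>)) (s *\<^sub>R \<xi>))" by (simp add: v_def)
  also have "\<dots> = of_real (s powr (- 2 - 2 * \<delta>)) * weighted rot_weight (\<lambda>\<eta>. f (cmul (p T) \<eta>))"
    by (rule weighted_dilate[OF smooth_rot_weight _ T0_cmul[OF f nz] s]) (simp add: rot_weight_def)
  finally show ?thesis using rot by (simp add: v_def s_def)
qed

text \<open>\<open>b\<close> has bounded support, so \<open>b (cinv \<eta>)\<close> vanishes for
  small nonzero \<open>\<eta>\<close>; at 0 itself the power of the norm is 0. The product is thus
  zero near the origin, where inversion and power are singular.\<close>

lemma continuous_inversion:
  assumes b: "b \<in> T0"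
  shows "continuous_on UNIV (\<lambda>\<eta>. b (cinv \<eta>) * of_real (norm \<eta> powr s))"
proof -
  obtain r R where f: "0 < r" "r \<le> R" "\<And>\<xi>. b \<xi> \<noteq> 0 \<Longrightarrow> \<xi> \<in> annulus r R" using T0E[OF b] by blast
  let ?c = "\<lambda>\<eta>. b (cinv \<eta>) * of_real (norm \<eta> powr s)"
  have ci: "continuous_on (- {0}) cinv"
    unfolding cinv_def
  proof (intro continuous_on_scaleR continuous_on_vec_lambda)
    show "continuous_on (- {0}) (\<lambda>a::plane. 1 / (norm a)\<^sup>2)" by (intro continuous_intros) auto
    show "continuous_on (- {0}) (\<lambda>a::plane. if i = 1 then a $ 1 else - a $ 2)" for i :: 2
      by (cases "i = 1") (auto intro!: continuous_intros)
  qed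
  have "continuous_on (- {0}) ?c"
    by (intro continuous_on_mult continuous_on_of_real continuous_on_powr continuous_on_compose2[OF smooth_continuous[OF T0_smooth[OF b], of UNIV] ci]
        continuous_on_norm continuous_on_id continuous_on_const) auto
  moreover have "continuous_on (ball 0 (1 / R)) ?c"
  proof -
    have "?c \<eta> = 0" if "\<eta> \<in> ball 0 (1 / R)" for \<eta>
    proof (cases "\<eta> = 0")
      case False
      have "norm (cinv \<eta>) > R" using that False f by (simp add: norm_cinv field_simps)
      then have "b (cinv \<eta>) = 0" using f(3)[of "cinv \<eta>"] by (force simp: annulus_def)
      then show ?thesis by simp
    qed simp
    then show ?thesis by (rule continuous_on_cong[THEN iffD2, OF refl]) simp_all
  qed
  ultimately have "continuous_on (- {0} \<union> ball 0 (1 / R)) ?c"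
    by (intro continuous_on_open_Un) auto
  moreover have "- {0} \<union> ball 0 (1 / R) = (UNIV :: plane set)" using f by auto
  ultimately show ?thesis by simp
qed

text \<open>Both sides are the value of \<open>v\<close> at the multiplicative convolution
  \<open>\<xi> \<mapsto> \<integral> f (\<eta> \<xi>) b (1 / \<eta>) |\<eta>|\<^sup>-\<^sup>2 d\<eta> = \<integral> f \<zeta> b (\<xi> / \<zeta>) |\<zeta>|\<^sup>-\<^sup>2 d\<zeta>\<close>, written with complex products.\<close>

lemma averaging:
  assumes f: "f \<in> T0" and b: "b \<in> T0"
  shows "v f * (LINT \<eta>|lborel. b (cinv \<eta>) * of_real (norm \<eta> powr (- 4 - 2 * \<delta>)))
    = v b * (LINT \<zeta>|lborel. f \<zeta> * of_real (norm \<zeta> powr (2 * \<delta>)))"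
proof -
  obtain r R where f': "0 < r" "r \<le> R" "\<And>\<xi>. f \<xi> \<noteq> 0 \<Longrightarrow> \<xi> \<in> annulus r R" using T0E[OF f] by blast
  obtain s S where b': "0 < s" "s \<le> S" "\<And>\<xi>. b \<xi> \<noteq> 0 \<Longrightarrow> \<xi> \<in> annulus s S" using T0E[OF b] by blast
  have RS: "R > 0" "S > 0" using f' b' by auto
  have f0: "f 0 = 0" and b0: "b 0 = 0" using f'(3)[of 0] f'(1) b'(3)[of 0] b'(1) by (auto simp: annulus_def)
  obtain k :: plane where box: "cball 0 (max R (1 / s)) \<subseteq> cbox (- k) k"
    using bounded_subset_cbox_symmetric[OF bounded_cball] by metis
  \<comment> \<open>The factor \<open>norm \<eta> powr - 2\<close> is the density of the invariant
    measure of the multiplicative group.\<close>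
  define c where "c \<eta> = b (cinv \<eta>) * of_real (norm \<eta> powr - 2)" for \<eta>
  have cc: "continuous_on UNIV c" unfolding c_def by (rule continuous_inversion[OF b])
  have c_ann: "1 / S \<le> norm \<eta> \<and> norm \<eta> \<le> 1 / s" if "c \<eta> \<noteq> 0" for \<eta>
  proof -
    have "b (cinv \<eta>) \<noteq> 0" using that by (auto simp: c_def)
    from b'(3)[OF this] b'(1) have "s \<le> 1 / norm \<eta>" "1 / norm \<eta> \<le> S" "\<eta> \<noteq> 0"
      by (auto simp: annulus_def norm_cinv)
    then show ?thesis using b' RS by (simp add: field_simps)
  qed
  define H1 where "H1 \<eta> \<xi> = c \<eta> * f (cmul \<eta> \<xi>)" for \<eta> \<xi>
  \<comment> \<open>Agrees with \<open>cinv\<close> wherever \<open>f\<close> is nonzero; the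
    maximum removes the singularity at the origin, so that the second family is continuous in
    \<open>\<zeta>\<close> on the whole box.\<close>
  define d :: "plane \<Rightarrow> plane" where "d \<zeta> = (1 / (max (norm \<zeta>) r)\<^sup>2) *\<^sub>R (\<chi> i. if i = 1 then \<zeta> $ 1 else - \<zeta> $ 2)" for \<zeta>
  have d: "d \<zeta> = cinv \<zeta>" if "r \<le> norm \<zeta>" for \<zeta> using that by (simp add: d_def cinv_def max_def)
  have cd: "continuous_on A d" for A
    unfolding d_def
  proof (intro continuous_on_scaleR continuous_on_vec_lambda)
    show "continuous_on A (\<lambda>a::plane. 1 / (max (norm a) r)\<^sup>2)" using f'(1) by (intro continuous_intros) (auto simp: max_def)
    show "continuous_on A (\<lambda>a::plane. if i = 1 then a $ 1 else - a $ 2)" for i :: 2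
      by (cases "i = 1") (auto intro!: continuous_intros)
  qed
  define g where "g \<zeta> = f \<zeta> / of_real ((norm \<zeta>)\<^sup>2)" for \<zeta>
  have g: "g \<in> T0" unfolding g_def[abs_def] by (rule T0_over_norm_sq[OF cutoff f])
  define H2 where "H2 \<zeta> \<xi> = g \<zeta> * b (cmul (d \<zeta>) \<xi>)" for \<zeta> \<xi>
  have g_ann: "r \<le> norm \<zeta> \<and> norm \<zeta> \<le> R" if "g \<zeta> \<noteq> 0" for \<zeta>
    using that f'(3)[of \<zeta>] by (auto simp: g_def annulus_def)
  have p1: "psm A H1" for A unfolding H1_def[abs_def]
    by (intro psm_mult psm_param psm_cmul continuous_on_subset[OF cc] T0_smooth[OF f] continuous_on_id) simp
  have p2: "psm A H2" for A unfolding H2_def[abs_def]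
    by (intro psm_mult psm_param psm_cmul smooth_continuous[OF T0_smooth[OF g]] T0_smooth[OF b] cd)
  have a1: "annular A H1 (r * s) (R * S)" for A
    unfolding annular_def
  proof (intro ballI allI impI)
    fix \<eta> \<xi> assume "H1 \<eta> \<xi> \<noteq> 0"
    then have "c \<eta> \<noteq> 0" "f (cmul \<eta> \<xi>) \<noteq> 0" by (auto simp: H1_def)
    from c_ann[OF this(1)] f'(3)[OF this(2)]
    have n: "1 \<le> S * norm \<eta>" "s * norm \<eta> \<le> 1" "r \<le> norm \<eta> * norm \<xi>" "norm \<eta> * norm \<xi> \<le> R"
      using b' RS by (simp_all add: annulus_def norm_cmul field_simps)
    have "r * s \<le> (norm \<eta> * norm \<xi>) * s" using n(3) b'(1) by (intro mult_right_mono) auto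
    also have "\<dots> = (s * norm \<eta>) * norm \<xi>" by simp
    also have "\<dots> \<le> 1 * norm \<xi>" using n(2) by (intro mult_right_mono) auto
    finally have 1: "r * s \<le> norm \<xi>" by simp
    have "1 * norm \<xi> \<le> (S * norm \<eta>) * norm \<xi>" using n(1) by (intro mult_right_mono) auto
    also have "\<dots> = (norm \<eta> * norm \<xi>) * S" by simp
    also have "\<dots> \<le> R * S" using n(4) RS by (intro mult_right_mono) auto
    finally show "\<xi> \<in> annulus (r * s) (R * S)" using 1 by (simp add: annulus_def)
  qed
  have a2: "annular A H2 (r * s) (R * S)" for A
    unfolding annular_def
  proof (intro ballI allI impI)
    fix \<zeta> \<xi> assume "H2 \<zeta> \<xi> \<noteq> 0"
    then have nz: "g \<zeta> \<noteq> 0" "b (cmul (d \<zeta>) \<xi>) \<noteq> 0" by (auto simp: H2_def)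
    from g_ann[OF nz(1)] have n: "r \<le> norm \<zeta>" "norm \<zeta> \<le> R" by auto
    from b'(3)[OF nz(2)] have "s \<le> norm \<xi> / norm \<zeta>" "norm \<xi> / norm \<zeta> \<le> S"
      by (simp_all add: annulus_def norm_cmul d[OF n(1)] norm_cinv)
    moreover have "0 < norm \<zeta>" using n f'(1) by linarith
    ultimately have n': "s * norm \<zeta> \<le> norm \<xi>" "norm \<xi> \<le> S * norm \<zeta>" by (simp_all add: field_simps)
    have "r * s \<le> s * norm \<zeta>" "S * norm \<zeta> \<le> R * S"
      using n b'(1) RS mult_right_mono[of r "norm \<zeta>" s] mult_right_mono[of "norm \<zeta>" R S] by (simp_all add: mult.commute)
    with n' show "\<xi> \<in> annulus (r * s) (R * S)" by (simp add: annulus_def)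
  qed
  have rs: "0 < r * s" using f' b' by simp
  note W1 = weighted_box_integral[where w=rot_weight and a="- k" and b=k, OF smooth_rot_weight p1 rs a1, folded v_def]
  note W2 = weighted_box_integral[where w=rot_weight and a="- k" and b=k, OF smooth_rot_weight p2 rs a2, folded v_def]
  have v0: "v (\<lambda>\<xi>. 0) = 0" by (simp add: v_def weighted_def m.zero)
  \<comment> \<open>The exponent is \<open>- 2 - 2 * \<delta>\<close> from \<open>v_cmul\<close>
    plus \<open>- 2\<close> from the invariant density.\<close>
  have v1: "v (H1 \<eta>) = b (cinv \<eta>) * of_real (norm \<eta> powr (- 4 - 2 * \<delta>)) * v f" for \<eta>
  proof (cases "\<eta> = 0")
    case True
    then have "H1 \<eta> = (\<lambda>\<xi>. 0)" by (simp add: H1_def fun_eq_iff c_def)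
    then show ?thesis using True by (simp add: v0)
  next
    case False
    have "v (H1 \<eta>) = c \<eta> * v (\<lambda>\<xi>. f (cmul \<eta> \<xi>))"
      unfolding v_def H1_def[abs_def] by (rule weighted_cmult[OF smooth_rot_weight T0_cmul[OF f False]])
    moreover have "norm \<eta> powr (- 4 - 2 * \<delta>) = norm \<eta> powr - 2 * norm \<eta> powr (- 2 - 2 * \<delta>)"
      by (simp add: powr_add[symmetric])
    ultimately show ?thesis unfolding v_cmul[OF f False] by (simp add: c_def)
  qed
  \<comment> \<open>The inverse multiplier contributes \<open>2 + 2 * \<delta>\<close>, which the
    invariant density inside \<open>g\<close> lowers to \<open>2 * \<delta>\<close>.\<close>
  have v2: "v (H2 \<zeta>) = v b * (f \<zeta> * of_real (norm \<zeta> powr (2 * \<delta>)))" for \<zeta>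
  proof (cases "g \<zeta> = 0")
    case True
    then have "H2 \<zeta> = (\<lambda>\<xi>. 0)" "f \<zeta> = 0" using f0 by (auto simp: H2_def fun_eq_iff g_def)
    then show ?thesis by (simp add: v0)
  next
    case False
    then have n: "r \<le> norm \<zeta>" "0 < norm \<zeta>" using g_ann[OF False] f'(1) by auto
    have nd: "norm (d \<zeta>) = 1 / norm \<zeta>" by (simp add: d[OF n(1)] norm_cinv)
    then have "norm (d \<zeta>) > 0" using n by simp
    then have dz: "d \<zeta> \<noteq> 0" by auto
    have "v (H2 \<zeta>) = g \<zeta> * v (\<lambda>\<xi>. b (cmul (d \<zeta>) \<xi>))"
      unfolding v_def H2_def[abs_def] by (rule weighted_cmult[OF smooth_rot_weight T0_cmul[OF b dz]])
    also have "\<dots> = g \<zeta> * (of_real ((1 / norm \<zeta>) powr (- 2 - 2 * \<delta>)) * v b)" unfolding v_cmul[OF b dz] nd ..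
    also have "(1 / norm \<zeta>) powr (- 2 - 2 * \<delta>) = norm \<zeta> powr (2 * \<delta>) * (norm \<zeta>)\<^sup>2"
    proof -
      have "(1 / norm \<zeta>) powr (- 2 - 2 * \<delta>) = inverse (norm \<zeta> powr (- 2 - 2 * \<delta>))"
        by (simp add: powr_divide inverse_eq_divide)
      also have "\<dots> = norm \<zeta> powr (- (- 2 - 2 * \<delta>))" by (rule powr_minus[symmetric])
      also have "- (- 2 - 2 * \<delta>) = 2 * \<delta> + 2" by simp
      also have "norm \<zeta> powr (2 * \<delta> + 2) = norm \<zeta> powr (2 * \<delta>) * (norm \<zeta>)\<^sup>2"
        using n(2) by (simp add: powr_add)
      finally show ?thesis .
    qed
    finally show ?thesis using n by (simp add: g_def)
  qed
  have out1: "H1 \<eta> = (\<lambda>\<xi>. 0)" if "\<eta> \<notin> cbox (- k) k" for \<eta>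
    using that c_ann[of \<eta>] box by (force simp: H1_def subset_iff)
  have out2: "H2 \<zeta> = (\<lambda>\<xi>. 0)" if "\<zeta> \<notin> cbox (- k) k" for \<zeta>
    using that g_ann[of \<zeta>] box by (force simp: H2_def subset_iff)
  have "integral (cbox (- k) k) (\<lambda>\<eta>. H1 \<eta> \<xi>) = integral (cbox (- k) k) (\<lambda>\<zeta>. H2 \<zeta> \<xi>)" for \<xi>
  proof -
    have cp: "continuous_on (cbox (- k) k) (\<lambda>p. (p, \<xi>))"
      by (intro continuous_on_Pair continuous_on_id continuous_on_const)
    have c1: "continuous_on (cbox (- k) k) (\<lambda>\<eta>. H1 \<eta> \<xi>)" and c2: "continuous_on (cbox (- k) k) (\<lambda>\<zeta>. H2 \<zeta> \<xi>)"
      using continuous_on_compose2[OF psm_continuous[OF p1, of UNIV] cp]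
        continuous_on_compose2[OF psm_continuous[OF p2, of UNIV] cp] by auto
    have L1: "integral (cbox (- k) k) (\<lambda>\<eta>. H1 \<eta> \<xi>) = (LINT \<eta>|lborel. H1 \<eta> \<xi>)"
      by (rule lebesgue_eq_box_integral(2)[OF c1, symmetric]) (simp add: out1)
    have L2: "integral (cbox (- k) k) (\<lambda>\<zeta>. H2 \<zeta> \<xi>) = (LINT \<zeta>|lborel. H2 \<zeta> \<xi>)"
      by (rule lebesgue_eq_box_integral(2)[OF c2, symmetric]) (simp add: out2)
    show ?thesis
    proof (cases "\<xi> = 0")
      case True
      have "cmul x 0 = 0" for x by (simp add: plane_eq_iff)
      then have "H1 \<eta> \<xi> = 0" "H2 \<zeta> \<xi> = 0" for \<eta> \<zeta> using True f0 b0 by (simp_all add: H1_def H2_def)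
      then show ?thesis by simp
    next
      case False
      then have n: "norm \<xi> > 0" by simp
      \<comment> \<open>The substitution \<open>\<zeta> = \<eta> \<xi>\<close> carries one integrand
        into the other; the invariant density compensates its Jacobian
        \<open>|\<xi>|^2\<close>.\<close>
      define G where "G \<zeta> = f \<zeta> * c (cmul (cinv \<xi>) \<zeta>)" for \<zeta>
      have one: "cmul (axis 1 1) y = y" for y using cmul_axis_1[of 1 y] by simp
      have G1: "G (cmul \<xi> \<eta>) = H1 \<eta> \<xi>" for \<eta>
      proof -
        have "cmul (cinv \<xi>) (cmul \<xi> \<eta>) = \<eta>"
          by (simp add: cmul_assoc[symmetric] cmul_commute[of "cinv \<xi>"] cmul_cinv[OF False] one)
        then show ?thesis by (simp add: G_def H1_def cmul_commute[of \<xi>])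
      qed
      have G2: "G \<zeta> = of_real ((norm \<xi>)\<^sup>2) * H2 \<zeta> \<xi>" for \<zeta>
      proof (cases "f \<zeta> = 0")
        case nz: False
        then have r: "r \<le> norm \<zeta>" using f'(3) by (auto simp: annulus_def)
        then have z: "\<zeta> \<noteq> 0" using f'(1) by auto
        have "norm (cinv \<xi>) > 0" using norm_cinv[of \<xi>] n by simp
        then have ix: "cinv \<xi> \<noteq> 0" by auto
        have cc: "cinv (cinv \<xi>) = \<xi>"
        proof -
          have "cinv (cinv \<xi>) = cmul (cmul \<xi> (cinv \<xi>)) (cinv (cinv \<xi>))" by (simp add: cmul_cinv[OF False] one)
          also have "\<dots> = cmul \<xi> (axis 1 1)" by (simp add: cmul_assoc cmul_cinv[OF ix])
          also have "\<dots> = \<xi>" by (simp add: cmul_commute[of \<xi>] one)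
          finally show ?thesis .
        qed
        have "cinv (cmul (cinv \<xi>) \<zeta>) = cmul (d \<zeta>) \<xi>"
          by (simp add: cinv_cmul[OF ix z] cc d[OF r] cmul_commute[of \<xi>])
        moreover have "norm (cmul (cinv \<xi>) \<zeta>) powr - 2 = (norm \<xi>)\<^sup>2 / (norm \<zeta>)\<^sup>2"
        proof -
          have "norm (cmul (cinv \<xi>) \<zeta>) powr - 2 = inverse ((norm \<zeta> / norm \<xi>) powr 2)"
            by (simp add: norm_cmul norm_cinv powr_minus)
          also have "\<dots> = inverse ((norm \<zeta> / norm \<xi>)\<^sup>2)" by simp
          finally show ?thesis by (simp add: power_divide)
        qed
        ultimately show ?thesis by (simp add: G_def c_def H2_def g_def)
      qed (simp add: G_def H2_def g_def)
      have cG: "continuous_on UNIV G"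
        unfolding G_def
        by (intro continuous_on_mult smooth_continuous[OF T0_smooth[OF f]] continuous_on_compose2[OF cc linear_continuous_on[OF bounded_linear_cmul]]) simp
      have "(LINT \<zeta>|lborel. G \<zeta>) = of_real ((norm \<xi>)\<^sup>2) * (LINT \<eta>|lborel. G (cmul \<xi> \<eta>))"
        by (rule integral_cmul[OF cG _ False, of R]) (use f'(3) in \<open>auto simp: G_def annulus_def\<close>)
      then have "of_real ((norm \<xi>)\<^sup>2) * (LINT \<zeta>|lborel. H2 \<zeta> \<xi>) = of_real ((norm \<xi>)\<^sup>2) * (LINT \<eta>|lborel. H1 \<eta> \<xi>)"
        unfolding G1 unfolding G2 by (simp only: integral_mult_right_zero)
      then show ?thesis unfolding L1 L2 using n by simp
    qed
  qed
  then have "integral (cbox (- k) k) (\<lambda>\<eta>. v (H1 \<eta>)) = integral (cbox (- k) k) (\<lambda>\<zeta>. v (H2 \<zeta>))"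
    using W1(2) W2(2) by simp
  moreover have "integral (cbox (- k) k) (\<lambda>\<eta>. v (H1 \<eta>)) = (LINT \<eta>|lborel. v (H1 \<eta>))"
    by (rule lebesgue_eq_box_integral(2)[OF W1(1), symmetric]) (simp add: out1 v0)
  moreover have "integral (cbox (- k) k) (\<lambda>\<zeta>. v (H2 \<zeta>)) = (LINT \<zeta>|lborel. v (H2 \<zeta>))"
    by (rule lebesgue_eq_box_integral(2)[OF W2(1), symmetric]) (simp add: out2 v0)
  ultimately show ?thesis unfolding v1 v2 by (simp add: mult.commute)
qed


text \<open>A tangential field is its component \<open>v\<close> times the rotated position divided
  by \<open>|\<xi>|^2\<close>. Weakly, \<open>f\<close> is split as
  \<open>\<xi>_1^2 g + \<xi>_2^2 g\<close>, and \<open>D_zero_pair\<close> moves one of the two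
  parts to the other component of \<open>m\<close>.\<close>

lemma recover:
  assumes f: "f \<in> T0"
  defines "g \<equiv> \<lambda>\<xi>. f \<xi> / of_real ((norm \<xi>)\<^sup>2)"
  shows "m 1 f = - v (coord_mult 2 g)" "m 2 f = v (coord_mult 1 g)"
proof -
  have g: "g \<in> T0" unfolding g_def by (rule T0_over_norm_sq[OF cutoff f])
  obtain r R where "0 < r" "\<And>\<xi>. f \<xi> \<noteq> 0 \<Longrightarrow> \<xi> \<in> annulus r R" using T0E[OF f] by blast
  then have "f 0 = 0" by (force simp: annulus_def)
  then have fg: "f \<xi> = of_real ((norm \<xi>)\<^sup>2) * g \<xi>" for \<xi> by (cases "\<xi> = 0") (simp_all add: g_def)
  have fe: "f = (\<lambda>\<xi>. coord_mult 1 (coord_mult 1 g) \<xi> + coord_mult 2 (coord_mult 2 g) \<xi>)"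
    using fg[unfolded norm_plane_sq] by (simp add: fun_eq_iff coord_mult_def power2_eq_square algebra_simps)
  have T: "coord_mult i (coord_mult j g) \<in> T0" "coord_mult j g \<in> T0" for i j by (intro T0_coord_mult g)+
  have mf: "m l f = m l (coord_mult 1 (coord_mult 1 g)) + m l (coord_mult 2 (coord_mult 2 g))" for l
    by (subst fe) (rule m.add[OF T(1) T(1)])
  show "m 1 f = - v (coord_mult 2 g)"
    unfolding v_eq[OF T(2)] mf using D_zero_pair[OF T(2), of 1] by (simp add: coord_mult_commute[of 1 2])
  show "m 2 f = v (coord_mult 1 g)"
    unfolding v_eq[OF T(2)] mf using D_zero_pair[OF T(2), of 2] by (simp add: coord_mult_commute[of 2 1])
qed

text \<open>On real \<open>f\<close> a reflection conjugates the value by the reality condition and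
  changes its sign by \<open>m_odd\<close>; the value is therefore imaginary.\<close>

lemma Re_m_real:
  assumes "f \<in> T0" "\<And>\<xi>. cnj (f \<xi>) = f \<xi>"
  shows "Re (m l f) = 0"
proof -
  have "m l (\<lambda>\<xi>. f (- \<xi>)) = cnj (m l (\<lambda>\<xi>. cnj (f \<xi>)))"
    using reality[of l] assms(1) unfolding reality_condition_def by (rule bspec)
  then have "- m l f = cnj (m l f)" using m_odd[OF assms(1)] assms(2) by simp
  then have "- Re (m l f) = Re (m l f)" by (metis complex_cnj(1) uminus_complex.sel(1) complex.sel(1) cnj.sel(1))
  then show ?thesis by simp
qed

text \<open>The integrand is continuous, nonnegative, and positive at \<open>axis 1 1\<close>, the
  complex number 1, which inversion fixes and where the power of the norm is 1.\<close>

lemma inversion_integral_nonzero: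
  assumes b: "b \<in> T0" "\<And>\<xi>. b \<xi> = of_real (Re (b \<xi>))" "\<And>\<xi>. 0 \<le> Re (b \<xi>)" "b (axis 1 1) \<noteq> 0"
  obtains K where "K \<noteq> 0" "(LINT \<eta>|lborel. b (cinv \<eta>) * of_real (norm \<eta> powr s)) = complex_of_real K"
proof -
  define F where "F \<eta> = Re (b (cinv \<eta>)) * norm \<eta> powr s" for \<eta>
  have e: "b (cinv \<eta>) * of_real (norm \<eta> powr s) = of_real (F \<eta>)" for \<eta>
    by (subst b(2)) (simp add: F_def)
  have c: "continuous_on UNIV (\<lambda>\<eta>. complex_of_real (F \<eta>))"
    using continuous_inversion[OF b(1), of s] unfolding e .
  have cF: "continuous_on UNIV F" using continuous_on_Re[OF c] by simp
  obtain r R where f: "0 < r" "r \<le> R" "\<And>\<xi>. b \<xi> \<noteq> 0 \<Longrightarrow> \<xi> \<in> annulus r R" using T0E[OF b(1)] by blast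
  \<comment> \<open>The radius \<open>1 / r\<close> covers the support after inversion; the 1 puts
    the unit ball inside, so that the box contains \<open>axis 1 1\<close> and has nonempty
    interior.\<close>
  obtain k :: plane where box: "cball 0 (max 1 (1 / r)) \<subseteq> cbox (- k) k"
    using bounded_subset_cbox_symmetric[OF bounded_cball] by metis
  have out: "F \<eta> = 0" if "\<eta> \<notin> cbox (- k) k" for \<eta>
  proof -
    have "norm \<eta> > 1 / r" using that box by (force simp: subset_iff not_le)
    moreover have "0 < 1 / r" using f(1) by simp
    then have "0 < norm \<eta>" using calculation by linarith
    ultimately have "1 / norm \<eta> < r" using f(1) by (simp add: field_simps)
    then have "b (cinv \<eta>) = 0" using f(3)[of "cinv \<eta>"] by (force simp: annulus_def norm_cinv)
    then show ?thesis by (simp add: F_def)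
  qed
  have one: "axis 1 1 \<in> cbox (- k) k" using box by (auto simp: subset_iff norm_axis_1)
  have ne: "box (- k) k \<noteq> {}"
  proof -
    have "- (k \<bullet> i) < k \<bullet> i" if i: "i \<in> Basis" for i
    proof -
      have "i \<in> cbox (- k) k" using box i by (auto simp: subset_iff)
      then have "i \<bullet> i \<le> k \<bullet> i" using i by (auto simp: mem_box)
      then have "1 \<le> k \<bullet> i" using i by simp
      then show ?thesis by linarith
    qed
    then show ?thesis by (simp add: box_ne_empty)
  qed
  have i: "integrable lborel (\<lambda>\<eta>. complex_of_real (F \<eta>))"
    by (rule lebesgue_eq_box_integral(1)[OF continuous_on_subset[OF c], of "- k" k]) (simp_all add: out)
  have iF: "F integrable_on cbox (- k) k" by (rule integrable_continuous[OF continuous_on_subset[OF cF]]) simp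
  have "(LINT \<eta>|lborel. complex_of_real (F \<eta>)) = integral (cbox (- k) k) (\<lambda>\<eta>. complex_of_real (F \<eta>))"
    by (rule lebesgue_eq_box_integral(2)[OF continuous_on_subset[OF c]]) (simp_all add: out)
  also have "\<dots> = complex_of_real (integral (cbox (- k) k) F)"
    using integral_linear[OF iF bounded_linear_of_real] by (simp add: comp_def)
  finally have K: "(LINT \<eta>|lborel. b (cinv \<eta>) * of_real (norm \<eta> powr s)) = complex_of_real (integral (cbox (- k) k) F)"
    unfolding e .
  have "integral (cbox (- k) k) F \<noteq> 0"
  proof
    assume "integral (cbox (- k) k) F = 0"
    then have "(F has_integral 0) (cbox (- k) k)" using integrable_integral[OF iF] by simp
    moreover have "continuous_on (cbox (- k) k) F" by (rule continuous_on_subset[OF cF]) simp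
    moreover have "0 \<le> F x" for x by (simp add: F_def b(3))
    ultimately have "F (axis 1 1) = 0" using has_integral_0_cbox_imp_0[OF _ _ _ ne one] by blast
    moreover have "cinv (axis 1 1) = axis 1 1" unfolding plane_eq_iff cinv_nth norm_axis_1 by (simp add: axis_def)
    ultimately have "Re (b (axis 1 1)) = 0" by (simp add: F_def norm_axis_1)
    then show False using b(2)[of "axis 1 1"] b(4) by simp
  qed
  then show thesis using K that by blast
qed

text \<open>\<open>averaging\<close> against one fixed \<open>b\<close> determines \<open>v\<close>
  on every test function: it is integration against a multiple of
  \<open>|\<xi>|^(2 \<delta>)\<close>. Then \<open>recover\<close> restores the two components of
  \<open>m\<close>.\<close>

lemma multiple_of_msqg:
  "\<exists>c::real. \<forall>l. dist_eq_on (- {0}) (m l) (dist_of (\<lambda>\<xi>. of_real c * msqg_mult \<delta> l \<xi>))"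
proof -
  obtain w where w: "w \<in> T0" "\<And>\<xi>. w (- \<xi>) = w \<xi>" "\<And>\<xi>. cnj (w \<xi>) = w \<xi>"
    "\<And>\<xi>. 1 / 2 < norm \<xi> \<Longrightarrow> norm \<xi> < 2 * 1 \<Longrightarrow> w \<xi> = 1" by (rule even_real_cutoff[OF cutoff, of 1 1]) auto
  \<comment> \<open>Squaring the real cutoff makes it nonnegative, so that the normalizing integral
    cannot vanish.\<close>
  define b where "b \<xi> = w \<xi> * w \<xi>" for \<xi>
  have b: "b \<in> T0" unfolding b_def[abs_def] by (rule T0_mult[OF w(1) T0_smooth[OF w(1)]])
  have wr: "w \<xi> = of_real (Re (w \<xi>))" for \<xi> using w(3)[of \<xi>] by (simp add: complex_eq_iff)
  have br: "b \<xi> = of_real ((Re (w \<xi>))\<^sup>2)" for \<xi> unfolding b_def by (subst (1 2) wr) (simp add: power2_eq_square)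
  have b1: "b (axis 1 1) \<noteq> 0" using w(4)[of "axis 1 1"] by (simp add: b_def norm_axis_1)
  obtain K where K: "K \<noteq> 0" "(LINT \<eta>|lborel. b (cinv \<eta>) * of_real (norm \<eta> powr (- 4 - 2 * \<delta>))) = complex_of_real K"
    by (rule inversion_integral_nonzero[OF b _ _ b1, of "- 4 - 2 * \<delta>"]) (auto simp: br)
  \<comment> \<open>\<open>b\<close> is real, so \<open>v b\<close> is imaginary; this supplies the
    factor \<open>\<i>\<close> of the mSQG symbol and makes \<open>c\<close> real.\<close>
  have "Re (m l (coord_mult j b)) = 0" for l j
    by (rule Re_m_real[OF T0_coord_mult[OF b]]) (simp add: coord_mult_def br)
  then have "Re (v b) = 0" unfolding v_eq[OF b] by simp
  then have vb: "v b = \<i> * of_real (Im (v b))" by (simp add: complex_eq_iff)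
  define c where "c = Im (v b) / K"
  have v: "v h = \<i> * of_real c * (LINT \<zeta>|lborel. h \<zeta> * of_real (norm \<zeta> powr (2 * \<delta>)))" if "h \<in> T0" for h
  proof -
    have "v h * of_real K = \<i> * of_real (Im (v b)) * (LINT \<zeta>|lborel. h \<zeta> * of_real (norm \<zeta> powr (2 * \<delta>)))"
      using averaging[OF that b] unfolding K(2) by (subst (asm) vb)
    then show ?thesis using K(1) by (simp add: c_def field_simps)
  qed
  have "m l f = dist_of (\<lambda>\<xi>. of_real c * msqg_mult \<delta> l \<xi>) f" if f: "f \<in> T0" for f l
  proof -
    define g where "g \<xi> = f \<xi> / of_real ((norm \<xi>)\<^sup>2)" for \<xi>
    have g: "g \<in> T0" unfolding g_def[abs_def] by (rule T0_over_norm_sq[OF cutoff f])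
    \<comment> \<open>The division by \<open>|\<xi>|^2\<close> lowers the exponent
      \<open>2 * \<delta>\<close> to that of the mSQG symbol. At 0 both sides are 0 by the
      conventions for division and \<open>powr\<close>.\<close>
    have wt: "g \<xi> * of_real (norm \<xi> powr (2 * \<delta>)) = of_real (norm \<xi> powr (2 * (- 1 + \<delta>))) * f \<xi>" for \<xi>
    proof (cases "\<xi> = 0")
      case False
      then have "norm \<xi> powr (2 * (- 1 + \<delta>)) = norm \<xi> powr (2 * \<delta>) / (norm \<xi>)\<^sup>2"
      proof -
        have "2 * (- 1 + \<delta>) = 2 * \<delta> - 2" by simp
        then show ?thesis using False by (simp only: powr_diff) simp
      qed
      then show ?thesis by (simp add: g_def)
    qed (simp add: g_def)
    have cg: "coord_mult j g \<xi> * of_real (norm \<xi> powr (2 * \<delta>)) = of_real (\<xi> $ j) * of_real (norm \<xi> powr (2 * (- 1 + \<delta>))) * f \<xi>" for j \<xi>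
      unfolding coord_mult_def mult.assoc wt ..
    have m1: "m 1 f = \<i> * of_real c * (- 1) * (LINT \<zeta>|lborel. of_real (\<zeta> $ 2) * of_real (norm \<zeta> powr (2 * (- 1 + \<delta>))) * f \<zeta>)"
      unfolding recover(1)[OF f, folded g_def] v[OF T0_coord_mult[OF g]] cg by simp
    have m2: "m 2 f = \<i> * of_real c * (LINT \<zeta>|lborel. of_real (\<zeta> $ 1) * of_real (norm \<zeta> powr (2 * (- 1 + \<delta>))) * f \<zeta>)"
      unfolding recover(2)[OF f, folded g_def] v[OF T0_coord_mult[OF g]] cg ..
    have q1: "msqg_mult \<delta> 1 \<xi> = - \<i> * of_real (\<xi> $ 2) * of_real (norm \<xi> powr (2 * (- 1 + \<delta>)))"
      and q2: "msqg_mult \<delta> 2 \<xi> = \<i> * of_real (\<xi> $ 1) * of_real (norm \<xi> powr (2 * (- 1 + \<delta>)))" for \<xi>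
      by (simp_all add: msqg_mult_def levi_civita_def sum_2)
    show ?thesis
      using exhaust_2[of l] unfolding dist_of_def
    proof
      assume l: "l = 1"
      have "(LINT x|lborel. of_real c * msqg_mult \<delta> 1 x * f x) = (LINT \<zeta>|lborel. (\<i> * of_real c * (- 1)) * (of_real (\<zeta> $ 2) * of_real (norm \<zeta> powr (2 * (- 1 + \<delta>))) * f \<zeta>))"
        unfolding q1 by (intro Bochner_Integration.integral_cong refl) (simp add: mult_ac)
      then show "m l f = (LINT x|lborel. of_real c * msqg_mult \<delta> l x * f x)"
        unfolding l m1 by (simp only: integral_mult_right_zero)
    next
      assume l: "l = 2"
      have "(LINT x|lborel. of_real c * msqg_mult \<delta> 2 x * f x) = (LINT \<zeta>|lborel. (\<i> * of_real c) * (of_real (\<zeta> $ 1) * of_real (norm \<zeta> powr (2 * (- 1 + \<delta>))) * f \<zeta>))"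
        unfolding q2 by (intro Bochner_Integration.integral_cong refl) (simp add: mult_ac)
      then show "m l f = (LINT x|lborel. of_real c * msqg_mult \<delta> l x * f x)"
        unfolding l m2 by (simp only: integral_mult_right_zero)
    qed
  qed
  then show ?thesis unfolding dist_eq_on_def by blast
qed

end

theorem theorem6:
  fixes \<delta> :: real
    and m :: "2 \<Rightarrow> (plane \<Rightarrow> complex) \<Rightarrow> complex"
    and \<psi> :: "plane \<Rightarrow> complex"
  assumes "0 \<le> \<delta>" and "\<delta> \<le> 1/2"
    and "lp_cutoff \<psi>"
    and "\<And>l. distribution_on (- {0}) (m l)"
    and "\<And>l. homogeneous_dist (-1 + 2 * \<delta>) (m l)"
    and "\<And>l. reality_condition (m l)"
    and "\<exists>C::real. \<forall>\<phi> \<in> test_functions UNIV. \<forall>\<theta> \<in> schwartz0. range \<theta> \<subseteq> \<real> \<longrightarrow>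
           norm (LINT x|lborel. (\<Sum>l\<in>UNIV.
                   of_real (\<phi> x) * multiplier_op (m l) \<theta> x * partial l \<theta> x))
             \<le> C * sup_norm (tf_hessian \<phi>) * (Hdot_norm \<psi> (-1 + \<delta>) \<theta>)\<^sup>2"
  shows "\<exists>c::real. \<forall>l. dist_eq_on (- {0}) (m l) (dist_of (\<lambda>\<xi>. of_real c * msqg_mult \<delta> l \<xi>))"
proof -
  from assms(7) obtain C :: real where C: "\<forall>\<phi> \<in> test_functions UNIV. \<forall>\<theta> \<in> schwartz0. range \<theta> \<subseteq> \<real> \<longrightarrow>
           norm (LINT x|lborel. (\<Sum>l\<in>UNIV.
                   of_real (\<phi> x) * multiplier_op (m l) \<theta> x * partial l \<theta> x))
             \<le> C * sup_norm (tf_hessian \<phi>) * (Hdot_norm \<psi> (-1 + \<delta>) \<theta>)\<^sup>2" ..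
  interpret homogeneous_multiplier m \<psi> "Hdot_norm \<psi> (-1 + \<delta>)" C \<delta>
    by unfold_locales (use assms(1-6) C in auto)
  show ?thesis by (rule multiple_of_msqg)
qed

end
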